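(* Let $E$ and $F$ be complex Banach spaces, let $U$ be an open subset of $E$, let $p\in[1,\infty)$ and let $f\in\mathcal{H}^\infty(U,F)$. The following conditions are equivalent: (i) $f\colon U\to F$ has relatively $p$-compact range. (ii) $f=T\circ g$ for some complex Banach space $G$, some $g\in\mathcal{H}^\infty(U,G)$ and some $T\in\mathcal{K}_p(G,F)$. In this case, $$k_p^{\mathcal{H}^\infty}(f)=\|f\|_{\mathcal{K}_p\circ\mathcal{H}^\infty}:=\inf\{k_p(T)\|g\|_\infty\},$$ where the infimum runs over all factorizations $f=T\circ g$ as in (ii), and this infimum is attained at the factorization $f=T_f\circ g_U$. Furthermore, the mapping $f\mapsto T_f$ is an isometric isomorphism from $(\mathcal{K}_p\circ\mathcal{H}^\infty(U,F),\|\cdot\|_{\mathcal{K}_p\circ\mathcal{H}^\infty})$ onto $(\mathcal{K}_p(\mathcal{G}^\infty(U),F),k_p)$.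
   Context: $\mathcal{L}(X,Y)$ is the Banach space of bounded linear operators between Banach spaces $X,Y$; $B_X$ is the closed unit ball of $X$. $\mathcal{H}^\infty(U,F)$ is the Banach space of all bounded holomorphic mappings $f\colon U\to F$ with the supremum norm $\|\cdot\|_\infty$, and $\mathcal{H}^\infty(U)=\mathcal{H}^\infty(U,\mathbb{C})$. $p$-compactness. For $1<p<\infty$ put $p^*=p/(p-1)$ and, for $(x_n)\in\ell_p(F)$ (absolutely $p$-summable sequences in $F$, with norm $\|(x_n)\|_p=(\sum_n\|x_n\|^p)^{1/p}$), $p\text{-}\mathrm{conv}(x_n)=\{\sum_{n=1}^\infty a_nx_n\colon (a_n)\in B_{\ell_{p^*}}\}$; for $p=1$ and $(x_n)\in\ell_1(F)$, $1\text{-}\mathrm{conv}(x_n)=\{\sum_{n=1}^\infty a_nx_n\colon (a_n)\in B_{c_0}\}$. A set $K\subseteq F$ is relatively $p$-compact if $K\subseteq p\text{-}\mathrm{conv}(x_n)$ for some $(x_n)\in\ell_p(F)$; then $m_p(K)$ is the infimum of $\|(x_n)\|_p$ over all such sequences. $\mathcal{K}_p(X,Y)$ is the space of $p$-compact operators, i.e. linear $T\colon X\to Y$ with $T(B_X)$ relatively $p$-compact in $Y$, with norm $k_p(T)=m_p(T(B_X))$. A holomorphic $f\colon U\to F$ has relatively $p$-compact range if $f(U)$ is relatively $p$-compact in $F$, and then $k_p^{\mathcal{H}^\infty}(f)=m_p(f(U))$. $\mathcal{K}_p\circ\mathcal{H}^\infty(U,F)$ denotes the set of all $f\in\mathcal{H}^\infty(U,F)$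 admitting a factorization as in (ii). Linearisation (Mujica). $\mathcal{G}^\infty(U)$ is the norm-closed linear span in $\mathcal{H}^\infty(U)^*$ of the functionals $\delta(x)\colon f\mapsto f(x)$, $x\in U$; $g_U\colon U\to\mathcal{G}^\infty(U)$, $g_U(x)=\delta(x)$, is holomorphic. For $f\in\mathcal{H}^\infty(U,F)$, $T_f\in\mathcal{L}(\mathcal{G}^\infty(U),F)$ is the unique bounded linear operator with $T_f\circ g_U=f$ (it exists and $\|T_f\|=\|f\|_\infty$). *)

theory Defs
  imports "HOL-Analysis.Analysis" "HOL-Algebra.Module" "HOL-Algebra.Algebraic_Closure_Type"
begin

no_notation var (\<open>X\<index>\<close>)

section \<open>Complex normed spaces\<close>

text \<open>
  The distribution has type classes for real normed and real Banach spaces only; the complex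
  ones add a complex scalar multiplication that extends the real one.  The spaces \<open>E\<close> and \<open>F\<close>
  are types of class \<open>complex_banach\<close>.
\<close>

class complex_normed_vector = real_normed_vector +
  fixes scaleC :: "complex \<Rightarrow> 'a \<Rightarrow> 'a"  (infixr \<open>*\<^sub>C\<close> 75)
  assumes scaleC_add_right: "a *\<^sub>C (x + y) = a *\<^sub>C x + a *\<^sub>C y"
    and scaleC_add_left: "(a + b) *\<^sub>C x = a *\<^sub>C x + b *\<^sub>C x"
    and scaleC_scaleC: "a *\<^sub>C (b *\<^sub>C x) = (a * b) *\<^sub>C x"
    and scaleR_scaleC: "r *\<^sub>R x = complex_of_real r *\<^sub>C x"
    and norm_scaleC: "norm (a *\<^sub>C x) = norm a * norm x"

class complex_banach = complex_normed_vector + complete_space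

instance complex_banach \<subseteq> banach ..

instantiation complex :: complex_banach
begin
definition scaleC_complex :: "complex \<Rightarrow> complex \<Rightarrow> complex"
  where "scaleC_complex a x = a * x"
instance
  by standard (simp_all add: scaleC_complex_def algebra_simps norm_mult scaleR_conv_of_real)
end

text \<open>
  Spaces that are quantified over (the intermediate space \<open>G\<close> of a factorization) or that depend
  on a set (such as \<open>H\<^sup>\<infinity>(U)\<close>) cannot be types.  They are modules over the ring of complex numbers
  with an explicit carrier set and a norm; the fields \<open>mult\<close> and \<open>one\<close>, which the record \<open>module\<close>
  inherits from \<open>ring\<close>, play no role.
\<close>

record 'a cspace = "(complex, 'a) module" +
  vnorm :: "'a \<Rightarrow> real"

locale complex_normed_space =
  module "ring_of_type_algebra :: complex ring" X for X :: "'a cspace" (structure) +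
  assumes vnorm_eq_zero: "x \<in> carrier X \<Longrightarrow> vnorm X x = 0 \<longleftrightarrow> x = \<zero>"
    and vnorm_triangle:
      "x \<in> carrier X \<Longrightarrow> y \<in> carrier X \<Longrightarrow> vnorm X (x \<oplus> y) \<le> vnorm X x + vnorm X y"
    and vnorm_smult: "x \<in> carrier X \<Longrightarrow> vnorm X (c \<odot> x) = norm c * vnorm X x"

text \<open>The locale \<open>Metric_space\<close> wants a nonnegative symmetric distance off the carrier, too.\<close>

definition vdist :: "'a cspace \<Rightarrow> 'a \<Rightarrow> 'a \<Rightarrow> real"
  where "vdist X x y =
     (if x \<in> carrier X \<and> y \<in> carrier X then vnorm X (x \<ominus>\<^bsub>X\<^esub> y) else 0)"

context complex_normed_space
begin

lemma vnorm_uminus: "x \<in> carrier X \<Longrightarrow> vnorm X (\<ominus> x) = vnorm X x"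
proof -
  assume x: "x \<in> carrier X"
  have "\<ominus>\<^bsub>ring_of_type_algebra\<^esub> (1::complex) = -1"
    by (rule R.minus_equality) (simp_all add: ring_of_type_algebra_def)
  then have "(-1) \<odot> x = \<ominus> x"
    using smult_l_minus[of 1 x] smult_one[OF x] x by (simp add: ring_of_type_algebra_def)
  with vnorm_smult[OF x, of "-1"] show ?thesis
    by simp
qed

lemma vnorm_nonneg: "x \<in> carrier X \<Longrightarrow> 0 \<le> vnorm X x"
  using vnorm_triangle[of x "\<ominus> x"] vnorm_uminus[of x] vnorm_eq_zero[of \<zero>] by (simp add: r_neg)

lemma Metric_space_vdist: "Metric_space (carrier X) (vdist X)"
proof
  fix x y
  show "0 \<le> vdist X x y"
    by (simp add: vdist_def vnorm_nonneg)
  show "vdist X x y = vdist X y x"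
    using vnorm_uminus[of "x \<ominus> y"] by (auto simp: vdist_def a_minus_def minus_add minus_minus a_comm)
next
  fix x y
  assume xy: "x \<in> carrier X" "y \<in> carrier X"
  then have "x \<ominus> y = \<zero> \<longleftrightarrow> x = y"
    using M.minus_equality[of x "\<ominus> y"] M.minus_minus[of y] M.r_neg[of y] by (auto simp: a_minus_def)
  with xy show "vdist X x y = 0 \<longleftrightarrow> x = y"
    by (simp add: vdist_def vnorm_eq_zero)
next
  fix x y z
  assume xyz: "x \<in> carrier X" "y \<in> carrier X" "z \<in> carrier X"
  then have "x \<ominus> z = (x \<ominus> y) \<oplus> (y \<ominus> z)"
    by (simp add: a_minus_def a_assoc) (simp add: a_assoc[symmetric] l_neg)
  with xyz show "vdist X x z \<le> vdist X x y + vdist X y z"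
    by (simp add: vdist_def vnorm_triangle)
qed

end

locale complex_banach_space = complex_normed_space +
  assumes complete: "Metric_space.mcomplete (carrier X) (vdist X)"

definition unit_ball :: "'a cspace \<Rightarrow> 'a set"
  where "unit_ball X = {x \<in> carrier X. vnorm X x \<le> 1}"

definition type_space :: "'a::complex_normed_vector cspace"
  where "type_space = \<lparr>carrier = UNIV, mult = undefined, one = undefined,
           zero = 0, add = (+), smult = scaleC, vnorm = norm\<rparr>"

text \<open>Spaces of vector-valued functions with pointwise operations.\<close>

definition fun_space ::
    "('a \<Rightarrow> 'b::complex_normed_vector) set \<Rightarrow> (('a \<Rightarrow> 'b) \<Rightarrow> real) \<Rightarrow> ('a \<Rightarrow> 'b) cspace"
  where "fun_space S N = \<lparr>carrier = S, mult = undefined, one = undefined,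
           zero = (\<lambda>x. 0), add = (\<lambda>f g x. f x + g x), smult = (\<lambda>c f x. c *\<^sub>C f x), vnorm = N\<rparr>"

definition clinear_on :: "'a cspace \<Rightarrow> 'b cspace \<Rightarrow> ('a \<Rightarrow> 'b) \<Rightarrow> bool"
  where "clinear_on X Y T \<longleftrightarrow> T \<in> carrier X \<rightarrow> carrier Y \<and>
     (\<forall>x\<in>carrier X. \<forall>y\<in>carrier X. T (x \<oplus>\<^bsub>X\<^esub> y) = T x \<oplus>\<^bsub>Y\<^esub> T y) \<and>
     (\<forall>c. \<forall>x\<in>carrier X. T (c \<odot>\<^bsub>X\<^esub> x) = c \<odot>\<^bsub>Y\<^esub> T x)"

definition bounded_clinear_on :: "'a cspace \<Rightarrow> 'b cspace \<Rightarrow> ('a \<Rightarrow> 'b) \<Rightarrow> bool"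
  where "bounded_clinear_on X Y T \<longleftrightarrow> clinear_on X Y T \<and>
     (\<exists>B. \<forall>x\<in>carrier X. vnorm Y (T x) \<le> B * vnorm X x)"

text \<open>
  The space \<open>L(X,F)\<close>.  Here and below, a map defined on a subset of a type is represented by the
  function that vanishes outside this subset, so that equality of functions is equality of maps.
\<close>

definition bounded_ops :: "'a cspace \<Rightarrow> ('a \<Rightarrow> 'f::complex_normed_vector) set"
  where "bounded_ops X = {T. bounded_clinear_on X type_space T \<and> (\<forall>x. x \<notin> carrier X \<longrightarrow> T x = 0)}"

definition op_norm :: "'a cspace \<Rightarrow> ('a \<Rightarrow> 'f::complex_normed_vector) \<Rightarrow> real"
  where "op_norm X T = (SUP x\<in>unit_ball X. norm (T x))"

definition dual_space :: "'a cspace \<Rightarrow> ('a \<Rightarrow> complex) cspace"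
  where "dual_space X = fun_space (bounded_ops X) (op_norm X)"

definition closed_lin_span :: "'a cspace \<Rightarrow> 'a set \<Rightarrow> 'a set"
  where "closed_lin_span X S = Abstract_Topology.closure_of
     (Metric_space.mtopology (carrier X) (vdist X))
     ((\<lambda>V. submodule V (ring_of_type_algebra :: complex ring) X) hull S)"

definition isometric_isomorphism :: "'a cspace \<Rightarrow> 'b cspace \<Rightarrow> ('a \<Rightarrow> 'b) \<Rightarrow> bool"
  where "isometric_isomorphism X Y \<Phi> \<longleftrightarrow>
     complex_normed_space X \<and> complex_normed_space Y \<and> clinear_on X Y \<Phi> \<and>
     bij_betw \<Phi> (carrier X) (carrier Y) \<and> (\<forall>x\<in>carrier X. vnorm Y (\<Phi> x) = vnorm X x)"

section \<open>Bounded holomorphic mappings\<close>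

text \<open>
  Holomorphy is complex Frechet differentiability at every point.  For maps into a type, lemma
  \<open>holo_on_type_space\<close> below expresses it by \<open>has_derivative\<close>.
\<close>

definition holo_on :: "'e::complex_normed_vector set \<Rightarrow> 'b cspace \<Rightarrow> ('e \<Rightarrow> 'b) \<Rightarrow> bool"
  where "holo_on U Y g \<longleftrightarrow> g \<in> U \<rightarrow> carrier Y \<and>
     (\<forall>x\<in>U. \<exists>D. bounded_clinear_on type_space Y D \<and>
        ((\<lambda>y. vnorm Y ((g y \<ominus>\<^bsub>Y\<^esub> g x) \<ominus>\<^bsub>Y\<^esub> D (y - x)) / norm (y - x)) \<longlongrightarrow> 0) (at x within U))"

definition Hinf :: "'e::complex_normed_vector set \<Rightarrow> 'b cspace \<Rightarrow> ('e \<Rightarrow> 'b) set"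
  where "Hinf U Y = {g. holo_on U Y g \<and> (\<exists>B. \<forall>x\<in>U. vnorm Y (g x) \<le> B) \<and>
     (\<forall>x. x \<notin> U \<longrightarrow> g x = \<zero>\<^bsub>Y\<^esub>)}"

text \<open>The inserted \<open>0\<close> only matters for empty \<open>U\<close>, where a real supremum would be unspecified.\<close>

definition sup_norm :: "'e set \<Rightarrow> 'b cspace \<Rightarrow> ('e \<Rightarrow> 'b) \<Rightarrow> real"
  where "sup_norm U Y g = Sup (insert 0 ((\<lambda>x. vnorm Y (g x)) ` U))"

definition Hinf_space ::
    "'e::complex_normed_vector set \<Rightarrow> ('e \<Rightarrow> 'f::complex_normed_vector) cspace"
  where "Hinf_space U = fun_space (Hinf U type_space) (sup_norm U type_space)"

text \<open>\<open>delta U\<close> is the map \<open>g\<^sub>U\<close>.  It vanishes outside \<open>U\<close> since the elements of \<open>H\<^sup>\<infinity>(U)\<close> do.\<close>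

definition delta :: "'e::complex_normed_vector set \<Rightarrow> 'e \<Rightarrow> ('e \<Rightarrow> complex) \<Rightarrow> complex"
  where "delta U x = (\<lambda>f. if f \<in> Hinf U type_space then f x else 0)"

definition Ginf :: "'e::complex_normed_vector set \<Rightarrow> (('e \<Rightarrow> complex) \<Rightarrow> complex) cspace"
  where "Ginf U = (dual_space (Hinf_space U))
     \<lparr>carrier := closed_lin_span (dual_space (Hinf_space U)) (delta U ` U)\<rparr>"

definition linearization :: "'e::complex_normed_vector set \<Rightarrow> ('e \<Rightarrow> 'f::complex_normed_vector) \<Rightarrow>
    (('e \<Rightarrow> complex) \<Rightarrow> complex) \<Rightarrow> 'f"
  where "linearization U f = (THE T. T \<in> bounded_ops (Ginf U) \<and> (\<forall>x\<in>U. T (delta U x) = f x))"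

section \<open>p-compactness\<close>

definition lp :: "real \<Rightarrow> (nat \<Rightarrow> 'a::real_normed_vector) set"
  where "lp p = {x. summable (\<lambda>n. norm (x n) powr p)}"

definition lp_norm :: "real \<Rightarrow> (nat \<Rightarrow> 'a::real_normed_vector) \<Rightarrow> real"
  where "lp_norm p x = (\<Sum>n. norm (x n) powr p) powr (1 / p)"

text \<open>The unit ball of \<open>\<ell>\<^bsub>p*\<^esub>\<close> for \<open>p > 1\<close> and of \<open>c\<^sub>0\<close> for \<open>p = 1\<close>.\<close>

definition coeff_ball :: "real \<Rightarrow> (nat \<Rightarrow> complex) set"
  where "coeff_ball p =
     (if p = 1 then {a. a \<longlonglongrightarrow> 0 \<and> (\<forall>n. norm (a n) \<le> 1)}
      else {a \<in> lp (p / (p - 1)). lp_norm (p / (p - 1)) a \<le> 1})"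

definition p_conv :: "real \<Rightarrow> (nat \<Rightarrow> 'f::complex_normed_vector) \<Rightarrow> 'f set"
  where "p_conv p x = {(\<Sum>n. a n *\<^sub>C x n) | a. a \<in> coeff_ball p}"

definition rel_p_compact :: "real \<Rightarrow> 'f::complex_normed_vector set \<Rightarrow> bool"
  where "rel_p_compact p K \<longleftrightarrow> (\<exists>x\<in>lp p. K \<subseteq> p_conv p x)"

definition m_p :: "real \<Rightarrow> 'f::complex_normed_vector set \<Rightarrow> real"
  where "m_p p K = Inf {lp_norm p x | x. x \<in> lp p \<and> K \<subseteq> p_conv p x}"

definition p_compact_ops :: "real \<Rightarrow> 'a cspace \<Rightarrow> ('a \<Rightarrow> 'f::complex_normed_vector) set"
  where "p_compact_ops p X = {T. clinear_on X type_space T \<and>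
     (\<forall>x. x \<notin> carrier X \<longrightarrow> T x = 0) \<and> rel_p_compact p (T ` unit_ball X)}"

definition k_p :: "real \<Rightarrow> 'a cspace \<Rightarrow> ('a \<Rightarrow> 'f::complex_normed_vector) \<Rightarrow> real"
  where "k_p p X T = m_p p (T ` unit_ball X)"

definition p_compact_space :: "real \<Rightarrow> 'a cspace \<Rightarrow> ('a \<Rightarrow> 'f::complex_normed_vector) cspace"
  where "p_compact_space p X = fun_space (p_compact_ops p X) (k_p p X)"

definition k_p_Hinf :: "real \<Rightarrow> 'e set \<Rightarrow> ('e \<Rightarrow> 'f::complex_normed_vector) \<Rightarrow> real"
  where "k_p_Hinf p U f = m_p p (f ` U)"

section \<open>Factorization through p-compact operators\<close>

definition factorization :: "real \<Rightarrow> 'e::complex_normed_vector set \<Rightarrow>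
    ('e \<Rightarrow> 'f::complex_normed_vector) \<Rightarrow> 'g cspace \<Rightarrow> ('e \<Rightarrow> 'g) \<Rightarrow> ('g \<Rightarrow> 'f) \<Rightarrow> bool"
  where "factorization p U f G g T \<longleftrightarrow>
     complex_banach_space G \<and> g \<in> Hinf U G \<and> T \<in> p_compact_ops p G \<and> (\<forall>x\<in>U. f x = T (g x))"

text \<open>
  ``Some complex Banach space \<open>G\<close>'' has to range over the spaces whose elements are taken from
  a fixed type.  The type argument of the following definitions is this type.  The type \<open>universe\<close>
  is the sum of an arbitrary type \<open>'h\<close> and of the type containing \<open>G\<^sup>\<infinity>(U)\<close>: it has room for
  \<open>G\<^sup>\<infinity>(U)\<close> and, \<open>'h\<close> being arbitrary, for an isometric copy of any given Banach space.
\<close>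

type_synonym ('e, 'h) universe = "'h + (('e \<Rightarrow> complex) \<Rightarrow> complex)"

definition Kp_Hinf :: "'g itself \<Rightarrow> real \<Rightarrow> 'e::complex_normed_vector set \<Rightarrow>
    ('e \<Rightarrow> 'f::complex_normed_vector) set"
  where "Kp_Hinf (_ :: 'g itself) p U =
     {f \<in> Hinf U type_space. \<exists>(G :: 'g cspace) g T. factorization p U f G g T}"

definition Kp_Hinf_norm :: "'g itself \<Rightarrow> real \<Rightarrow> 'e::complex_normed_vector set \<Rightarrow>
    ('e \<Rightarrow> 'f::complex_normed_vector) \<Rightarrow> real"
  where "Kp_Hinf_norm (_ :: 'g itself) p U f =
     Inf {k_p p G T * sup_norm U G g | (G :: 'g cspace) g T. factorization p U f G g T}"

definition Kp_Hinf_space :: "'g itself \<Rightarrow> real \<Rightarrow> 'e::complex_normed_vector set \<Rightarrow>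
    ('e \<Rightarrow> 'f::complex_normed_vector) cspace"
  where "Kp_Hinf_space t p U = fun_space (Kp_Hinf t p U) (Kp_Hinf_norm t p U)"

section \<open>Agreement with the library notions for types\<close>

lemma scaleC_one: "1 *\<^sub>C x = (x :: 'a::complex_normed_vector)"
  using scaleR_scaleC[of 1 x] by simp

lemma abelian_group_type_space: "abelian_group (type_space :: 'a::complex_normed_vector cspace)"
proof (rule abelian_groupI)
  fix x :: 'a
  assume "x \<in> carrier type_space"
  show "\<exists>y\<in>carrier type_space. y \<oplus>\<^bsub>type_space\<^esub> x = \<zero>\<^bsub>type_space\<^esub>"
    by (rule bexI[of _ "- x"]) (simp_all add: type_space_def)
qed (simp_all add: type_space_def algebra_simps)

lemma minus_type_space: "x \<ominus>\<^bsub>type_space\<^esub> y = x - (y :: 'a::complex_normed_vector)"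
proof -
  interpret abelian_group "type_space :: 'a cspace"
    by (rule abelian_group_type_space)
  have "\<ominus>\<^bsub>type_space\<^esub> y = - y"
    by (rule minus_equality) (simp_all add: type_space_def)
  then show ?thesis
    by (simp add: a_minus_def type_space_def)
qed

lemma complex_normed_space_type_space:
  "complex_normed_space (type_space :: 'a::complex_normed_vector cspace)"
proof -
  have "module (ring_of_type_algebra :: complex ring) (type_space :: 'a cspace)"
    by (rule moduleI[OF cring_from_type_algebra abelian_group_type_space])
      (simp_all add: type_space_def ring_of_type_algebra_def scaleC_add_left scaleC_add_right
        scaleC_scaleC scaleC_one)
  then show ?thesis
    by (intro complex_normed_space.intro complex_normed_space_axioms.intro)
      (simp_all add: type_space_def norm_triangle_ineq norm_scaleC)
qed

lemma complex_banach_space_type_space: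
  "complex_banach_space (type_space :: 'a::complex_banach cspace)"
proof -
  have "vdist (type_space :: 'a cspace) = dist"
    by (intro ext) (simp add: vdist_def minus_type_space dist_norm, simp add: type_space_def)
  moreover have "Metric_space.mcomplete (UNIV :: 'a set) dist"
    using complete_UNIV mcomplete_iff_complete by simp
  ultimately show ?thesis
    by (intro complex_banach_space.intro complex_banach_space_axioms.intro
        complex_normed_space_type_space) (simp add: type_space_def)
qed

lemma holo_on_type_space:
  fixes f :: "'e::complex_normed_vector \<Rightarrow> 'f::complex_normed_vector"
  shows "holo_on U type_space f \<longleftrightarrow>
    (\<forall>x\<in>U. \<exists>D. (f has_derivative D) (at x within U) \<and> (\<forall>c h. D (c *\<^sub>C h) = c *\<^sub>C D h))"
proof -
  have *: "bounded_clinear_on type_space type_space D \<longleftrightarrow>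
      bounded_linear D \<and> (\<forall>c h. D (c *\<^sub>C h) = c *\<^sub>C D h)" for D :: "'e \<Rightarrow> 'f"
  proof
    assume "bounded_clinear_on type_space type_space D"
    then have D: "D (x + y) = D x + D y" "D (c *\<^sub>C x) = c *\<^sub>C D x" "\<exists>B. \<forall>x. norm (D x) \<le> B * norm x"
      for x y c
      by (auto simp: bounded_clinear_on_def clinear_on_def type_space_def)
    from D(3) obtain B where "norm (D x) \<le> norm x * B" for x
      by (metis mult.commute)
    then have "bounded_linear D"
      by (intro bounded_linear_intro[of D B]) (simp_all add: D scaleR_scaleC)
    with D show "bounded_linear D \<and> (\<forall>c h. D (c *\<^sub>C h) = c *\<^sub>C D h)"
      by simp
  next
    assume D: "bounded_linear D \<and> (\<forall>c h. D (c *\<^sub>C h) = c *\<^sub>C D h)"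
    then interpret bounded_linear D by simp
    obtain B where "norm (D x) \<le> norm x * B" for x
      using bounded by blast
    then have "\<exists>B. \<forall>x. norm (D x) \<le> B * norm x"
      by (metis mult.commute)
    with D show "bounded_clinear_on type_space type_space D"
      by (simp add: bounded_clinear_on_def clinear_on_def type_space_def add)
  qed
  have **: "(f has_derivative D) (at x within U) \<longleftrightarrow> bounded_linear D \<and>
      ((\<lambda>y. norm (f y - f x - D (y - x)) / norm (y - x)) \<longlongrightarrow> 0) (at x within U)" for D x
  proof -
    have "((\<lambda>y. ((f y - f x) - D (y - x)) /\<^sub>R norm (y - x)) \<longlongrightarrow> 0) (at x within U) \<longleftrightarrow>
        ((\<lambda>y. norm (f y - f x - D (y - x)) / norm (y - x)) \<longlongrightarrow> 0) (at x within U)"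
      by (subst tendsto_norm_zero_iff[symmetric]) (simp add: divide_inverse mult.commute)
    then show ?thesis
      unfolding has_derivative_at_within by simp
  qed
  have "vnorm type_space = (norm :: 'f \<Rightarrow> real)" "carrier type_space = (UNIV :: 'f set)"
    by (simp_all add: type_space_def)
  then show ?thesis
    unfolding holo_on_def * ** minus_type_space by auto
qed

end

theory Submission
  imports Defs "HOL-Complex_Analysis.Complex_Analysis"
begin

text \<open>
  Write \<open>B\<close> for the unit ball of \<open>G\<^sup>\<infinity>(U)\<close> and \<open>T\<^sub>f\<close> for the linearization of \<open>f\<close>.  Since
  \<open>f(x) = T\<^sub>f(\<delta>(x))\<close> with \<open>\<delta>(x) \<in> B\<close>, the range \<open>f(U)\<close> lies in \<open>T\<^sub>f(B)\<close>.  What matters is the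
  opposite estimate, that \<open>T\<^sub>f(B)\<close> is no larger than \<open>f(U)\<close> in the sense of \<open>m\<^sub>p\<close>.  Let \<open>u\<close> be a
  functional on \<open>F\<close> with \<open>|u| \<le> 1\<close> on \<open>f(U)\<close>.  Then \<open>u \<circ> f\<close> has norm at most 1, so
  \<open>|u(T\<^sub>f \<phi>)| = |\<phi>(u \<circ> f)| \<le> 1\<close> for every \<open>\<phi> \<in> B\<close>.  By the bipolar theorem, \<open>T\<^sub>f(B)\<close> is contained
  in every bounded closed absolutely convex set that contains \<open>f(U)\<close>.  A \<open>p\<close>-convex hull is such a set
  (for \<open>p = 1\<close>: once bounded coefficients replace null sequences, which costs an arbitrarily small
  enlargement of the generating sequence), and therefore \<open>m\<^sub>p(T\<^sub>f(B)) = m\<^sub>p(f(U))\<close>; see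
  \<open>m_p_polar\<close> and \<open>linearization_p_compact\<close>.

  Conversely, a factorization \<open>f = T \<circ> g\<close> gives \<open>f(U) \<subseteq> \<parallel>g\<parallel> T(B\<^sub>G)\<close> and hence
  \<open>m\<^sub>p(f(U)) \<le> k\<^sub>p(T) \<parallel>g\<parallel>\<close> (\<open>factorization_m_p_le\<close>).  With \<open>\<parallel>\<delta>\<parallel> \<le> 1\<close> this shows that the infimum
  over all factorizations is \<open>m\<^sub>p(f(U))\<close> and is attained at \<open>f = T\<^sub>f \<circ> \<delta>\<close>.  The map \<open>f \<mapsto> T\<^sub>f\<close> is a
  linear bijection with inverse \<open>T \<mapsto> T \<circ> \<delta>\<close>, because an operator on \<open>G\<^sup>\<infinity>(U)\<close> is determined by its
  values on the evaluations; the equality of norms makes it an isometry.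

  Three ingredients carry these arguments.  The theorem of Hahn and Banach is derived from the fact
  that minimal sublinear functionals are linear.  The operator \<open>T\<^sub>f\<close> is defined weakly:
  \<open>T\<^sub>f \<phi>\<close> is the vector \<open>y\<close> with \<open>u(y) = \<phi>(u \<circ> f)\<close> for all functionals \<open>u\<close>; the \<open>\<phi>\<close> that admit
  such a \<open>y\<close> form a closed subspace containing the evaluations.  And \<open>\<delta>\<close> is holomorphic because
  Cauchy's estimates on complex lines bound \<open>f(x + k) - f(x) - f'(x)k\<close> uniformly over the unit ball of
  \<open>H\<^sup>\<infinity>(U)\<close>.
\<close>

section \<open>Complex scalar multiplication\<close>

lemma scaleC_zero_left: "0 *\<^sub>C x = (0 :: 'a::complex_normed_vector)"
  using norm_scaleC[of 0 x] by simp

lemma scaleC_zero_right: "a *\<^sub>C 0 = (0 :: 'a::complex_normed_vector)"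
  using norm_scaleC[of a "0::'a"] by simp

lemma scaleC_minus1: "(-1) *\<^sub>C x = - (x :: 'a::complex_normed_vector)"
  using scaleR_scaleC[of "-1" x] by simp

lemma scaleC_minus_right: "a *\<^sub>C (- x) = - (a *\<^sub>C (x :: 'a::complex_normed_vector))"
  using scaleC_add_right[of a x "- x", symmetric]
  by (simp add: scaleC_zero_right eq_neg_iff_add_eq_0 add.commute)

lemma scaleC_diff_right: "a *\<^sub>C (x - y) = a *\<^sub>C x - a *\<^sub>C (y :: 'a::complex_normed_vector)"
  using scaleC_add_right[of a x "- y"] by (simp add: scaleC_minus_right)

lemma bounded_linear_scaleC_left: "bounded_linear (\<lambda>c. c *\<^sub>C (x :: 'a::complex_normed_vector))"
  by (rule bounded_linear_intro[where K = "norm x"])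
    (simp_all add: scaleC_add_left scaleR_scaleC scaleC_scaleC norm_scaleC scaleC_complex_def)

lemma bounded_linear_scaleC_right: "bounded_linear (\<lambda>x :: 'a::complex_normed_vector. c *\<^sub>C x)"
  by (rule bounded_linear_intro[where K = "norm c"])
    (simp_all add: scaleC_add_right scaleR_scaleC scaleC_scaleC norm_scaleC mult.commute)

section \<open>The Hahn-Banach and bipolar theorems\<close>

text \<open>
  Homogeneity is demanded as an inequality only, since scaling by \<open>1 / t\<close> reverses it.
\<close>

definition sublinear :: "('a::real_vector \<Rightarrow> real) \<Rightarrow> bool"
  where "sublinear q \<longleftrightarrow>
    (\<forall>x y. q (x + y) \<le> q x + q y) \<and> (\<forall>t>0. \<forall>x. q (t *\<^sub>R x) \<le> t * q x)"

lemma sublinear_add: "sublinear q \<Longrightarrow> q (x + y) \<le> q x + q y"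
  by (simp add: sublinear_def)

lemma sublinear_scale:
  assumes "sublinear q" and "0 < t"
  shows "q (t *\<^sub>R x) = t * q x"
proof (rule antisym)
  show "q (t *\<^sub>R x) \<le> t * q x"
    using assms by (simp add: sublinear_def)
  have "q ((1 / t) *\<^sub>R (t *\<^sub>R x)) \<le> (1 / t) * q (t *\<^sub>R x)"
    using assms unfolding sublinear_def by (metis zero_less_divide_1_iff)
  then show "t * q x \<le> q (t *\<^sub>R x)"
    using assms by (simp add: field_simps)
qed

lemma sublinear_zero:
  assumes "sublinear q" shows "q 0 = 0"
  using sublinear_scale[OF assms, of 2 0] by simp

lemma sublinear_scale_nonneg:
  assumes "sublinear q" and "0 \<le> t"
  shows "q (t *\<^sub>R x) = t * q x"
  using assms sublinear_scale[OF assms(1), of t x] sublinear_zero[OF assms(1)] by (cases "t = 0") auto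

lemma sublinear_minus_ge: "sublinear q \<Longrightarrow> - q (- x) \<le> q x"
  using sublinear_add[of q x "- x"] sublinear_zero[of q] by simp

text \<open>
  The witness is the infimum of \<open>q (x + t y) - t q y\<close> over \<open>t \<ge> 0\<close>; it is finite because
  each of these numbers is at least \<open>- q (- x)\<close>.  Two values of \<open>t\<close> matter later.  For \<open>t = 0\<close> one gets
  \<open>q' \<le> q\<close>.  For \<open>t = 1\<close> one gets \<open>q' x + q y \<le> q (x + y)\<close>, the inequality missing for additivity,
  and \<open>q' (- y) \<le> - q y\<close>, which forces a linear functional below \<open>q'\<close> to reach \<open>q\<close> at \<open>y\<close>.
\<close>

lemma sublinear_minorant:
  fixes q :: "'a::real_vector \<Rightarrow> real"
  assumes q: "sublinear q"
  obtains q' where "sublinear q'" "\<And>x t. 0 \<le> t \<Longrightarrow> q' x \<le> q (x + t *\<^sub>R y) - t * q y"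
proof -
  define g where "g x t = q (x + t *\<^sub>R y) - t * q y" for x t
  define q' where "q' x = (INF t\<in>{0..}. g x t)" for x
  have lb: "- q (- x) \<le> g x t" if "0 \<le> t" for x t
    using sublinear_add[OF q, of "x + t *\<^sub>R y" "- x"] sublinear_scale_nonneg[OF q that, of y]
    by (simp add: g_def)
  have low: "q' x \<le> g x t" if "0 \<le> t" for x t
    unfolding q'_def using that lb by (intro cINF_lower bdd_belowI[of _ "- q (- x)"]) auto
  have great: "c \<le> q' x" if "\<And>t. 0 \<le> t \<Longrightarrow> c \<le> g x t" for c x
    unfolding q'_def using that by (intro cINF_greatest) auto
  have "sublinear q'"
    unfolding sublinear_def
  proof (intro conjI allI impI)
    fix x z
    have "q' (x + z) \<le> g x s + g z t" if "0 \<le> s" "0 \<le> t" for s t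
    proof -
      have "q' (x + z) \<le> g (x + z) (s + t)"
        using that by (intro low) simp
      also have "\<dots> \<le> g x s + g z t"
        using sublinear_add[OF q, of "x + s *\<^sub>R y" "z + t *\<^sub>R y"]
        by (simp add: g_def algebra_simps)
      finally show ?thesis .
    qed
    then have "q' (x + z) - g x s \<le> q' z" if "0 \<le> s" for s
      using that by (intro great) (simp add: algebra_simps)
    then have "q' (x + z) - q' z \<le> q' x"
      by (intro great) (simp add: algebra_simps)
    then show "q' (x + z) \<le> q' x + q' z"
      by simp
  next
    fix s :: real and x
    assume s: "0 < s"
    have "q' (s *\<^sub>R x) / s \<le> g x t" if "0 \<le> t" for t
    proof -
      have "q' (s *\<^sub>R x) \<le> g (s *\<^sub>R x) (s * t)"
        using that s by (intro low) simp
      also have "\<dots> = s * g x t"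
        using sublinear_scale[OF q s, of "x + t *\<^sub>R y"] by (simp add: g_def algebra_simps)
      finally show ?thesis
        using s by (simp add: field_simps)
    qed
    then have "q' (s *\<^sub>R x) / s \<le> q' x"
      by (rule great)
    then show "q' (s *\<^sub>R x) \<le> s * q' x"
      using s by (simp add: field_simps)
  qed
  with that low show thesis
    by (simp add: g_def)
qed

text \<open>
  Zorn's lemma for the reversed pointwise order.  A chain is bounded below by its pointwise infimum,
  which is finite because every member is at least \<open>- q (- x)\<close> at \<open>x\<close>, and subadditive
  because any two members of the chain can be replaced by the smaller one.
\<close>

lemma minimal_sublinear_exists:
  fixes q :: "'a::real_vector \<Rightarrow> real"
  assumes q: "sublinear q"
  obtains m where "sublinear m" "m \<le> q" "\<And>m'. sublinear m' \<Longrightarrow> m' \<le> m \<Longrightarrow> m' = m"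
proof -
  define A where "A = {m. sublinear m \<and> m \<le> q}"
  define P where "P = (\<lambda>m m' :: 'a \<Rightarrow> real. m' \<le> m)"
  have "\<exists>m\<in>A. \<forall>a\<in>A. P m a \<longrightarrow> a = m"
  proof (rule predicate_Zorn)
    show "partial_order_on A (relation_of P A)"
      by (rule partial_order_on_relation_ofI) (auto simp: P_def)
    fix C
    assume C: "C \<in> Chains (relation_of P A)"
    then have CA: "m \<in> A" if "m \<in> C" for m
      using that by (auto simp: Chains_def relation_of_def)
    have tot: "m \<le> m' \<or> m' \<le> m" if "m \<in> C" "m' \<in> C" for m m'
      using C that by (auto simp: Chains_def relation_of_def P_def)
    show "\<exists>u\<in>A. \<forall>a\<in>C. P a u"
    proof (cases "C = {}")
      case True
      then show ?thesis
        using q by (auto simp: A_def)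
    next
      case False
      define u where "u x = (INF m\<in>C. m x)" for x
      have lb: "- q (- x) \<le> m x" if "m \<in> C" for m x
      proof -
        have "sublinear m" "m (- x) \<le> q (- x)"
          using CA[OF that] by (auto simp: A_def le_fun_def)
        then show ?thesis
          using sublinear_minus_ge[of m x] by simp
      qed
      have low: "u x \<le> m x" if "m \<in> C" for m x
        unfolding u_def using that lb by (intro cINF_lower bdd_belowI[of _ "- q (- x)"]) auto
      have great: "c \<le> u x" if "\<And>m. m \<in> C \<Longrightarrow> c \<le> m x" for c x
        unfolding u_def using that False by (intro cINF_greatest) auto
      have "sublinear u"
        unfolding sublinear_def
      proof (intro conjI allI impI)
        fix x z
        have *: "u (x + z) \<le> m x + m' z" if mm: "m \<in> C" "m' \<in> C" for m m'
        proof -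
          obtain l where l: "l \<in> C" "l \<le> m" "l \<le> m'"
            using tot[OF mm] mm by blast
          have "u (x + z) \<le> l (x + z)"
            using l low by simp
          also have "\<dots> \<le> l x + l z"
            using CA[OF l(1)] by (auto simp: A_def intro: sublinear_add)
          also have "\<dots> \<le> m x + m' z"
            using l by (intro add_mono) (auto simp: le_fun_def)
          finally show ?thesis .
        qed
        have "u (x + z) - m x \<le> u z" if "m \<in> C" for m
          using *[OF that] by (intro great) (simp add: diff_le_eq add.commute)
        then have "u (x + z) - u z \<le> u x"
          by (intro great) (simp add: algebra_simps)
        then show "u (x + z) \<le> u x + u z"
          by simp
      next
        fix s :: real and x
        assume s: "0 < s"
        have "u (s *\<^sub>R x) / s \<le> m x" if "m \<in> C" for m
        proof -
          have "m (s *\<^sub>R x) = s * m x"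
            using CA[OF that] s by (auto simp: A_def intro: sublinear_scale)
          with low[OF that, of "s *\<^sub>R x"] s show ?thesis
            by (simp add: field_simps)
        qed
        then have "u (s *\<^sub>R x) / s \<le> u x"
          by (rule great)
        then show "u (s *\<^sub>R x) \<le> s * u x"
          using s by (simp add: field_simps)
      qed
      moreover have "u \<le> q"
      proof -
        obtain m where m: "m \<in> C"
          using False by blast
        have "u \<le> m"
          using low[OF m] by (simp add: le_fun_def)
        also have "m \<le> q"
          using CA[OF m] by (simp add: A_def)
        finally show ?thesis .
      qed
      ultimately show ?thesis
        using low by (auto simp: A_def P_def le_fun_def)
    qed
  qed
  then show thesis
    using that by (auto simp: A_def P_def dest: order_trans)
qed

text \<open>
  A minimal sublinear \<open>m\<close> is linear: its minorant in a direction \<open>z\<close> coincides with it, and this says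
  \<open>m x + m z \<le> m (x + z)\<close>.  Choosing \<open>m\<close> below the minorant of \<open>q\<close> in the direction \<open>y\<close>,
  instead of below \<open>q\<close>, yields the value at \<open>y\<close>.
\<close>

theorem Hahn_Banach_sublinear:
  fixes q :: "'a::real_vector \<Rightarrow> real"
  assumes q: "sublinear q"
  obtains u where "linear u" "\<And>x. u x \<le> q x" "u y = q y"
proof -
  obtain q' where q': "sublinear q'" "\<And>x t. 0 \<le> t \<Longrightarrow> q' x \<le> q (x + t *\<^sub>R y) - t * q y"
    using sublinear_minorant[OF q] by blast
  obtain m where m: "sublinear m" "m \<le> q'" "\<And>m'. sublinear m' \<Longrightarrow> m' \<le> m \<Longrightarrow> m' = m"
    using minimal_sublinear_exists[OF q'(1)] by blast
  have mq: "m x \<le> q x" for x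
    using q'(2)[of 0 x] m(2) by (auto simp: le_fun_def intro: order_trans)
  have super: "m x + m z \<le> m (x + z)" for x z
  proof -
    obtain m' where m': "sublinear m'" "\<And>x t. 0 \<le> t \<Longrightarrow> m' x \<le> m (x + t *\<^sub>R z) - t * m z"
      using sublinear_minorant[OF m(1)] by blast
    have "m' \<le> m"
      using m'(2)[of 0] by (simp add: le_fun_def)
    with m(3) m'(1) have "m' = m"
      by blast
    with m'(2)[of 1 x] show ?thesis
      by simp
  qed
  have add: "m (x + z) = m x + m z" for x z
    using super sublinear_add[OF m(1)] by (intro antisym)
  have neg: "m (- x) = - m x" for x
    using add[of x "- x"] sublinear_zero[OF m(1)] by simp
  have "linear m"
  proof (rule linearI)
    fix r :: real and x
    show "m (r *\<^sub>R x) = r *\<^sub>R m x"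
    proof (cases "0 \<le> r")
      case True
      then show ?thesis
        using sublinear_scale_nonneg[OF m(1)] by simp
    next
      case False
      then show ?thesis
        using sublinear_scale_nonneg[OF m(1), of "- r" x] neg[of "r *\<^sub>R x"] by simp
    qed
  qed (rule add)
  moreover have "m y = q y"
  proof (rule antisym)
    have "m (- y) \<le> q' (- y)"
      using m(2) by (simp add: le_fun_def)
    also have "\<dots> \<le> q (- y + 1 *\<^sub>R y) - 1 * q y"
      by (rule q'(2)) simp
    also have "\<dots> = - q y"
      using sublinear_zero[OF q] by simp
    finally show "q y \<le> m y"
      using neg[of y] by simp
  qed (rule mq)
  ultimately show thesis
    using that mq by blast
qed

definition cfunctional :: "('a::complex_normed_vector \<Rightarrow> complex) \<Rightarrow> bool"
  where "cfunctional u \<longleftrightarrow> bounded_linear u \<and> (\<forall>c x. u (c *\<^sub>C x) = c * u x)"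

lemma cfunctionalD:
  assumes "cfunctional u"
  shows "bounded_linear u" "u (c *\<^sub>C x) = c * u x" "u (x + y) = u x + u y" "u 0 = 0" "u (x - y) = u x - u y"
proof -
  show u: "bounded_linear u" "u (c *\<^sub>C x) = c * u x"
    using assms by (simp_all add: cfunctional_def)
  interpret bounded_linear u by fact
  show "u (x + y) = u x + u y" "u 0 = 0" "u (x - y) = u x - u y"
    by (simp_all add: add zero diff)
qed

text \<open>
  A real-linear \<open>v \<le> q\<close> is the real part of the complex-linear functional \<open>v x - \<i> v (\<i> x)\<close>.  Rotating
  \<open>x\<close> so that the value of this functional becomes nonnegative turns \<open>v \<le> q\<close> into a bound for its modulus.
\<close>

lemma Hahn_Banach_seminorm:
  fixes q :: "'a::complex_normed_vector \<Rightarrow> real"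
  assumes add: "\<And>x y. q (x + y) \<le> q x + q y"
    and scale: "\<And>c x. q (c *\<^sub>C x) \<le> norm c * q x"
    and bound: "\<And>x. q x \<le> B * norm x"
  obtains u where "cfunctional u" "\<And>x. norm (u x) \<le> q x" "u y = of_real (q y)"
proof -
  have "sublinear q"
    unfolding sublinear_def scaleR_scaleC
    using add scale by (metis abs_of_pos norm_of_real)
  then obtain v where v: "linear v" "\<And>x. v x \<le> q x" "v y = q y"
    using Hahn_Banach_sublinear by metis
  interpret v: linear v by fact
  define u where "u x = Complex (v x) (- v (\<i> *\<^sub>C x))" for x
  have u_add: "u (x + z) = u x + u z" for x z
    by (simp add: u_def v.add scaleC_add_right complex_eq_iff)
  have u_scale: "u (c *\<^sub>C x) = c * u x" for c x
  proof -
    have 1: "c *\<^sub>C x = Re c *\<^sub>R x + Im c *\<^sub>R (\<i> *\<^sub>C x)"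
    proof -
      have "c = of_real (Re c) + of_real (Im c) * \<i>"
        by (simp add: complex_eq_iff)
      then have "c *\<^sub>C x = (of_real (Re c) + of_real (Im c) * \<i>) *\<^sub>C x"
        by simp
      then show ?thesis
        by (simp add: scaleR_scaleC scaleC_add_left scaleC_scaleC)
    qed
    have 2: "\<i> *\<^sub>C (c *\<^sub>C x) = Re c *\<^sub>R (\<i> *\<^sub>C x) - Im c *\<^sub>R x"
    proof -
      have "\<i> * c = of_real (Re c) * \<i> + of_real (- Im c)"
        by (simp add: complex_eq_iff)
      then have "\<i> *\<^sub>C (c *\<^sub>C x) = (of_real (Re c) * \<i> + of_real (- Im c)) *\<^sub>C x"
        by (simp add: scaleC_scaleC)
      also have "\<dots> = Re c *\<^sub>R (\<i> *\<^sub>C x) + (- Im c) *\<^sub>R x"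
        by (simp only: scaleR_scaleC scaleC_add_left scaleC_scaleC)
      finally show ?thesis
        by simp
    qed
    show ?thesis
      unfolding u_def 2 unfolding 1 by (simp add: v.add v.scale v.diff complex_eq_iff)
  qed
  have u_le: "norm (u x) \<le> q x" for x
  proof (cases "u x = 0")
    case True
    then show ?thesis
      using v(2)[of x] v(2)[of "- x"] scale[of "-1" x] v.neg[of x] scaleR_scaleC[of "-1" x] by simp
  next
    case False
    define c where "c = cnj (u x) / norm (u x)"
    have c: "norm c = 1" "c * u x = norm (u x)"
      using False by (simp_all add: c_def norm_divide complex_norm_square[symmetric] mult.commute
          power2_eq_square)
    have "norm (u x) = Re (u (c *\<^sub>C x))"
      by (simp add: u_scale c)
    also have "\<dots> = v (c *\<^sub>C x)"
      by (simp add: u_def)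
    also have "\<dots> \<le> q (c *\<^sub>C x)"
      by (rule v)
    also have "\<dots> \<le> q x"
      using scale[of c x] c by simp
    finally show ?thesis .
  qed
  have "bounded_linear u"
    using u_add u_scale[of "of_real _"] order_trans[OF u_le bound]
    by (intro bounded_linear_intro[where K = B]) (simp_all add: scaleR_scaleC scaleC_complex_def mult.commute)
  moreover have "u y = of_real (q y)"
  proof -
    have "Re (u y) = q y"
      by (simp add: u_def v)
    moreover have "(norm (u y))\<^sup>2 \<le> (q y)\<^sup>2"
      using u_le by (intro power_mono) auto
    ultimately have "Im (u y) = 0"
      by (simp add: cmod_power2)
    then show ?thesis
      using \<open>Re (u y) = q y\<close> by (simp add: complex_eq_iff)
  qed
  ultimately show thesis
    using that[of u] u_scale u_le by (simp add: cfunctional_def)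
qed

corollary norming_functional:
  fixes y :: "'a::complex_normed_vector"
  obtains u where "cfunctional u" "\<And>x. norm (u x) \<le> norm x" "u y = of_real (norm y)"
  using Hahn_Banach_seminorm[of norm 1] by (metis norm_triangle_ineq norm_scaleC mult_1 order_refl)

lemma functionals_separate:
  fixes y z :: "'f::complex_normed_vector"
  assumes "\<And>u. cfunctional u \<Longrightarrow> u y = u z"
  shows "y = z"
proof -
  obtain u where u: "cfunctional u" "u (y - z) = of_real (norm (y - z))"
    using norming_functional[of "y - z"] by blast
  then show ?thesis
    using assms[OF u(1)] cfunctionalD(5)[OF u(1), of y z] by simp
qed

definition abs_convex :: "'a::complex_normed_vector set \<Rightarrow> bool"
  where "abs_convex C \<longleftrightarrow>
    (\<forall>x\<in>C. \<forall>y\<in>C. \<forall>a b. norm a + norm b \<le> 1 \<longrightarrow> a *\<^sub>C x + b *\<^sub>C y \<in> C)"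

lemma abs_convex_scale:
  assumes "abs_convex C" "x \<in> C" "norm a \<le> 1"
  shows "a *\<^sub>C x \<in> C"
  using assms(1)[unfolded abs_convex_def, rule_format, OF assms(2,2), of a 0] assms(3)
  by (simp add: scaleC_zero_left)

text \<open>
  The bipolar theorem.  For \<open>e > 0\<close> let \<open>q x\<close> be the infimum of \<open>t + \<parallel>x - t c\<parallel> / e\<close> over \<open>t \<ge> 0\<close> and
  \<open>c \<in> C\<close>.  This is a seminorm with \<open>q \<le> 1\<close> on \<open>C\<close> and \<open>q x \<le> \<parallel>x\<parallel> / e\<close>.  A functional dominated by
  \<open>q\<close> that attains \<open>q\<close> at \<open>y\<close> is bounded by 1 on \<open>C\<close>; hence \<open>q y \<le> 1\<close>, and a nearly optimal choice of \<open>t\<close>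
  and \<open>c\<close> provides a point of \<open>C\<close> whose distance to \<open>y\<close> is of order \<open>e\<close>.
\<close>

lemma closure_abs_convex_if_functionals:
  fixes C :: "'a::complex_normed_vector set"
  assumes C: "abs_convex C" "C \<noteq> {}" "bounded C"
    and le: "\<And>u. cfunctional u \<Longrightarrow> (\<And>x. x \<in> C \<Longrightarrow> norm (u x) \<le> 1) \<Longrightarrow> norm (u y) \<le> 1"
  shows "y \<in> closure C"
proof -
  obtain M where M: "M > 0" "\<And>x. x \<in> C \<Longrightarrow> norm x \<le> M"
    using C(3) by (auto simp: bounded_pos)
  have approx: "\<exists>c\<in>C. norm (y - c) \<le> e * (1 + e) + e * M" if e: "0 < e" for e
  proof -
    define S where "S x = {t + norm (x - t *\<^sub>R c) / e | t c. 0 \<le> t \<and> c \<in> C}" for x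
    define q where "q x = Inf (S x)" for x
    have low: "q x \<le> t + norm (x - t *\<^sub>R c) / e" if "0 \<le> t" "c \<in> C" for x t c
      unfolding q_def using that e
      by (intro cInf_lower bdd_belowI[of _ 0]) (auto simp: S_def)
    have great: "b \<le> q x" if "\<And>t c. 0 \<le> t \<Longrightarrow> c \<in> C \<Longrightarrow> b \<le> t + norm (x - t *\<^sub>R c) / e" for b x
    proof -
      obtain c where "c \<in> C"
        using C(2) by blast
      then have "0 + norm (x - 0 *\<^sub>R c) / e \<in> S x"
        unfolding S_def by blast
      with that show ?thesis
        unfolding q_def by (intro cInf_greatest) (auto simp: S_def)
    qed
    have ex: "\<exists>t c. 0 \<le> t \<and> c \<in> C \<and> t + norm (x - t *\<^sub>R c) / e < b" if "q x < b" for b x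
      using great[of b x] that by (meson not_le)
    have "q (x + z) \<le> q x + q z" for x z
    proof -
      have *: "q (x + z) \<le> (s + norm (x - s *\<^sub>R c) / e) + (t + norm (z - t *\<^sub>R d) / e)"
        if st: "0 \<le> s" "0 \<le> t" "c \<in> C" "d \<in> C" for s t c d
      proof (cases "s + t = 0")
        case True
        then have "s = 0" "t = 0"
          using st by auto
        have "q (x + z) \<le> norm (x + z) / e"
          using low[of 0 c "x + z"] st by simp
        also have "\<dots> \<le> norm x / e + norm z / e"
          using e norm_triangle_ineq[of x z] by (simp add: field_simps)
        finally show ?thesis
          using \<open>s = 0\<close> \<open>t = 0\<close> by simp
      next
        case False
        define w where "w = (s / (s + t)) *\<^sub>R c + (t / (s + t)) *\<^sub>R d"
        have "w \<in> C"
          unfolding w_def scaleR_scaleC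
          using False st
          by (intro C(1)[unfolded abs_convex_def, rule_format])
            (simp_all add: norm_divide add_divide_distrib[symmetric] flip: of_real_add)
        have w: "(s + t) *\<^sub>R w = s *\<^sub>R c + t *\<^sub>R d"
          using False by (simp add: w_def scaleR_add_right)
        have "q (x + z) \<le> (s + t) + norm (x + z - (s + t) *\<^sub>R w) / e"
          using st \<open>w \<in> C\<close> by (intro low) auto
        also have "norm (x + z - (s + t) *\<^sub>R w) \<le> norm (x - s *\<^sub>R c) + norm (z - t *\<^sub>R d)"
          unfolding w using norm_triangle_ineq[of "x - s *\<^sub>R c" "z - t *\<^sub>R d"]
          by (simp add: algebra_simps)
        finally show ?thesis
          using e by (simp add: add_divide_distrib divide_right_mono)
      qed
      have "q (x + z) - (s + norm (x - s *\<^sub>R c) / e) \<le> q z" if "0 \<le> s" "c \<in> C" for s c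
        using *[OF that(1) _ that(2)] by (intro great) (simp add: diff_le_eq add.commute)
      then have "q (x + z) - q z \<le> q x"
        by (intro great) (simp add: algebra_simps)
      then show ?thesis
        by simp
    qed
    moreover have "q (a *\<^sub>C x) \<le> norm a * q x" for a x
    proof (cases "a = 0")
      case True
      then show ?thesis
        using C(2) low[of 0 _ 0] by (auto simp: scaleC_zero_left)
    next
      case False
      have "q (a *\<^sub>C x) / norm a \<le> t + norm (x - t *\<^sub>R c) / e" if tc: "0 \<le> t" "c \<in> C" for t c
      proof -
        define d where "d = (a / norm a) *\<^sub>C c"
        have "d \<in> C"
          unfolding d_def using tc C(1) False by (intro abs_convex_scale) (simp_all add: norm_divide)
        then have "q (a *\<^sub>C x) \<le> norm a * t + norm (a *\<^sub>C x - (norm a * t) *\<^sub>R d) / e"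
          using tc by (intro low) auto
        also have "a *\<^sub>C x - (norm a * t) *\<^sub>R d = a *\<^sub>C (x - t *\<^sub>R c)"
        proof -
          have "a *\<^sub>C x = a *\<^sub>C (x - t *\<^sub>R c) + a *\<^sub>C (t *\<^sub>R c)"
            by (simp flip: scaleC_add_right)
          moreover have "a *\<^sub>C (t *\<^sub>R c) = (norm a * t) *\<^sub>R d"
            using False by (simp add: d_def scaleR_scaleC scaleC_scaleC mult.commute)
          ultimately show ?thesis
            by simp
        qed
        finally show ?thesis
          using False by (simp add: norm_scaleC field_simps)
      qed
      then have "q (a *\<^sub>C x) / norm a \<le> q x"
        by (rule great)
      then show ?thesis
        using False by (simp add: field_simps)
    qed
    moreover have "q x \<le> (1 / e) * norm x" for x
      using low[of 0 _ x] C(2) by auto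
    ultimately obtain u where u: "cfunctional u" "\<And>x. norm (u x) \<le> q x" "u y = of_real (q y)"
      using Hahn_Banach_seminorm[of q "1 / e"] by metis
    have "q x \<le> 1" if "x \<in> C" for x
      using low[of 1 x x] that by simp
    then have "norm (u x) \<le> 1" if "x \<in> C" for x
      using order_trans[OF u(2)] that by blast
    then have "norm (u y) \<le> 1"
      by (rule le[OF u(1)])
    with u(3) have "q y < 1 + e"
      using e by simp
    then obtain t c where tc: "0 \<le> t" "c \<in> C" "t + norm (y - t *\<^sub>R c) / e < 1 + e"
      using ex by blast
    \<comment> \<open>\<open>t\<close> may exceed 1 by less than \<open>e\<close>; cutting it off keeps the point in \<open>C\<close>.\<close>
    define s where "s = min t 1"
    have "s *\<^sub>R c \<in> C"
      unfolding scaleR_scaleC using tc by (intro abs_convex_scale[OF C(1)]) (auto simp: s_def)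
    have "0 \<le> norm (y - t *\<^sub>R c) / e"
      using e by simp
    then have t: "t < 1 + e"
      using tc(3) by linarith
    have "norm (y - t *\<^sub>R c) / e < 1 + e"
      using tc by linarith
    then have "norm (y - t *\<^sub>R c) \<le> e * (1 + e)"
      using e by (simp add: field_simps)
    moreover have "norm (t *\<^sub>R c - s *\<^sub>R c) \<le> e * M"
    proof -
      have "norm (t *\<^sub>R c - s *\<^sub>R c) = \<bar>t - s\<bar> * norm c"
        by (simp flip: scaleR_diff_left)
      also have "\<dots> \<le> e * M"
        using t e M(2)[OF tc(2)] by (intro mult_mono) (auto simp: s_def)
      finally show ?thesis .
    qed
    ultimately have "norm (y - s *\<^sub>R c) \<le> e * (1 + e) + e * M"
      using norm_triangle_ineq[of "y - t *\<^sub>R c" "t *\<^sub>R c - s *\<^sub>R c"] by simp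
    with \<open>s *\<^sub>R c \<in> C\<close> show ?thesis
      by blast
  qed
  show ?thesis
    unfolding closure_approachable
  proof (intro allI impI)
    fix r :: real
    assume r: "0 < r"
    have "((\<lambda>e. e * (1 + e) + e * M) \<longlongrightarrow> 0 * (1 + 0) + 0 * M) (at_right 0)"
      by (intro tendsto_intros)
    then have "eventually (\<lambda>e. e * (1 + e) + e * M < r) (at_right 0)"
      using r by (intro order_tendstoD(2)) auto
    then have "eventually (\<lambda>e. 0 < e \<and> e * (1 + e) + e * M < r) (at_right 0)"
      using eventually_at_right_less by (rule eventually_conj[rotated])
    from eventually_happens'[OF _ this] obtain e where e: "0 < e" "e * (1 + e) + e * M < r"
      by auto
    obtain c where "c \<in> C" "norm (y - c) \<le> e * (1 + e) + e * M"
      using approx[OF e(1)] by blast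
    with e(2) show "\<exists>c\<in>C. dist c y < r"
      by (intro bexI[of _ c]) (simp_all add: dist_norm norm_minus_commute)
  qed
qed

section \<open>Compactness of p-convex hulls\<close>

text \<open>
  For \<open>p > 1\<close> this is \<open>coeff_ball p\<close>; for \<open>p = 1\<close> the unit ball of \<open>\<ell>\<^sub>\<infinity>\<close> replaces the one of \<open>c\<^sub>0\<close>.
  Conditions on finitely many coefficients at a time make it visibly closed in the product topology, in
  which it is even compact.
\<close>

definition coeff_closure :: "real \<Rightarrow> (nat \<Rightarrow> complex) set"
  where "coeff_closure p =
     (if p = 1 then {a. \<forall>n. norm (a n) \<le> 1}
      else {a. \<forall>N. (\<Sum>n<N. norm (a n) powr (p / (p - 1))) \<le> 1})"

lemma coeff_ball_iff_suminf:
  assumes "1 < p"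
  shows "a \<in> coeff_ball p \<longleftrightarrow> summable (\<lambda>n. norm (a n) powr (p / (p - 1))) \<and>
    (\<Sum>n. norm (a n) powr (p / (p - 1))) \<le> 1"
proof -
  have "s powr (1 / (p / (p - 1))) \<le> 1 \<longleftrightarrow> s \<le> 1" if "0 \<le> s" for s :: real
  proof -
    have "0 < 1 / (p / (p - 1))"
      using assms by simp
    then show ?thesis
      using that powr_less_mono2[of "1 / (p / (p - 1))" 1 s] powr_mono2[of "1 / (p / (p - 1))" s 1]
      by (auto simp: not_le[symmetric] simp del: divide_divide_eq_right)
  qed
  moreover have "0 \<le> (\<Sum>n. norm (a n) powr (p / (p - 1)))"
      if "summable (\<lambda>n. norm (a n) powr (p / (p - 1)))"
    using that by (simp add: suminf_nonneg)
  ultimately show ?thesis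
    using assms by (auto simp: coeff_ball_def lp_def lp_norm_def)
qed

lemma coeff_ball_eq_closure:
  assumes "1 < p"
  shows "coeff_ball p = coeff_closure p"
proof (rule Set.set_eqI)
  fix a :: "nat \<Rightarrow> complex"
  let ?f = "\<lambda>n. norm (a n) powr (p / (p - 1))"
  have "(summable ?f \<and> suminf ?f \<le> 1) \<longleftrightarrow> (\<forall>N. sum ?f {..<N} \<le> 1)"
  proof (intro iffI conjI allI)
    fix N
    assume "summable ?f \<and> suminf ?f \<le> 1"
    then show "sum ?f {..<N} \<le> 1"
      using sum_le_suminf[of ?f "{..<N}"] by (simp add: order_trans)
  next
    assume *: "\<forall>N. sum ?f {..<N} \<le> 1"
    then show **: "summable ?f"
      by (intro summableI_nonneg_bounded[where x = 1]) auto
    with * show "suminf ?f \<le> 1"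
      by (intro suminf_le_const) auto
  qed
  then show "a \<in> coeff_ball p \<longleftrightarrow> a \<in> coeff_closure p"
    using assms by (simp add: coeff_ball_iff_suminf coeff_closure_def)
qed

lemma coeff_ball_subset_closure: "1 \<le> p \<Longrightarrow> coeff_ball p \<subseteq> coeff_closure p"
  by (cases "p = 1") (auto simp: coeff_ball_eq_closure, auto simp: coeff_ball_def coeff_closure_def)

lemma coeff_closure_norm_le_1:
  assumes "1 \<le> p" "a \<in> coeff_closure p"
  shows "norm (a n) \<le> 1"
proof (cases "p = 1")
  case True
  then show ?thesis
    using assms by (simp add: coeff_closure_def)
next
  case False
  have "norm (a n) powr (p / (p - 1)) \<le> (\<Sum>k<Suc n. norm (a k) powr (p / (p - 1)))"
    by (rule member_le_sum) auto
  also have "\<dots> \<le> 1"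
    using False assms unfolding coeff_closure_def by (simp del: sum.lessThan_Suc)
  finally show ?thesis
    using gr_one_powr[of "norm (a n)" "p / (p - 1)"] False assms by (force simp: not_less[symmetric])
qed

text \<open>
  Young's inequality after division of \<open>x\<close> by the \<open>\<ell>\<^sub>p\<close> norm \<open>s\<close> of its restriction to \<open>A\<close>.
\<close>

lemma Hoelder_coeff_closure:
  assumes p: "1 \<le> p" and a: "a \<in> coeff_closure p" and A: "finite A"
  shows "(\<Sum>n\<in>A. norm (a n *\<^sub>C x n)) \<le> (\<Sum>n\<in>A. norm (x n) powr p) powr (1 / p)"
proof (cases "p = 1")
  case True
  then show ?thesis
    using coeff_closure_norm_le_1[OF p a]
    by (auto simp: norm_scaleC sum_nonneg intro!: sum_mono mult_left_le_one_le)
next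
  case False
  define q where "q = p / (p - 1)"
  have pq: "1 < p" "1 < q" "1 / p + 1 / q = 1"
    using False p by (auto simp: q_def field_simps)
  define S where "S = (\<Sum>n\<in>A. norm (x n) powr p)"
  define s where "s = S powr (1 / p)"
  have "0 \<le> S"
    by (simp add: S_def sum_nonneg)
  have s: "s powr p = S"
    using pq \<open>0 \<le> S\<close> by (simp add: s_def powr_powr)
  show ?thesis
  proof (cases "S = 0")
    case True
    then have "norm (x n) powr p = 0" if "n \<in> A" for n
      using that A sum_nonneg_eq_0_iff[of A "\<lambda>n. norm (x n) powr p"] by (simp add: S_def)
    then have "(\<Sum>n\<in>A. norm (a n *\<^sub>C x n)) = 0"
      by (simp add: norm_scaleC)
    then show ?thesis
      by simp
  next
    case False
    then have "0 < s"
      using \<open>0 \<le> S\<close> by (simp add: s_def)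
    obtain N where N: "A \<subseteq> {..<N}"
      using finite_nat_bounded[OF A] by blast
    have "(\<Sum>n\<in>A. norm (a n *\<^sub>C x n)) / s = (\<Sum>n\<in>A. norm (x n) / s * norm (a n))"
      by (simp add: sum_divide_distrib norm_scaleC mult.commute)
    also have "\<dots> \<le> (\<Sum>n\<in>A. (norm (x n) / s) powr p / p + norm (a n) powr q / q)"
      using pq \<open>0 < s\<close> by (intro sum_mono Youngs_inequality) auto
    also have "\<dots> = (\<Sum>n\<in>A. norm (x n) powr p) / S / p + (\<Sum>n\<in>A. norm (a n) powr q) / q"
      using \<open>0 < s\<close> by (simp add: sum.distrib sum_divide_distrib powr_divide s)
    also have "\<dots> \<le> 1 / p + 1 / q"
    proof -
      have "(\<Sum>n\<in>A. norm (a n) powr q) \<le> (\<Sum>n<N. norm (a n) powr q)"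
        using N by (intro sum_mono2) auto
      also have "\<dots> \<le> 1"
        using a pq by (simp add: coeff_closure_def q_def)
      finally have "(\<Sum>n\<in>A. norm (a n) powr q) / q \<le> 1 / q"
        using pq by (simp add: divide_right_mono)
      moreover have "(\<Sum>n\<in>A. norm (x n) powr p) / S / p = 1 / p"
        using False by (simp add: S_def)
      ultimately show ?thesis
        by simp
    qed
    finally show ?thesis
      using \<open>0 < s\<close> pq by (simp add: s_def S_def)
  qed
qed

lemma lp_norm_nonneg: "0 \<le> lp_norm p x"
  by (simp add: lp_norm_def)

lemma sum_le_lp_norm:
  assumes "1 \<le> p" "x \<in> lp p" "finite A"
  shows "(\<Sum>n\<in>A. norm (x n) powr p) powr (1 / p) \<le> lp_norm p x"
  unfolding lp_norm_def using assms
  by (intro powr_mono2 sum_le_suminf sum_nonneg) (auto simp: lp_def)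

lemma summable_coeff_closure:
  fixes x :: "nat \<Rightarrow> 'a::complex_normed_vector"
  assumes "1 \<le> p" "a \<in> coeff_closure p" "x \<in> lp p"
  shows "summable (\<lambda>n. norm (a n *\<^sub>C x n))" "(\<Sum>n. norm (a n *\<^sub>C x n)) \<le> lp_norm p x"
proof -
  have *: "(\<Sum>n\<in>A. norm (a n *\<^sub>C x n)) \<le> lp_norm p x" if "finite A" for A
    using Hoelder_coeff_closure[OF assms(1,2) that] sum_le_lp_norm[OF assms(1,3) that]
    by (rule order_trans)
  show "summable (\<lambda>n. norm (a n *\<^sub>C x n))"
    using * by (intro summableI_nonneg_bounded) auto
  then show "(\<Sum>n. norm (a n *\<^sub>C x n)) \<le> lp_norm p x"
    using * by (intro suminf_le_const) auto
qed

definition closed_p_conv :: "real \<Rightarrow> (nat \<Rightarrow> 'f::complex_normed_vector) \<Rightarrow> 'f set"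
  where "closed_p_conv p x = (\<lambda>a. \<Sum>n. a n *\<^sub>C x n) ` coeff_closure p"

lemma p_conv_subset_closed: "1 \<le> p \<Longrightarrow> p_conv p x \<subseteq> closed_p_conv p x"
  using coeff_ball_subset_closure by (auto simp: p_conv_def closed_p_conv_def)

lemma norm_closed_p_conv_le:
  fixes x :: "nat \<Rightarrow> 'f::complex_banach"
  assumes "1 \<le> p" "x \<in> lp p" "y \<in> closed_p_conv p x"
  shows "norm y \<le> lp_norm p x"
proof -
  obtain a where a: "a \<in> coeff_closure p" "y = (\<Sum>n. a n *\<^sub>C x n)"
    using assms(3) by (auto simp: closed_p_conv_def)
  then show ?thesis
    using summable_norm[OF summable_coeff_closure(1)[OF assms(1) a(1) assms(2)]]
      summable_coeff_closure(2)[OF assms(1) a(1) assms(2)] by simp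
qed

lemma compact_coeff_closure:
  assumes p: "1 \<le> p"
  shows "compact (coeff_closure p)"
proof -
  have "compactin (product_topology (\<lambda>_. euclidean) UNIV) (PiE UNIV (\<lambda>_. cball (0::complex) 1))"
    by (subst compactin_PiE) auto
  then have cube: "compact (PiE UNIV (\<lambda>_::nat. cball (0::complex) 1))"
    by (simp add: euclidean_product_topology)
  have "closed (coeff_closure p)"
  proof (cases "p = 1")
    case True
    then show ?thesis
      by (auto simp: coeff_closure_def intro!: closed_Collect_all closed_Collect_le continuous_intros)
  next
    case False
    then show ?thesis
      using p
      by (auto simp: coeff_closure_def
          intro!: closed_Collect_all closed_Collect_le continuous_intros continuous_on_powr')
  qed
  moreover have "coeff_closure p \<subseteq> PiE UNIV (\<lambda>_. cball 0 1)"
    using coeff_closure_norm_le_1[OF p] by auto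
  ultimately show ?thesis
    by (metis compact_Int_closed[OF cube] inf.absorb2)
qed

text \<open>
  By Hoelder's inequality, the tails of \<open>\<Sum> a\<^sub>n x\<^sub>n\<close> are bounded by the \<open>\<ell>\<^sub>p\<close> tails of \<open>x\<close>, uniformly in the
  coefficients.  So the sum is a uniform limit of functions that are continuous in the product
  topology, and the hull is the continuous image of a compact set.
\<close>

lemma compact_closed_p_conv:
  fixes x :: "nat \<Rightarrow> 'f::complex_banach"
  assumes p: "1 \<le> p" and x: "x \<in> lp p"
  shows "compact (closed_p_conv p x)"
proof -
  define f where "f N a = (\<Sum>n<N. a n *\<^sub>C x n)" for N and a :: "nat \<Rightarrow> complex"
  have "uniformly_Cauchy_on (coeff_closure p) f"
    unfolding uniformly_Cauchy_on_def
  proof (intro allI impI)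
    fix e :: real
    assume e: "0 < e"
    have "Cauchy (\<lambda>N. \<Sum>n<N. norm (x n) powr p)"
      using x by (intro convergent_Cauchy) (simp add: lp_def summable_iff_convergent)
    then obtain M where
      M: "\<And>m n. M \<le> m \<Longrightarrow> M \<le> n \<Longrightarrow> \<bar>(\<Sum>k<m. norm (x k) powr p) - (\<Sum>k<n. norm (x k) powr p)\<bar> < e powr p"
      unfolding Cauchy_def dist_real_def using e by (metis powr_gt_zero less_irrefl)
    have half: "dist (f m a) (f n a) < e" if "a \<in> coeff_closure p" "M \<le> m" "m \<le> n" for a m n
    proof -
      have split: "{..<n} - {..<m} = {m..<n}" "{..<m} \<subseteq> {..<n}"
        using that by auto
      have "dist (f m a) (f n a) = norm (\<Sum>k\<in>{m..<n}. a k *\<^sub>C x k)"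
        using sum_diff[of "{..<n}" "{..<m}" "\<lambda>k. a k *\<^sub>C x k"] split
        by (simp add: f_def dist_norm norm_minus_commute)
      also have "\<dots> \<le> (\<Sum>k\<in>{m..<n}. norm (a k *\<^sub>C x k))"
        by (rule norm_sum)
      also have "\<dots> \<le> (\<Sum>k\<in>{m..<n}. norm (x k) powr p) powr (1 / p)"
        using p that by (intro Hoelder_coeff_closure) auto
      also have "\<dots> < (e powr p) powr (1 / p)"
      proof (rule powr_less_mono2)
        show "(\<Sum>k\<in>{m..<n}. norm (x k) powr p) < e powr p"
          using M[of n m] that sum_diff[of "{..<n}" "{..<m}" "\<lambda>k. norm (x k) powr p"] split by simp
      qed (use p in \<open>auto intro: sum_nonneg\<close>)
      also have "\<dots> = e"
        using p e by (simp add: powr_powr)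
      finally show ?thesis .
    qed
    have "dist (f m a) (f n a) < e" if "a \<in> coeff_closure p" "M \<le> m" "M \<le> n" for a m n
      using half[OF that(1,2)] half[OF that(1,3)] by (metis dist_commute linear)
    then show "\<exists>M. \<forall>a\<in>coeff_closure p. \<forall>m\<ge>M. \<forall>n\<ge>M. dist (f m a) (f n a) < e"
      by blast
  qed
  then have "uniformly_convergent_on (coeff_closure p) f"
    by (rule Cauchy_uniformly_convergent)
  then have "uniform_limit (coeff_closure p) f (\<lambda>a. lim (\<lambda>N. f N a)) sequentially"
    by (simp add: uniformly_convergent_uniform_limit_iff)
  moreover have "(\<lambda>a. lim (\<lambda>N. f N a)) = (\<lambda>a. \<Sum>n. a n *\<^sub>C x n)"
    by (simp add: f_def suminf_eq_lim)
  moreover have "continuous_on (coeff_closure p) (f N)" for N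
    unfolding f_def
    by (intro continuous_on_sum bounded_linear.continuous_on[OF bounded_linear_scaleC_left]
        continuous_on_subset[OF continuous_on_product_coordinates]) auto
  ultimately have "continuous_on (coeff_closure p) (\<lambda>a. \<Sum>n. a n *\<^sub>C x n)"
    by (metis (mono_tags, lifting) always_eventually uniform_limit_theorem sequentially_bot)
  then show ?thesis
    unfolding closed_p_conv_def using compact_coeff_closure[OF p] by (rule compact_continuous_image)
qed

text \<open>
  Convexity of the power with the weight \<open>1 - s - t\<close> at the origin.  It comes from Young's inequality for
  the products of \<open>u\<close> and \<open>v\<close> with \<open>w\<^sup>q\<^sup>-\<^sup>1\<close>, where \<open>w = s u + t v\<close>.
\<close>

lemma powr_subconvex:
  fixes u v :: real
  assumes q: "1 < q" and "0 \<le> u" "0 \<le> v" "0 \<le> s" "0 \<le> t" "s + t \<le> 1"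
  shows "(s * u + t * v) powr q \<le> s * u powr q + t * v powr q"
proof -
  define w where "w = s * u + t * v"
  define p where "p = q / (q - 1)"
  have p: "1 < p" "1 / q + 1 / p = 1" "(q - 1) * p = q"
    using q by (auto simp: p_def field_simps)
  have w: "0 \<le> w"
    using assms by (simp add: w_def)
  have young: "z * w powr (q - 1) \<le> z powr q / q + w powr q / p" if "0 \<le> z" for z
    using Youngs_inequality[of q p z "w powr (q - 1)"] q p w that by (simp add: powr_powr)
  have "w powr q = w * w powr (q - 1)"
    using w q by (cases "w = 0") (simp_all add: powr_diff)
  also have "\<dots> = s * (u * w powr (q - 1)) + t * (v * w powr (q - 1))"
    by (simp add: w_def algebra_simps)
  also have "\<dots> \<le> s * (u powr q / q + w powr q / p) + t * (v powr q / q + w powr q / p)"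
    using assms by (intro add_mono mult_left_mono young) auto
  also have "\<dots> = (s * u powr q + t * v powr q) / q + (s + t) * (w powr q / p)"
    by (simp add: algebra_simps add_divide_distrib)
  also have "\<dots> \<le> (s * u powr q + t * v powr q) / q + 1 * (w powr q / p)"
    using assms p by (intro add_left_mono mult_right_mono) auto
  finally have "w powr q * (1 - 1 / p) \<le> (s * u powr q + t * v powr q) / q"
    by (simp add: algebra_simps)
  moreover have "1 - 1 / p = 1 / q"
    using p by simp
  ultimately show ?thesis
    using q by (simp add: w_def divide_right_mono field_simps)
qed

lemma coeff_closure_abs_convex:
  assumes p: "1 \<le> p" and ab: "a \<in> coeff_closure p" "b \<in> coeff_closure p"
    and st: "norm s + norm t \<le> 1"
  shows "(\<lambda>n. s * a n + t * b n) \<in> coeff_closure p"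
proof (cases "p = 1")
  case True
  have "norm (s * a n + t * b n) \<le> 1" for n
  proof -
    have "norm (s * a n + t * b n) \<le> norm s * norm (a n) + norm t * norm (b n)"
      by (metis norm_mult norm_triangle_ineq)
    also have "\<dots> \<le> norm s * 1 + norm t * 1"
      using coeff_closure_norm_le_1[OF p] ab by (intro add_mono mult_left_mono) auto
    finally show ?thesis
      using st by simp
  qed
  then show ?thesis
    using True by (simp add: coeff_closure_def)
next
  case False
  define q where "q = p / (p - 1)"
  have q: "1 < q"
    using False p by (simp add: q_def)
  have ab1: "(\<Sum>n<N. norm (a n) powr q) \<le> 1" "(\<Sum>n<N. norm (b n) powr q) \<le> 1" for N
    using ab False by (simp_all add: coeff_closure_def q_def)
  have "(\<Sum>n<N. norm (s * a n + t * b n) powr q) \<le> 1" for N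
  proof -
    have "norm (s * a n + t * b n) powr q \<le> norm s * norm (a n) powr q + norm t * norm (b n) powr q"
      for n
    proof -
      have "norm (s * a n + t * b n) powr q \<le> (norm s * norm (a n) + norm t * norm (b n)) powr q"
        using q by (intro powr_mono2) (auto intro: norm_triangle_le simp: norm_mult[symmetric] norm_triangle_ineq)
      also have "\<dots> \<le> norm s * norm (a n) powr q + norm t * norm (b n) powr q"
        using q st by (intro powr_subconvex) auto
      finally show ?thesis .
    qed
    then have "(\<Sum>n<N. norm (s * a n + t * b n) powr q) \<le>
        (\<Sum>n<N. norm s * norm (a n) powr q + norm t * norm (b n) powr q)"
      by (rule sum_mono)
    also have "\<dots> = norm s * (\<Sum>n<N. norm (a n) powr q) + norm t * (\<Sum>n<N. norm (b n) powr q)"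
      by (simp add: sum.distrib sum_distrib_left)
    also have "\<dots> \<le> norm s * 1 + norm t * 1"
      using ab1 by (intro add_mono mult_left_mono) auto
    finally show ?thesis
      using st by simp
  qed
  then show ?thesis
    using False by (simp add: coeff_closure_def q_def)
qed

lemma abs_convex_closed_p_conv:
  fixes x :: "nat \<Rightarrow> 'f::complex_banach"
  assumes p: "1 \<le> p" and x: "x \<in> lp p"
  shows "abs_convex (closed_p_conv p x)"
  unfolding abs_convex_def
proof (intro ballI allI impI)
  fix y z and s t :: complex
  assume yz: "y \<in> closed_p_conv p x" "z \<in> closed_p_conv p x" and st: "norm s + norm t \<le> 1"
  obtain a b where a: "a \<in> coeff_closure p" "y = (\<Sum>n. a n *\<^sub>C x n)"
    and b: "b \<in> coeff_closure p" "z = (\<Sum>n. b n *\<^sub>C x n)"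
    using yz by (auto simp: closed_p_conv_def)
  have "(\<lambda>n. a n *\<^sub>C x n) sums y" "(\<lambda>n. b n *\<^sub>C x n) sums z"
    using a b summable_norm_cancel[OF summable_coeff_closure(1)[OF p _ x]]
    by (simp_all add: summable_sums)
  then have "(\<lambda>n. s *\<^sub>C (a n *\<^sub>C x n) + t *\<^sub>C (b n *\<^sub>C x n)) sums (s *\<^sub>C y + t *\<^sub>C z)"
    by (intro sums_add bounded_linear.sums[OF bounded_linear_scaleC_right])
  then have "s *\<^sub>C y + t *\<^sub>C z = (\<Sum>n. (s * a n + t * b n) *\<^sub>C x n)"
    by (simp add: scaleC_add_left scaleC_scaleC sums_iff)
  then show "s *\<^sub>C y + t *\<^sub>C z \<in> closed_p_conv p x"
    unfolding closed_p_conv_def by (rule image_eqI[OF _ coeff_closure_abs_convex[OF p a(1) b(1) st]])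
qed

text \<open>
  With the tail sums \<open>R\<^sub>n\<close> of \<open>r\<close>, the factors \<open>c\<^sub>n = 1 + d / \<surd>R\<^sub>n\<close> grow, but the additional terms
  \<open>d r\<^sub>n / \<surd>R\<^sub>n\<close> are at most \<open>2d (\<surd>R\<^sub>n - \<surd>R\<^sub>n\<^sub>+\<^sub>1)\<close>, which telescopes.  The sequence \<open>b\<close> is \<open>1 / c\<close>
  in a form that still tends to 0 if \<open>r\<close> vanishes eventually; where \<open>R\<^sub>n = 0\<close>, one has \<open>b\<^sub>n = 0\<close> and,
  dividing by zero, \<open>c\<^sub>n = 1\<close>.
\<close>

lemma summable_slowly_rescale:
  fixes r :: "nat \<Rightarrow> real"
  assumes r: "summable r" "\<And>n. 0 \<le> r n" and e: "0 < e"
  obtains b c where "b \<longlonglongrightarrow> 0" "\<And>n. 0 \<le> b n \<and> b n \<le> 1" "\<And>n. r n \<noteq> 0 \<Longrightarrow> b n * c n = 1"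
    "\<And>n. 0 \<le> c n" "summable (\<lambda>n. c n * r n)" "(\<Sum>n. c n * r n) < suminf r + e"
proof -
  define R where "R n = (\<Sum>k. r (k + n))" for n
  have sumR: "summable (\<lambda>k. r (k + n))" for n
    using r(1) by (simp add: summable_iff_shift)
  have R0: "0 \<le> R n" for n
    unfolding R_def using r sumR by (intro suminf_nonneg) auto
  have RSuc: "R n = r n + R (Suc n)" for n
    using suminf_split_head[OF sumR[of n]] by (simp add: R_def)
  have "R \<longlonglongrightarrow> 0"
    unfolding R_def[abs_def] by (rule suminf_exist_split2[OF r(1)])
  then have lim: "(\<lambda>n. sqrt (R n)) \<longlonglongrightarrow> 0"
    using tendsto_real_sqrt by fastforce
  define d where "d = e / (2 * sqrt (R 0) + 1)"
  have d: "0 < d" "2 * d * sqrt (R 0) < e"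
  proof -
    have "0 < 2 * sqrt (R 0) + 1"
      using R0[of 0] by (simp add: add_nonneg_pos)
    then have "0 < d" "(2 * sqrt (R 0) + 1) * d = e"
      using e by (simp_all add: d_def)
    then show "0 < d" "2 * d * sqrt (R 0) < e"
      by (simp_all add: algebra_simps)
  qed
  define b where "b n = sqrt (R n) / (sqrt (R n) + d)" for n
  define c where "c n = 1 + d / sqrt (R n)" for n
  have cr: "c n * r n \<le> r n + 2 * d * (sqrt (R n) - sqrt (R (Suc n)))" for n
  proof (cases "R n = 0")
    case True
    then have "r n = 0" "R (Suc n) = 0"
      using RSuc[of n] r(2)[of n] R0[of "Suc n"] by auto
    then show ?thesis
      using True by simp
  next
    case False
    then have pos: "0 < sqrt (R n)"
      using R0[of n] by simp
    define u v where "u = sqrt (R n)" and "v = sqrt (R (Suc n))"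
    have uv: "u\<^sup>2 = R n" "v\<^sup>2 = R (Suc n)" "0 \<le> v" "v \<le> u" "0 < u"
      using R0 RSuc[of n] r(2)[of n] pos by (auto simp: u_def v_def)
    have "r n = u\<^sup>2 - v\<^sup>2"
      using RSuc[of n] uv(1,2) by linarith
    also have "\<dots> = (u - v) * (u + v)"
      by (simp add: algebra_simps power2_eq_square)
    also have "\<dots> \<le> (u - v) * (2 * u)"
      using uv by (intro mult_left_mono) auto
    finally have "r n / u \<le> 2 * (u - v)"
      by (simp add: pos_divide_le_eq[OF uv(5)] mult.commute mult.left_commute)
    then have "d * (r n / u) \<le> d * (2 * (u - v))"
      using d by (intro mult_left_mono) auto
    then show ?thesis
      by (simp add: c_def u_def v_def algebra_simps)
  qed
  have "(\<lambda>n. sqrt (R n) - sqrt (R (Suc n))) sums (sqrt (R 0) - 0)"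
    by (rule telescope_sums'[OF lim])
  then have sums: "(\<lambda>n. r n + 2 * d * (sqrt (R n) - sqrt (R (Suc n)))) sums (suminf r + 2 * d * sqrt (R 0))"
    using r(1) by (intro sums_add sums_mult) (auto simp: summable_sums)
  have c0: "0 \<le> c n" for n
    using d R0 by (simp add: c_def add_nonneg_nonneg)
  have sumcr: "summable (\<lambda>n. c n * r n)"
    using cr c0 r(2) by (intro summable_comparison_test'[OF sums_summable[OF sums]]) simp
  moreover have "(\<Sum>n. c n * r n) < suminf r + e"
    using suminf_le[OF cr sumcr sums_summable[OF sums]] sums d by (simp add: sums_iff)
  moreover have "b \<longlonglongrightarrow> 0"
  proof -
    have "b \<longlonglongrightarrow> 0 / (0 + d)"
      unfolding b_def using d by (intro tendsto_intros lim) auto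
    then show ?thesis
      by simp
  qed
  moreover have "0 \<le> b n \<and> b n \<le> 1" for n
    using R0[of n] d by (simp add: b_def add_nonneg_pos)
  moreover have "b n * c n = 1" if "r n \<noteq> 0" for n
  proof -
    have "0 < sqrt (R n)"
      using that RSuc[of n] r(2)[of n] R0[of "Suc n"] by simp
    then have "0 < sqrt (R n) + d" "0 < sqrt (R n)"
      using d by (simp_all add: add_pos_pos)
    moreover have "c n = (sqrt (R n) + d) / sqrt (R n)"
      using \<open>0 < sqrt (R n)\<close> by (simp add: c_def add_divide_distrib)
    ultimately show ?thesis
      by (simp add: b_def)
  qed
  ultimately show thesis
    using that c0 by blast
qed

text \<open>
  Only \<open>p = 1\<close> needs work: bounded coefficients become null sequences when a slowly
  growing factor is moved from the coefficients to the vectors.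
\<close>

lemma closed_p_conv_subset_p_conv:
  fixes x :: "nat \<Rightarrow> 'f::complex_banach"
  assumes p: "1 \<le> p" and x: "x \<in> lp p" and e: "0 < e"
  obtains y where "y \<in> lp p" "lp_norm p y < lp_norm p x + e" "closed_p_conv p x \<subseteq> p_conv p y"
proof (cases "p = 1")
  case False
  then have "closed_p_conv p x \<subseteq> p_conv p x"
    using p by (auto simp: closed_p_conv_def p_conv_def coeff_ball_eq_closure)
  then show thesis
    using that x e by force
next
  case True
  have x1: "summable (\<lambda>n. norm (x n))" "lp_norm p x = (\<Sum>n. norm (x n))"
    using x True by (simp_all add: lp_def lp_norm_def suminf_nonneg)
  obtain b c where bc: "b \<longlonglongrightarrow> 0" "\<And>n. 0 \<le> b n \<and> b n \<le> 1" "\<And>n. norm (x n) \<noteq> 0 \<Longrightarrow> b n * c n = 1"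
    "\<And>n. 0 \<le> c n" "summable (\<lambda>n. c n * norm (x n))"
    "(\<Sum>n. c n * norm (x n)) < (\<Sum>n. norm (x n)) + e"
    by (rule summable_slowly_rescale[OF x1(1) norm_ge_zero e]) (rule that)
  define y where "y n = c n *\<^sub>R x n" for n
  have "y \<in> lp p" "lp_norm p y = (\<Sum>n. c n * norm (x n))"
    using bc(4,5) True by (simp_all add: y_def lp_def lp_norm_def suminf_nonneg)
  moreover have "closed_p_conv p x \<subseteq> p_conv p y"
  proof
    fix z
    assume "z \<in> closed_p_conv p x"
    then obtain a where a: "a \<in> coeff_closure p" "z = (\<Sum>n. a n *\<^sub>C x n)"
      by (auto simp: closed_p_conv_def)
    have a1: "norm (a n) \<le> 1" for n
      by (rule coeff_closure_norm_le_1[OF p a(1)])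
    have "(\<lambda>n. a n * of_real (b n)) \<longlonglongrightarrow> 0"
    proof (rule Lim_null_comparison[OF _ bc(1)], intro always_eventually allI)
      show "norm (a n * of_real (b n)) \<le> b n" for n
        using mult_right_mono[OF a1[of n], of "b n"] bc(2)[of n] by (simp add: norm_mult)
    qed
    moreover have "norm (a n * of_real (b n)) \<le> 1" for n
      using a1[of n] bc(2)[of n] by (simp add: norm_mult mult_le_one)
    ultimately have "(\<lambda>n. a n * of_real (b n)) \<in> coeff_ball p"
      using True by (simp add: coeff_ball_def)
    moreover have "(a n * of_real (b n)) *\<^sub>C y n = a n *\<^sub>C x n" for n
    proof (cases "x n = 0")
      case False
      then have "complex_of_real (b n * c n) = 1"
        using bc(3)[of n] by simp
      then have "a n * of_real (b n) * of_real (c n) = a n"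
        by (simp add: mult.assoc)
      then show ?thesis
        by (simp only: y_def scaleR_scaleC scaleC_scaleC)
    qed (simp add: y_def scaleC_zero_right)
    ultimately show "z \<in> p_conv p y"
      unfolding p_conv_def a(2) by (intro CollectI exI[of _ "\<lambda>n. a n * of_real (b n)"]) simp
  qed
  ultimately show thesis
    using that bc(6) x1(2) by metis
qed

section \<open>The measure of p-compactness\<close>

lemma m_p_le:
  assumes "x \<in> lp p" "K \<subseteq> p_conv p x"
  shows "m_p p K \<le> lp_norm p x"
  unfolding m_p_def using assms by (intro cInf_lower bdd_belowI[of _ 0]) (auto simp: lp_norm_nonneg)

lemma m_p_less_obtains:
  assumes "rel_p_compact p K" "m_p p K < b"
  obtains x where "x \<in> lp p" "K \<subseteq> p_conv p x" "lp_norm p x < b"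
proof -
  have "{lp_norm p x | x. x \<in> lp p \<and> K \<subseteq> p_conv p x} \<noteq> {}"
    using assms(1) by (auto simp: rel_p_compact_def)
  then show thesis
    using cInf_lessD[OF _ assms(2)[unfolded m_p_def]] that by blast
qed

lemma m_p_nonneg: "rel_p_compact p K \<Longrightarrow> 0 \<le> m_p p K"
  unfolding m_p_def by (intro cInf_greatest) (auto simp: rel_p_compact_def lp_norm_nonneg)

lemma m_p_leI:
  assumes "\<And>e. 0 < e \<Longrightarrow> \<exists>x\<in>lp p. lp_norm p x \<le> b + e \<and> K \<subseteq> p_conv p x"
  shows "rel_p_compact p K" "m_p p K \<le> b"
proof -
  show "rel_p_compact p K"
    using assms[of 1] by (auto simp: rel_p_compact_def)
  show "m_p p K \<le> b"
  proof (rule field_le_epsilon)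
    fix e :: real
    assume "0 < e"
    then obtain x where "x \<in> lp p" "lp_norm p x \<le> b + e" "K \<subseteq> p_conv p x"
      using assms by blast
    then show "m_p p K \<le> b + e"
      using m_p_le[of x p K] by simp
  qed
qed

lemma rel_p_compact_subset: "rel_p_compact p L \<Longrightarrow> K \<subseteq> L \<Longrightarrow> rel_p_compact p K"
  by (auto simp: rel_p_compact_def)

lemma m_p_mono:
  assumes "rel_p_compact p L" "K \<subseteq> L"
  shows "m_p p K \<le> m_p p L"
proof (rule m_p_leI(2))
  fix e :: real
  assume "0 < e"
  then obtain x where "x \<in> lp p" "L \<subseteq> p_conv p x" "lp_norm p x < m_p p L + e"
    using m_p_less_obtains[OF assms(1), of "m_p p L + e"] by auto
  with assms(2) show "\<exists>x\<in>lp p. lp_norm p x \<le> m_p p L + e \<and> K \<subseteq> p_conv p x"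
    by (intro bexI[of _ x]) auto
qed

text \<open>
  If \<open>K\<close> lies in the \<open>p\<close>-convex hull of \<open>x\<close>, then the closed hull of \<open>x\<close> is a closed bounded absolutely
  convex set containing \<open>K\<close>, so it contains the bipolar of \<open>K\<close> and in particular \<open>L\<close>.
\<close>

theorem m_p_polar:
  fixes K L :: "'f::complex_banach set"
  assumes p: "1 \<le> p" and K: "rel_p_compact p K"
    and polar: "\<And>u y. y \<in> L \<Longrightarrow> cfunctional u \<Longrightarrow> (\<And>x. x \<in> K \<Longrightarrow> norm (u x) \<le> 1) \<Longrightarrow> norm (u y) \<le> 1"
  shows "rel_p_compact p L" "m_p p L \<le> m_p p K"
proof -
  have "\<exists>y\<in>lp p. lp_norm p y \<le> m_p p K + e \<and> L \<subseteq> p_conv p y" if e: "0 < e" for e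
  proof -
    obtain x where x: "x \<in> lp p" "K \<subseteq> p_conv p x" "lp_norm p x < m_p p K + e / 2"
      using m_p_less_obtains[OF K, of "m_p p K + e / 2"] e by auto
    obtain y where y: "y \<in> lp p" "lp_norm p y < lp_norm p x + e / 2" "closed_p_conv p x \<subseteq> p_conv p y"
      using closed_p_conv_subset_p_conv[OF p x(1), of "e / 2"] e by auto
    have "compact (closed_p_conv p x)"
      by (rule compact_closed_p_conv[OF p x(1)])
    moreover have "closed_p_conv p x \<noteq> {}"
    proof -
      have "(\<lambda>n. 0) \<in> coeff_closure p"
        by (simp add: coeff_closure_def)
      then show ?thesis
        by (auto simp: closed_p_conv_def)
    qed
    ultimately have "L \<subseteq> closure (closed_p_conv p x)"
    proof (intro subsetI closure_abs_convex_if_functionals abs_convex_closed_p_conv[OF p x(1)]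
        compact_imp_bounded)
      fix z u
      assume zu: "z \<in> L" "cfunctional u" "\<And>w. w \<in> closed_p_conv p x \<Longrightarrow> norm (u w) \<le> 1"
      have "norm (u w) \<le> 1" if "w \<in> K" for w
        using that x(2) p_conv_subset_closed[OF p, of x] by (intro zu(3)) auto
      then show "norm (u z) \<le> 1"
        by (rule polar[OF zu(1,2)])
    qed
    also have "\<dots> = closed_p_conv p x"
      using \<open>compact (closed_p_conv p x)\<close> by (simp add: compact_imp_closed)
    finally show ?thesis
      using x y by (intro bexI[of _ y]) auto
  qed
  then show "rel_p_compact p L" "m_p p L \<le> m_p p K"
    using m_p_leI by blast+
qed

lemma m_p_scale:
  fixes K L :: "'f::complex_banach set"
  assumes p: "1 \<le> p" and K: "rel_p_compact p K" and L: "\<And>y. y \<in> L \<Longrightarrow> \<exists>x\<in>K. y = c *\<^sub>C x"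
  shows "rel_p_compact p L" "m_p p L \<le> norm c * m_p p K"
proof -
  have "\<exists>y\<in>lp p. lp_norm p y \<le> norm c * m_p p K + e \<and> L \<subseteq> p_conv p y" if e: "0 < e" for e
  proof -
    define d where "d = e / (norm c + 1)"
    have "0 < norm c + 1"
      by (simp add: add_nonneg_pos)
    then have d: "0 < d" "(norm c + 1) * d = e"
      using e by (simp_all add: d_def)
    obtain x where x: "x \<in> lp p" "K \<subseteq> p_conv p x" "lp_norm p x < m_p p K + d"
      using m_p_less_obtains[OF K, of "m_p p K + d"] d by auto
    define y where "y n = c *\<^sub>C x n" for n
    have np: "norm (y n) powr p = norm c powr p * norm (x n) powr p" for n
      by (simp add: y_def norm_scaleC powr_mult)
    have "y \<in> lp p"
      using x(1) by (simp add: lp_def np summable_mult)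
    have "lp_norm p y = norm c * lp_norm p x"
      using x(1) p by (simp add: lp_norm_def np lp_def suminf_mult suminf_nonneg powr_mult powr_powr)
    also have "\<dots> \<le> norm c * (m_p p K + d)"
      using x(3) by (intro mult_left_mono) auto
    finally have "lp_norm p y \<le> norm c * m_p p K + e"
      using d by (simp add: distrib_right distrib_left)
    moreover have "L \<subseteq> p_conv p y"
    proof
      fix z
      assume "z \<in> L"
      then obtain w where w: "w \<in> K" "z = c *\<^sub>C w"
        using L by blast
      obtain a where a: "a \<in> coeff_ball p" "w = (\<Sum>n. a n *\<^sub>C x n)"
        using w x(2) by (auto simp: p_conv_def)
      have "summable (\<lambda>n. a n *\<^sub>C x n)"
        using a coeff_ball_subset_closure[OF p] x(1)
        by (intro summable_norm_cancel[OF summable_coeff_closure(1)[OF p]]) auto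
      then have "z = (\<Sum>n. c *\<^sub>C (a n *\<^sub>C x n))"
        unfolding w(2) a(2) by (rule bounded_linear.suminf[OF bounded_linear_scaleC_right])
      then have "z = (\<Sum>n. a n *\<^sub>C y n)"
        by (simp add: y_def scaleC_scaleC mult.commute)
      with a show "z \<in> p_conv p y"
        by (auto simp: p_conv_def)
    qed
    ultimately show ?thesis
      using \<open>y \<in> lp p\<close> by blast
  qed
  then show "rel_p_compact p L" "m_p p L \<le> norm c * m_p p K"
    using m_p_leI by blast+
qed

definition interleave :: "(nat \<Rightarrow> 'a) \<Rightarrow> (nat \<Rightarrow> 'a) \<Rightarrow> nat \<Rightarrow> 'a"
  where "interleave f g n = (if even n then f (n div 2) else g (n div 2))"

lemma interleave_even: "interleave f g (2 * n) = f n"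
  and interleave_odd: "interleave f g (2 * n + 1) = g n"
  by (simp_all add: interleave_def)

lemma interleave_sums:
  fixes f g :: "nat \<Rightarrow> 'a::real_normed_vector"
  assumes "f sums a" "g sums b"
  shows "interleave f g sums (a + b)"
proof -
  have "(\<lambda>n. interleave f (\<lambda>_. 0) (2 * n)) sums a \<longleftrightarrow> interleave f (\<lambda>_. 0) sums a"
    by (rule sums_mono_reindex) (auto simp: strict_mono_def interleave_def elim!: evenE)
  moreover have "(\<lambda>n. interleave (\<lambda>_. 0) g (2 * n + 1)) sums b \<longleftrightarrow> interleave (\<lambda>_. 0) g sums b"
    by (rule sums_mono_reindex) (auto simp: strict_mono_def interleave_def elim!: oddE)
  ultimately have "(\<lambda>n. interleave f (\<lambda>_. 0) n + interleave (\<lambda>_. 0) g n) sums (a + b)"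
    using assms by (intro sums_add) (simp_all only: interleave_even interleave_odd)
  moreover have "(\<lambda>n. interleave f (\<lambda>_. 0) n + interleave (\<lambda>_. 0) g n) = interleave f g"
    by (auto simp: interleave_def)
  ultimately show ?thesis
    by simp
qed

lemma lp_norm_le_iff:
  assumes "0 < p" "0 \<le> A" "x \<in> lp p"
  shows "lp_norm p x \<le> A \<longleftrightarrow> (\<Sum>n. norm (x n) powr p) \<le> A powr p"
proof -
  define S where "S = (\<Sum>n. norm (x n) powr p)"
  have "0 \<le> S"
    using assms by (simp add: S_def lp_def suminf_nonneg)
  then have S: "(S powr (1 / p)) powr p = S"
    using assms by (simp add: powr_powr)
  have A: "(A powr p) powr (1 / p) = A"
    using assms by (simp add: powr_powr)
  have "S powr (1 / p) \<le> A \<longleftrightarrow> S \<le> A powr p"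
    using powr_mono2[of p "S powr (1 / p)" A] powr_mono2[of "1 / p" S "A powr p"] S A assms \<open>0 \<le> S\<close>
    by auto
  then show ?thesis
    by (simp add: lp_norm_def S_def)
qed

text \<open>
  The sequences are interleaved after multiplication by weights \<open>s\<close> and \<open>t\<close>, and the coefficients are divided
  by them.  With \<open>q = p / (p - 1)\<close> the weights satisfy \<open>1 / s\<^sup>q = A / (A + B)\<close> and
  \<open>1 / t\<^sup>q = B / (A + B)\<close>, so that the new coefficients stay in the unit ball, while
  \<open>s\<^sup>p A\<^sup>p + t\<^sup>p B\<^sup>p = (A + B)\<^sup>p\<close> bounds the new sequence.  For \<open>p = 1\<close> both weights are 1.
\<close>

lemma p_conv_add:
  fixes x y :: "nat \<Rightarrow> 'f::complex_banach"
  assumes p: "1 \<le> p" and x: "x \<in> lp p" "lp_norm p x \<le> A" "0 < A"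
    and y: "y \<in> lp p" "lp_norm p y \<le> B" "0 < B"
  obtains z where "z \<in> lp p" "lp_norm p z \<le> A + B"
    "\<And>u v. u \<in> p_conv p x \<Longrightarrow> v \<in> p_conv p y \<Longrightarrow> u + v \<in> p_conv p z"
proof -
  define s t where "s = ((A + B) / A) powr ((p - 1) / p)" and "t = ((A + B) / B) powr ((p - 1) / p)"
  have st: "0 < s" "0 < t"
    using x(3) y(3) by (simp_all add: s_def t_def)
  define z where "z = interleave (\<lambda>n. s *\<^sub>R x n) (\<lambda>n. t *\<^sub>R y n)"
  have np: "(\<lambda>n. norm (z n) powr p) =
      interleave (\<lambda>n. s powr p * norm (x n) powr p) (\<lambda>n. t powr p * norm (y n) powr p)"
    using st by (auto simp: z_def interleave_def powr_mult)
  have sumz: "(\<lambda>n. norm (z n) powr p) sums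
      (s powr p * (\<Sum>n. norm (x n) powr p) + t powr p * (\<Sum>n. norm (y n) powr p))"
    unfolding np using x y by (intro interleave_sums sums_mult) (auto simp: lp_def summable_sums)
  then have z: "z \<in> lp p"
    by (auto simp: lp_def sums_iff)
  have pow: "(((A + B) / C) powr ((p - 1) / p)) powr p * C powr p = (A + B) powr (p - 1) * C"
    if "0 < C" for C
  proof -
    have "(((A + B) / C) powr ((p - 1) / p)) powr p = (A + B) powr (p - 1) / C powr (p - 1)"
      using p that x(3) y(3) by (simp add: powr_powr powr_divide)
    moreover have "C powr p = C powr (p - 1) * C"
      using that by (simp add: powr_diff)
    ultimately show ?thesis
      using that by simp
  qed
  have "(\<Sum>n. norm (z n) powr p) = s powr p * (\<Sum>n. norm (x n) powr p) + t powr p * (\<Sum>n. norm (y n) powr p)"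
    using sumz by (simp add: sums_iff)
  also have "\<dots> \<le> s powr p * A powr p + t powr p * B powr p"
    using x y p lp_norm_le_iff[of p A x] lp_norm_le_iff[of p B y]
    by (intro add_mono mult_left_mono) auto
  also have "\<dots> = (A + B) powr (p - 1) * (A + B)"
    using pow x(3) y(3) by (simp add: s_def t_def algebra_simps)
  also have "\<dots> = (A + B) powr p"
    using x(3) y(3) by (simp add: powr_diff)
  finally have "lp_norm p z \<le> A + B"
    using lp_norm_le_iff[of p "A + B" z] z p x(3) y(3) by simp
  moreover have "u + v \<in> p_conv p z" if u: "u \<in> p_conv p x" and v: "v \<in> p_conv p y" for u v
  proof -
    obtain a b where a: "a \<in> coeff_ball p" "u = (\<Sum>n. a n *\<^sub>C x n)"
      and b: "b \<in> coeff_ball p" "v = (\<Sum>n. b n *\<^sub>C y n)"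
      using u v by (auto simp: p_conv_def)
    have "(\<lambda>n. a n *\<^sub>C x n) sums u" "(\<lambda>n. b n *\<^sub>C y n) sums v"
      using a b coeff_ball_subset_closure[OF p] x(1) y(1)
        summable_norm_cancel[OF summable_coeff_closure(1)[OF p]]
      by (auto intro!: summable_sums)
    then have sums: "interleave (\<lambda>n. a n *\<^sub>C x n) (\<lambda>n. b n *\<^sub>C y n) sums (u + v)"
      by (rule interleave_sums)
    define c where "c = interleave (\<lambda>n. a n / of_real s) (\<lambda>n. b n / of_real t)"
    have "interleave (\<lambda>n. a n *\<^sub>C x n) (\<lambda>n. b n *\<^sub>C y n) = (\<lambda>n. c n *\<^sub>C z n)"
      using st by (auto simp: c_def z_def interleave_def scaleR_scaleC scaleC_scaleC)
    with sums have "u + v = (\<Sum>n. c n *\<^sub>C z n)"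
      by (simp add: sums_iff)
    moreover have "c \<in> coeff_ball p"
    proof (cases "p = 1")
      case True
      then have "s = 1" "t = 1"
        using x(3) y(3) by (simp_all add: s_def t_def)
      then have c: "c n = (if even n then a (n div 2) else b (n div 2))" for n
        by (simp add: c_def interleave_def)
      have ab: "a \<longlonglongrightarrow> 0" "b \<longlonglongrightarrow> 0" "\<And>n. norm (a n) \<le> 1" "\<And>n. norm (b n) \<le> 1"
        using a b True by (auto simp: coeff_ball_def)
      have div2: "filterlim (\<lambda>n::nat. n div 2) sequentially sequentially"
        unfolding filterlim_at_top
      proof
        fix Z :: nat
        show "\<forall>\<^sub>F n in sequentially. Z \<le> n div 2"
          by (rule eventually_sequentiallyI[of "2 * Z"]) simp
      qed
      have "c \<longlonglongrightarrow> 0"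
      proof (rule Lim_null_comparison)
        show "\<forall>\<^sub>F n in sequentially. norm (c n) \<le> norm (a (n div 2)) + norm (b (n div 2))"
          by (simp add: c)
        show "(\<lambda>n. norm (a (n div 2)) + norm (b (n div 2))) \<longlonglongrightarrow> 0"
          using tendsto_add[OF tendsto_norm_zero[OF filterlim_compose[OF ab(1) div2]]
              tendsto_norm_zero[OF filterlim_compose[OF ab(2) div2]]] by simp
      qed
      then show ?thesis
        using True ab by (simp add: coeff_ball_def c)
    next
      case False
      define q where "q = p / (p - 1)"
      have p1: "1 < p" and q: "0 < q" "(p - 1) / p * q = 1"
        using False p by (auto simp: q_def)
      have a1: "summable (\<lambda>n. norm (a n) powr q)" "(\<Sum>n. norm (a n) powr q) \<le> 1"
        using a(1) p1 by (simp_all add: coeff_ball_iff_suminf q_def)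
      have b1: "summable (\<lambda>n. norm (b n) powr q)" "(\<Sum>n. norm (b n) powr q) \<le> 1"
        using b(1) p1 by (simp_all add: coeff_ball_iff_suminf q_def)
      have sq: "s powr q = (A + B) / A" "t powr q = (A + B) / B"
        using q x(3) y(3) by (simp_all only: s_def t_def powr_powr) simp_all
      have "(\<lambda>n. norm (c n) powr q) =
          interleave (\<lambda>n. (1 / s powr q) * norm (a n) powr q) (\<lambda>n. (1 / t powr q) * norm (b n) powr q)"
        using st by (auto simp: c_def interleave_def norm_divide powr_divide)
      then have sumc: "(\<lambda>n. norm (c n) powr q) sums
          ((1 / s powr q) * (\<Sum>n. norm (a n) powr q) + (1 / t powr q) * (\<Sum>n. norm (b n) powr q))"
        using a1 b1 by (simp only:) (intro interleave_sums sums_mult summable_sums)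
      have "(1 / s powr q) * (\<Sum>n. norm (a n) powr q) + (1 / t powr q) * (\<Sum>n. norm (b n) powr q)
          \<le> (1 / s powr q) * 1 + (1 / t powr q) * 1"
        using a1 b1 by (intro add_mono mult_left_mono) auto
      also have "\<dots> = 1"
        using x(3) y(3) by (simp add: sq add_divide_distrib[symmetric])
      finally show ?thesis
        using sumc p1 by (simp add: coeff_ball_iff_suminf q_def sums_iff)
    qed
    ultimately show ?thesis
      by (auto simp: p_conv_def)
  qed
  ultimately show thesis
    using that z by blast
qed

lemma m_p_add:
  fixes K L M :: "'f::complex_banach set"
  assumes p: "1 \<le> p" and K: "rel_p_compact p K" and L: "rel_p_compact p L"
    and M: "\<And>y. y \<in> M \<Longrightarrow> \<exists>u\<in>K. \<exists>v\<in>L. y = u + v"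
  shows "rel_p_compact p M" "m_p p M \<le> m_p p K + m_p p L"
proof -
  have "\<exists>z\<in>lp p. lp_norm p z \<le> m_p p K + m_p p L + e \<and> M \<subseteq> p_conv p z" if e: "0 < e" for e
  proof -
    obtain x where x: "x \<in> lp p" "K \<subseteq> p_conv p x" "lp_norm p x < m_p p K + e / 2"
      using m_p_less_obtains[OF K, of "m_p p K + e / 2"] e by auto
    obtain y where y: "y \<in> lp p" "L \<subseteq> p_conv p y" "lp_norm p y < m_p p L + e / 2"
      using m_p_less_obtains[OF L, of "m_p p L + e / 2"] e by auto
    obtain z where z: "z \<in> lp p" "lp_norm p z \<le> (m_p p K + e / 2) + (m_p p L + e / 2)"
      "\<And>u v. u \<in> p_conv p x \<Longrightarrow> v \<in> p_conv p y \<Longrightarrow> u + v \<in> p_conv p z"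
      using p_conv_add[OF p x(1) less_imp_le[OF x(3)] _ y(1) less_imp_le[OF y(3)]]
        m_p_nonneg[OF K] m_p_nonneg[OF L] e by (metis add_nonneg_pos half_gt_zero)
    have "M \<subseteq> p_conv p z"
      using M z(3) x(2) y(2) by blast
    with z show ?thesis
      by (intro bexI[of _ z]) auto
  qed
  then show "rel_p_compact p M" "m_p p M \<le> m_p p K + m_p p L"
    using m_p_leI by blast+
qed

lemma norm_le_m_p:
  fixes K :: "'f::complex_banach set"
  assumes p: "1 \<le> p" and K: "rel_p_compact p K" and y: "y \<in> K"
  shows "norm y \<le> m_p p K"
proof (rule field_le_epsilon)
  fix e :: real
  assume e: "0 < e"
  obtain x where x: "x \<in> lp p" "K \<subseteq> p_conv p x" "lp_norm p x < m_p p K + e"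
    using m_p_less_obtains[OF K, of "m_p p K + e"] e by auto
  have "norm y \<le> lp_norm p x"
    using x y p_conv_subset_closed[OF p] by (intro norm_closed_p_conv_le[OF p x(1)]) blast
  with x show "norm y \<le> m_p p K + e"
    by simp
qed

lemma m_p_subset_zero:
  fixes K :: "'f::complex_banach set"
  assumes p: "1 \<le> p" and K: "K \<subseteq> {0}"
  shows "rel_p_compact p K" "m_p p K = 0"
proof -
  have "\<exists>x\<in>lp p. lp_norm p x \<le> 0 + e \<and> K \<subseteq> p_conv p x" if "0 < e" for e
  proof (intro bexI[of _ "\<lambda>_. 0"] conjI)
    have "(\<lambda>_. 0) \<in> coeff_ball p"
      by (simp add: coeff_ball_def lp_def lp_norm_def)
    then show "K \<subseteq> p_conv p (\<lambda>_. 0)"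
      using K by (auto simp: p_conv_def scaleC_zero_right)
  qed (use that in \<open>simp_all add: lp_def lp_norm_def\<close>)
  then have *: "rel_p_compact p K" "m_p p K \<le> 0"
    using m_p_leI by blast+
  then show "rel_p_compact p K" "m_p p K = 0"
    using m_p_nonneg by (auto intro: antisym)
qed

section \<open>Normed spaces of functions\<close>

text \<open>
  The spaces \<open>H\<^sup>\<infinity>(U)\<close>, the duals, \<open>G\<^sup>\<infinity>(U)\<close> and the spaces of \<open>p\<close>-compact operators all consist of functions
  with pointwise operations.  For them the module axioms reduce to this closure property.
\<close>

definition fun_subspace :: "('a \<Rightarrow> 'b::complex_normed_vector) set \<Rightarrow> bool"
  where "fun_subspace S \<longleftrightarrow> (\<lambda>x. 0) \<in> S \<and> (\<forall>f\<in>S. \<forall>g\<in>S. (\<lambda>x. f x + g x) \<in> S) \<and>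
    (\<forall>c. \<forall>f\<in>S. (\<lambda>x. c *\<^sub>C f x) \<in> S)"

lemma fun_subspaceD:
  assumes "fun_subspace S"
  shows "(\<lambda>x. 0) \<in> S" "f \<in> S \<Longrightarrow> g \<in> S \<Longrightarrow> (\<lambda>x. f x + g x) \<in> S" "f \<in> S \<Longrightarrow> (\<lambda>x. c *\<^sub>C f x) \<in> S"
  using assms by (auto simp: fun_subspace_def)

lemma fun_subspace_uminus:
  assumes "fun_subspace S" "f \<in> S"
  shows "(\<lambda>x. - f x) \<in> S"
  using fun_subspaceD(3)[OF assms, of "-1"] by (simp add: scaleC_minus1)

lemma fun_subspace_diff:
  assumes "fun_subspace S" "f \<in> S" "g \<in> S"
  shows "(\<lambda>x. f x - g x) \<in> S"
  using fun_subspaceD(2)[OF assms(1,2) fun_subspace_uminus[OF assms(1,3)]] by simp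

lemma fun_space_simps [simp]:
  "carrier (fun_space S N) = S" "zero (fun_space S N) = (\<lambda>x. 0)"
  "add (fun_space S N) = (\<lambda>f g x. f x + g x)" "smult (fun_space S N) = (\<lambda>c f x. c *\<^sub>C f x)"
  "vnorm (fun_space S N) = N"
  by (simp_all add: fun_space_def)

lemma type_space_simps [simp]:
  "carrier type_space = UNIV" "zero type_space = 0" "add type_space = (+)"
  "smult type_space = scaleC" "vnorm type_space = norm"
  by (simp_all add: type_space_def)

lemma abelian_group_fun_space:
  assumes S: "fun_subspace S"
  shows "abelian_group (fun_space S N)"
proof (rule abelian_groupI)
  fix f
  assume "f \<in> carrier (fun_space S N)"
  then show "\<exists>g\<in>carrier (fun_space S N). g \<oplus>\<^bsub>fun_space S N\<^esub> f = \<zero>\<^bsub>fun_space S N\<^esub>"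
    using fun_subspace_uminus[OF S, of f] by (intro bexI[of _ "\<lambda>x. - f x"]) auto
qed (use fun_subspaceD[OF S] in \<open>simp_all add: algebra_simps\<close>)

lemma module_fun_space:
  assumes S: "fun_subspace S"
  shows "module (ring_of_type_algebra :: complex ring) (fun_space S N)"
  by (rule moduleI[OF cring_from_type_algebra abelian_group_fun_space[OF S]])
    (use fun_subspaceD[OF S] in \<open>simp_all add: ring_of_type_algebra_def scaleC_add_left scaleC_add_right
        scaleC_scaleC scaleC_one\<close>)

lemma uminus_fun_space:
  assumes S: "fun_subspace S" and f: "f \<in> S"
  shows "\<ominus>\<^bsub>fun_space S N\<^esub> f = (\<lambda>x. - f x)"
proof -
  interpret abelian_group "fun_space S N"
    by (rule abelian_group_fun_space[OF S])
  show ?thesis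
    by (rule minus_equality) (use f fun_subspace_uminus[OF S f] in simp_all)
qed

lemma minus_fun_space:
  assumes S: "fun_subspace S" and g: "g \<in> S"
  shows "f \<ominus>\<^bsub>fun_space S N\<^esub> g = (\<lambda>x. f x - g x)"
  by (simp add: a_minus_def uminus_fun_space[OF S g])

text \<open>
  Homogeneity as an inequality suffices, since scaling by \<open>1 / c\<close> reverses it.
\<close>

lemma complex_normed_space_fun_space:
  assumes S: "fun_subspace S"
    and zero: "\<And>f. f \<in> S \<Longrightarrow> N f = 0 \<Longrightarrow> f = (\<lambda>x. 0)"
    and add: "\<And>f g. f \<in> S \<Longrightarrow> g \<in> S \<Longrightarrow> N (\<lambda>x. f x + g x) \<le> N f + N g"
    and scale: "\<And>c f. f \<in> S \<Longrightarrow> N (\<lambda>x. c *\<^sub>C f x) \<le> norm c * N f"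
  shows "complex_normed_space (fun_space S N)"
proof (intro complex_normed_space.intro complex_normed_space_axioms.intro)
  have N0: "N (\<lambda>x. 0) = 0"
    using scale[OF fun_subspaceD(1)[OF S], of 0] add[OF fun_subspaceD(1)[OF S] fun_subspaceD(1)[OF S]]
    by (simp add: scaleC_zero_right)
  have eq: "N (\<lambda>x. c *\<^sub>C f x) = norm c * N f" if f: "f \<in> S" for c f
  proof (cases "c = 0")
    case True
    then show ?thesis
      using N0 by (simp add: scaleC_zero_left)
  next
    case False
    have "N (\<lambda>x. (1 / c) *\<^sub>C (c *\<^sub>C f x)) \<le> norm (1 / c) * N (\<lambda>x. c *\<^sub>C f x)"
      by (rule scale[OF fun_subspaceD(3)[OF S f]])
    then have "norm c * N f \<le> N (\<lambda>x. c *\<^sub>C f x)"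
      using False by (simp add: scaleC_scaleC scaleC_one norm_divide field_simps)
    with scale[OF f, of c] show ?thesis
      by simp
  qed
  show "module (ring_of_type_algebra :: complex ring) (fun_space S N)"
    by (rule module_fun_space[OF S])
  fix f
  assume "f \<in> carrier (fun_space S N)"
  then have f: "f \<in> S"
    by simp
  show "vnorm (fun_space S N) f = 0 \<longleftrightarrow> f = \<zero>\<^bsub>fun_space S N\<^esub>"
    using zero[OF f] N0 by auto
  show "vnorm (fun_space S N) (c \<odot>\<^bsub>fun_space S N\<^esub> f) = norm c * vnorm (fun_space S N) f" for c
    using eq[OF f] by simp
  fix g
  assume "g \<in> carrier (fun_space S N)"
  then show "vnorm (fun_space S N) (f \<oplus>\<^bsub>fun_space S N\<^esub> g) \<le>
      vnorm (fun_space S N) f + vnorm (fun_space S N) g"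
    using add[OF f] by simp
qed

lemma complex_normed_space_fun_space_cong:
  assumes "complex_normed_space (fun_space S N)" "fun_subspace S" "\<And>f. f \<in> S \<Longrightarrow> N' f = N f"
  shows "complex_normed_space (fun_space S N')"
proof -
  interpret complex_normed_space "fun_space S N" by fact
  note S = fun_subspaceD[OF assms(2)]
  show ?thesis
    using vnorm_eq_zero vnorm_triangle vnorm_smult assms(3) S
    by (intro complex_normed_space_fun_space[OF assms(2)]) auto
qed

lemma vdist_fun_space:
  assumes "fun_subspace S" "f \<in> S" "g \<in> S"
  shows "vdist (fun_space S N) f g = N (\<lambda>x. f x - g x)"
  using assms by (simp add: vdist_def minus_fun_space)

lemma complex_banach_space_fun_space:
  assumes X: "complex_normed_space (fun_space S N)" and S: "fun_subspace S"
    and complete: "\<And>\<sigma> :: nat \<Rightarrow> 'a \<Rightarrow> 'b::complex_normed_vector. (\<And>n. \<sigma> n \<in> S) \<Longrightarrow>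
      (\<And>e. 0 < e \<Longrightarrow> \<exists>M. \<forall>m\<ge>M. \<forall>n\<ge>M. N (\<lambda>x. \<sigma> m x - \<sigma> n x) < e) \<Longrightarrow>
      \<exists>f\<in>S. \<forall>e>0. \<exists>M. \<forall>n\<ge>M. N (\<lambda>x. \<sigma> n x - f x) < e"
  shows "complex_banach_space (fun_space S N)"
proof (intro complex_banach_space.intro complex_banach_space_axioms.intro X)
  interpret complex_normed_space "fun_space S N" by fact
  interpret Metric_space S "vdist (fun_space S N)"
    using Metric_space_vdist by simp
  have "mcomplete"
    unfolding mcomplete_def
  proof (intro allI impI)
    fix \<sigma>
    assume C: "MCauchy \<sigma>"
    then have \<sigma>: "\<sigma> n \<in> S" for n
      by (auto simp: MCauchy_def)
    obtain f where f: "f \<in> S" "\<And>e. 0 < e \<Longrightarrow> \<exists>M. \<forall>n\<ge>M. N (\<lambda>x. \<sigma> n x - f x) < e"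
      using complete[of \<sigma>] C \<sigma> by (force simp: MCauchy_def vdist_fun_space[OF S])
    then have "limitin mtopology \<sigma> f sequentially"
      using \<sigma> by (auto simp: limit_metric_sequentially vdist_fun_space[OF S])
    then show "\<exists>f. limitin mtopology \<sigma> f sequentially"
      by blast
  qed
  then show "Metric_space.mcomplete (carrier (fun_space S N)) (vdist (fun_space S N))"
    by simp
qed

lemma fun_space_completeD:
  assumes X: "complex_banach_space (fun_space S N)" and S: "fun_subspace S"
    and \<sigma>: "\<And>n :: nat. \<sigma> n \<in> S"
    and C: "\<And>e. 0 < e \<Longrightarrow> \<exists>M. \<forall>m\<ge>M. \<forall>n\<ge>M. N (\<lambda>x. \<sigma> m x - \<sigma> n x) < e"
  obtains f where "f \<in> S" "\<And>e. 0 < e \<Longrightarrow> \<exists>M. \<forall>n\<ge>M. N (\<lambda>x. \<sigma> n x - f x) < e"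
proof -
  interpret complex_banach_space "fun_space S N" by fact
  interpret Metric_space S "vdist (fun_space S N)"
    using Metric_space_vdist by simp
  have "MCauchy \<sigma>"
    using \<sigma> C by (auto simp: MCauchy_def vdist_fun_space[OF S])
  then obtain f where "limitin mtopology \<sigma> f sequentially"
    using complete by (auto simp: mcomplete_def)
  then have "f \<in> S" "\<forall>e>0. \<exists>M. \<forall>n\<ge>M. \<sigma> n \<in> S \<and> vdist (fun_space S N) (\<sigma> n) f < e"
    by (auto simp: limit_metric_sequentially)
  moreover from this \<sigma> have "vdist (fun_space S N) (\<sigma> n) f = N (\<lambda>x. \<sigma> n x - f x)" for n
    by (intro vdist_fun_space[OF S])
  ultimately show thesis
    by (intro that[of f]) (simp, metis)
qed

section \<open>Closed linear spans\<close>

lemma submodule_fun_space_iff: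
  assumes S: "fun_subspace S"
  shows "submodule V (ring_of_type_algebra :: complex ring) (fun_space S N) \<longleftrightarrow> V \<subseteq> S \<and> fun_subspace V"
proof -
  interpret module "ring_of_type_algebra :: complex ring" "fun_space S N"
    by (rule module_fun_space[OF S])
  show ?thesis
  proof
    assume V: "submodule V (ring_of_type_algebra :: complex ring) (fun_space S N)"
    obtain f where f: "f \<in> V"
      using submoduleE(2)[OF V] by auto
    have scale: "(\<lambda>x. c *\<^sub>C g x) \<in> V" if "g \<in> V" for c g
      using submoduleE(4)[OF V _ that, of c] by (simp add: ring_of_type_algebra_def)
    then show "V \<subseteq> S \<and> fun_subspace V"
      using submoduleE(1,5)[OF V] scale[OF f, of 0]
      by (auto simp: fun_subspace_def scaleC_zero_left)
  next
    assume V: "V \<subseteq> S \<and> fun_subspace V"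
    then show "submodule V (ring_of_type_algebra :: complex ring) (fun_space S N)"
      using fun_subspaceD[of V] fun_subspace_uminus[of V]
      by (intro submoduleI) (auto simp: uminus_fun_space[OF S] subset_iff)
  qed
qed

context
  fixes S :: "('a \<Rightarrow> 'b::complex_normed_vector) set" and N
  assumes X: "complex_normed_space (fun_space S N)" and S: "fun_subspace S"
begin

interpretation complex_normed_space "fun_space S N"
  by (rule X)

lemma fun_norm_triangle: "f \<in> S \<Longrightarrow> g \<in> S \<Longrightarrow> N (\<lambda>x. f x + g x) \<le> N f + N g"
  using vnorm_triangle[of f g] by simp

lemma fun_norm_scale: "f \<in> S \<Longrightarrow> N (\<lambda>x. c *\<^sub>C f x) = norm c * N f"
  using vnorm_smult[of f c] by simp

lemma fun_norm_zero: "N (\<lambda>x. 0) = 0"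
  using vnorm_eq_zero[of "\<lambda>x. 0"] fun_subspaceD(1)[OF S] by simp

lemma fun_norm_triangle_diff:
  assumes "f \<in> S" "g \<in> S" "h \<in> S"
  shows "N (\<lambda>x. f x - h x) \<le> N (\<lambda>x. f x - g x) + N (\<lambda>x. g x - h x)"
  using fun_norm_triangle[OF fun_subspace_diff[OF S assms(1,2)] fun_subspace_diff[OF S assms(2,3)]] by simp

lemma fun_norm_minus_commute:
  assumes "f \<in> S" "g \<in> S"
  shows "N (\<lambda>x. f x - g x) = N (\<lambda>x. g x - f x)"
  using fun_norm_scale[OF fun_subspace_diff[OF S assms], of "-1"] by (simp add: scaleC_minus1)

context
  fixes V
  assumes V: "V \<subseteq> S"
begin

abbreviation (input) "cspan \<equiv> closed_lin_span (fun_space S N) V"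

text \<open>
  \<open>H\<close> is the linear span of \<open>V\<close>.  The statement replaces submodule hulls and the metric topology by
  approximation in norm.
\<close>

lemma closed_lin_span_obtains_span:
  obtains H where "V \<subseteq> H" "H \<subseteq> S" "fun_subspace H"
    "\<And>W. V \<subseteq> W \<Longrightarrow> W \<subseteq> S \<Longrightarrow> fun_subspace W \<Longrightarrow> H \<subseteq> W"
    "cspan = {f \<in> S. \<forall>e>0. \<exists>g\<in>H. N (\<lambda>x. f x - g x) < e}"
proof -
  interpret Metric_space S "vdist (fun_space S N)"
    using Metric_space_vdist by simp
  define H where "H = \<Inter>{W. (W \<subseteq> S \<and> fun_subspace W) \<and> V \<subseteq> W}"
  have HS: "H \<subseteq> S"
    unfolding H_def using S V by blast
  have "cspan = {f \<in> S. \<forall>e>0. \<exists>g\<in>H. g \<in> mball f e}"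
    by (simp add: closed_lin_span_def submodule_fun_space_iff[OF S] hull_def H_def metric_closure_of)
  also have "\<dots> = {f \<in> S. \<forall>e>0. \<exists>g\<in>H. N (\<lambda>x. f x - g x) < e}"
  proof -
    have "g \<in> mball f e \<longleftrightarrow> N (\<lambda>x. f x - g x) < e" if "f \<in> S" "g \<in> H" for f g e
      using that HS by (simp add: vdist_fun_space[OF S] subsetD)
    then have "(\<exists>g\<in>H. g \<in> mball f e) \<longleftrightarrow> (\<exists>g\<in>H. N (\<lambda>x. f x - g x) < e)" if "f \<in> S" for f e
      using that by blast
    then show ?thesis
      by (simp cong: conj_cong)
  qed
  finally show thesis
  proof (rule that[of H, rotated 4])
    show "fun_subspace H"
      by (auto simp: H_def fun_subspace_def)
  qed (use HS in \<open>auto simp: H_def\<close>)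
qed

lemma closed_lin_span_subset: "cspan \<subseteq> S"
  by (rule closed_lin_span_obtains_span) auto

lemma closed_lin_span_superset: "V \<subseteq> cspan"
proof (rule closed_lin_span_obtains_span)
  fix H
  assume H: "V \<subseteq> H" "cspan = {f \<in> S. \<forall>e>0. \<exists>g\<in>H. N (\<lambda>x. f x - g x) < e}"
  have "\<exists>g\<in>H. N (\<lambda>x. f x - g x) < e" if "f \<in> V" "0 < e" for f e
    using that H(1) fun_norm_zero by (intro bexI[of _ f]) auto
  with V show ?thesis
    by (auto simp: H(2))
qed

lemma closed_lin_span_closed:
  assumes f: "f \<in> S"
    and lim: "\<And>e. 0 < e \<Longrightarrow> \<exists>g\<in>cspan. N (\<lambda>x. f x - g x) < e"
  shows "f \<in> cspan"
proof (rule closed_lin_span_obtains_span)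
  fix H
  assume H: "H \<subseteq> S"
    "cspan = {f \<in> S. \<forall>e>0. \<exists>g\<in>H. N (\<lambda>x. f x - g x) < e}"
  have "\<exists>h\<in>H. N (\<lambda>x. f x - h x) < e" if e: "0 < e" for e
  proof -
    obtain g where g: "g \<in> S" "N (\<lambda>x. f x - g x) < e / 2" "\<forall>e>0. \<exists>h\<in>H. N (\<lambda>x. g x - h x) < e"
      using lim[OF half_gt_zero[OF e]] unfolding H(2) by blast
    then obtain h where h: "h \<in> H" "N (\<lambda>x. g x - h x) < e / 2"
      using half_gt_zero[OF e] by blast
    have "N (\<lambda>x. f x - h x) < e"
      using fun_norm_triangle_diff[OF f g(1), of h] g(2) h H(1) by auto
    with h show ?thesis
      by blast
  qed
  with f H show ?thesis
    by auto
qed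

lemma fun_subspace_closed_lin_span: "fun_subspace (cspan)"
proof (rule closed_lin_span_obtains_span)
  fix H
  assume H: "H \<subseteq> S" "fun_subspace H"
    "cspan = {f \<in> S. \<forall>e>0. \<exists>g\<in>H. N (\<lambda>x. f x - g x) < e}"
  let ?C = "{f \<in> S. \<forall>e>0. \<exists>g\<in>H. N (\<lambda>x. f x - g x) < e}"
  show ?thesis
    unfolding H(3) fun_subspace_def
  proof (intro conjI ballI allI)
    show "(\<lambda>x. 0) \<in> ?C"
      using fun_subspaceD(1)[OF S] fun_subspaceD(1)[OF H(2)] fun_norm_zero by force
  next
    fix f g
    assume f: "f \<in> ?C"
      and g: "g \<in> ?C"
    have "\<exists>h\<in>H. N (\<lambda>x. (f x + g x) - h x) < e" if e: "0 < e" for e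
    proof -
      obtain f' where f': "f' \<in> H" "N (\<lambda>x. f x - f' x) < e / 2"
        using f e half_gt_zero by blast
      obtain g' where g': "g' \<in> H" "N (\<lambda>x. g x - g' x) < e / 2"
        using g e half_gt_zero by blast
      have "N (\<lambda>x. (f x - f' x) + (g x - g' x)) \<le> N (\<lambda>x. f x - f' x) + N (\<lambda>x. g x - g' x)"
        using f g f' g' H(1) by (intro fun_norm_triangle fun_subspace_diff[OF S]) auto
      then have "N (\<lambda>x. (f x + g x) - (f' x + g' x)) < e"
        using f' g' by (simp add: algebra_simps)
      then show ?thesis
        using fun_subspaceD(2)[OF H(2) f'(1) g'(1)] by (intro bexI[of _ "\<lambda>x. f' x + g' x"])
    qed
    then show "(\<lambda>x. f x + g x) \<in> ?C"
      using fun_subspaceD(2)[OF S] f g by auto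
  next
    fix c f
    assume f: "f \<in> ?C"
    have "\<exists>h\<in>H. N (\<lambda>x. c *\<^sub>C f x - h x) < e" if e: "0 < e" for e
    proof -
      have c: "0 < norm c + 1"
        by (simp add: add_nonneg_pos)
      then have "0 < e / (norm c + 1)"
        using e by simp
      then obtain f' where f': "f' \<in> H" "N (\<lambda>x. f x - f' x) < e / (norm c + 1)"
        using f by blast
      have fS: "(\<lambda>x. f x - f' x) \<in> S"
        using f f' H(1) by (intro fun_subspace_diff[OF S]) auto
      have "N (\<lambda>x. c *\<^sub>C (f x - f' x)) = norm c * N (\<lambda>x. f x - f' x)"
        by (rule fun_norm_scale[OF fS])
      also have "\<dots> \<le> (norm c + 1) * N (\<lambda>x. f x - f' x)"
        using vnorm_nonneg[of "\<lambda>x. f x - f' x"] fS by (intro mult_right_mono) auto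
      also have "\<dots> < e"
        using f'(2) c by (simp add: field_simps)
      finally have "N (\<lambda>x. c *\<^sub>C f x - c *\<^sub>C f' x) < e"
        by (simp add: scaleC_diff_right)
      then show ?thesis
        using fun_subspaceD(3)[OF H(2) f'(1)] by (intro bexI[of _ "\<lambda>x. c *\<^sub>C f' x"])
    qed
    then show "(\<lambda>x. c *\<^sub>C f x) \<in> ?C"
      using fun_subspaceD(3)[OF S] f by auto
  qed
qed

text \<open>
  The induction principle for closed linear spans.  The closedness condition is only imposed on
  members of the closed span.
\<close>

lemma closed_lin_span_least:
  assumes "V \<subseteq> W" and W: "fun_subspace W" "W \<subseteq> S"
    and closed: "\<And>f. f \<in> cspan \<Longrightarrow>
      (\<And>e. 0 < e \<Longrightarrow> \<exists>g\<in>W. N (\<lambda>x. f x - g x) < e) \<Longrightarrow> f \<in> W"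
  shows "cspan \<subseteq> W"
proof (rule closed_lin_span_obtains_span)
  fix H
  assume H: "\<And>W. V \<subseteq> W \<Longrightarrow> W \<subseteq> S \<Longrightarrow> fun_subspace W \<Longrightarrow> H \<subseteq> W"
    "cspan = {f \<in> S. \<forall>e>0. \<exists>g\<in>H. N (\<lambda>x. f x - g x) < e}"
  have "H \<subseteq> W"
    by (rule H(1)[OF assms(1) W(2,1)])
  show ?thesis
  proof
    fix f
    assume f: "f \<in> cspan"
    then have "\<exists>g\<in>W. N (\<lambda>x. f x - g x) < e" if "0 < e" for e
      using that \<open>H \<subseteq> W\<close> unfolding H(2) by blast
    with f show "f \<in> W"
      by (rule closed)
  qed
qed

lemma complex_normed_space_closed_lin_span:
  "complex_normed_space (fun_space (cspan) N)"
proof (rule complex_normed_space_fun_space[OF fun_subspace_closed_lin_span])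
  fix f
  assume "f \<in> cspan"
  then have f: "f \<in> S"
    using closed_lin_span_subset by blast
  then show "f = (\<lambda>x. 0)" if "N f = 0"
    using that vnorm_eq_zero[of f] by simp
  show "N (\<lambda>x. c *\<^sub>C f x) \<le> norm c * N f" for c
    by (simp add: fun_norm_scale[OF f])
  fix g
  assume "g \<in> cspan"
  then show "N (\<lambda>x. f x + g x) \<le> N f + N g"
    using fun_norm_triangle[OF f] closed_lin_span_subset by blast
qed

lemma complex_banach_space_closed_lin_span:
  assumes "complex_banach_space (fun_space S N)"
  shows "complex_banach_space (fun_space (cspan) N)"
proof (rule complex_banach_space_fun_space[OF complex_normed_space_closed_lin_span
      fun_subspace_closed_lin_span])
  fix \<sigma> :: "nat \<Rightarrow> 'a \<Rightarrow> 'b"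
  assume \<sigma>: "\<And>n. \<sigma> n \<in> cspan"
    and C: "\<And>e. 0 < e \<Longrightarrow> \<exists>M. \<forall>m\<ge>M. \<forall>n\<ge>M. N (\<lambda>x. \<sigma> m x - \<sigma> n x) < e"
  have \<sigma>S: "\<sigma> n \<in> S" for n
    using \<sigma> closed_lin_span_subset by blast
  obtain f where f: "f \<in> S" "\<And>e. 0 < e \<Longrightarrow> \<exists>M. \<forall>n\<ge>M. N (\<lambda>x. \<sigma> n x - f x) < e"
    using fun_space_completeD[OF assms S \<sigma>S C] by blast
  have "f \<in> cspan"
  proof (rule closed_lin_span_closed[OF f(1)])
    fix e :: real
    assume "0 < e"
    from f(2)[OF this] obtain M where "N (\<lambda>x. \<sigma> M x - f x) < e"
      by auto
    then show "\<exists>g\<in>cspan. N (\<lambda>x. f x - g x) < e"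
      using \<sigma>[of M] fun_norm_minus_commute[OF f(1) \<sigma>S[of M]] by (intro bexI[of _ "\<sigma> M"]) simp_all
  qed
  with f(2) show "\<exists>f\<in>cspan. \<forall>e>0. \<exists>M. \<forall>n\<ge>M. N (\<lambda>x. \<sigma> n x - f x) < e"
    by blast
qed

end

end

section \<open>Bounded operators and dual spaces\<close>

lemma bounded_opsD:
  assumes "T \<in> bounded_ops X"
  shows "x \<in> carrier X \<Longrightarrow> y \<in> carrier X \<Longrightarrow> T (x \<oplus>\<^bsub>X\<^esub> y) = T x + T y"
    "x \<in> carrier X \<Longrightarrow> T (c \<odot>\<^bsub>X\<^esub> x) = c *\<^sub>C T x"
    "x \<notin> carrier X \<Longrightarrow> T x = 0"
  using assms by (auto simp: bounded_ops_def bounded_clinear_on_def clinear_on_def)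

lemma bounded_opsI:
  assumes "\<And>x y. x \<in> carrier X \<Longrightarrow> y \<in> carrier X \<Longrightarrow> T (x \<oplus>\<^bsub>X\<^esub> y) = T x + T y"
    "\<And>c x. x \<in> carrier X \<Longrightarrow> T (c \<odot>\<^bsub>X\<^esub> x) = c *\<^sub>C T x"
    "\<And>x. x \<notin> carrier X \<Longrightarrow> T x = 0"
    "\<And>x. x \<in> carrier X \<Longrightarrow> norm (T x) \<le> B * vnorm X x"
  shows "T \<in> bounded_ops X"
  using assms unfolding bounded_ops_def bounded_clinear_on_def clinear_on_def
  by (auto intro!: exI[of _ B])

context complex_normed_space
begin

lemma smult_zero_left: "x \<in> carrier X \<Longrightarrow> 0 \<odot> x = \<zero>"
  using smult_l_null[of x] by (simp add: ring_of_type_algebra_def)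

lemma smult_carrier: "x \<in> carrier X \<Longrightarrow> c \<odot> x \<in> carrier X"
  using smult_closed[of c x] by (simp add: ring_of_type_algebra_def)

lemma smult_assoc: "x \<in> carrier X \<Longrightarrow> (a * b) \<odot> x = a \<odot> (b \<odot> x)"
  using smult_assoc1[of a b x] by (simp add: ring_of_type_algebra_def)

lemma smult_one_complex: "x \<in> carrier X \<Longrightarrow> 1 \<odot> x = x"
  using smult_one[of x] by (simp add: ring_of_type_algebra_def)

lemma vnorm_zero: "vnorm X \<zero> = 0"
  using vnorm_eq_zero[of \<zero>] by simp

lemma zero_in_unit_ball: "\<zero> \<in> unit_ball X"
  by (simp add: unit_ball_def vnorm_zero)

lemma unit_ball_normalize:
  assumes x: "x \<in> carrier X" and M: "0 \<le> M" "vnorm X x \<le> M"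
  obtains y where "y \<in> unit_ball X" "x = of_real M \<odot> y"
proof (cases "M = 0")
  case True
  then have "x = \<zero>"
    using M vnorm_nonneg[OF x] vnorm_eq_zero[OF x] by simp
  then show thesis
    using that[OF zero_in_unit_ball] True by (simp add: smult_zero_left)
next
  case False
  define y where "y = of_real (1 / M) \<odot> x"
  have "y \<in> unit_ball X"
    using x M False by (simp add: y_def unit_ball_def smult_carrier vnorm_smult field_simps norm_divide)
  moreover have "of_real M \<odot> y = x"
    using x False smult_assoc[OF x, of "of_real M" "of_real (1 / M)"] smult_one_complex[OF x]
    by (simp add: y_def)
  ultimately show thesis
    using that by metis
qed

text \<open>
  Formulated for homogeneous maps that are not yet known to be bounded, so that it also applies to
  \<open>p\<close>-compact operators.
\<close>

lemma homogeneous_norm_bound: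
  fixes T :: "'a \<Rightarrow> 'f::complex_normed_vector"
  assumes T: "\<And>c x. x \<in> carrier X \<Longrightarrow> T (c \<odot> x) = c *\<^sub>C T x"
    and B: "\<And>x. x \<in> unit_ball X \<Longrightarrow> norm (T x) \<le> B" and x: "x \<in> carrier X"
  shows "norm (T x) \<le> B * vnorm X x"
proof -
  obtain y where y: "y \<in> unit_ball X" "x = of_real (vnorm X x) \<odot> y"
    by (rule unit_ball_normalize[OF x vnorm_nonneg[OF x] order_refl])
  have "norm (T x) = norm (T (of_real (vnorm X x) \<odot> y))"
    by (simp only: y(2)[symmetric])
  also have "\<dots> = vnorm X x * norm (T y)"
    using y(1) T[of y] vnorm_nonneg[OF x] by (simp add: unit_ball_def norm_scaleC)
  also have "\<dots> \<le> B * vnorm X x"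
    using B[OF y(1)] vnorm_nonneg[OF x] by (simp add: mult.commute[of B] mult_left_mono)
  finally show ?thesis .
qed

lemma op_norm_le:
  fixes T :: "'a \<Rightarrow> 'f::complex_normed_vector"
  assumes "\<And>x. x \<in> unit_ball X \<Longrightarrow> norm (T x) \<le> B"
  shows "op_norm X T \<le> B"
  unfolding op_norm_def using assms zero_in_unit_ball by (intro cSUP_least) auto

lemma norm_le_op_norm_unit_ball:
  fixes T :: "'a \<Rightarrow> 'f::complex_normed_vector"
  assumes T: "T \<in> bounded_ops X" and x: "x \<in> unit_ball X"
  shows "norm (T x) \<le> op_norm X T"
proof -
  obtain B where B: "\<And>x. x \<in> carrier X \<Longrightarrow> norm (T x) \<le> B * vnorm X x"
    using T by (auto simp: bounded_ops_def bounded_clinear_on_def)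
  have "norm (T x) \<le> \<bar>B\<bar>" if "x \<in> unit_ball X" for x
  proof -
    have x: "x \<in> carrier X" "vnorm X x \<le> 1"
      using that by (auto simp: unit_ball_def)
    have "norm (T x) \<le> B * vnorm X x"
      by (rule B[OF x(1)])
    also have "\<dots> \<le> \<bar>B\<bar> * 1"
      using x vnorm_nonneg[OF x(1)] by (intro mult_mono) auto
    finally show ?thesis
      by simp
  qed
  then show ?thesis
    unfolding op_norm_def using x by (intro cSUP_upper bdd_aboveI[of _ "\<bar>B\<bar>"]) auto
qed

lemma norm_le_op_norm:
  fixes T :: "'a \<Rightarrow> 'f::complex_normed_vector"
  assumes T: "T \<in> bounded_ops X" and x: "x \<in> carrier X"
  shows "norm (T x) \<le> op_norm X T * vnorm X x"
  by (rule homogeneous_norm_bound[OF bounded_opsD(2)[OF T] norm_le_op_norm_unit_ball[OF T] x])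

lemma op_norm_nonneg:
  fixes T :: "'a \<Rightarrow> 'f::complex_normed_vector"
  assumes "T \<in> bounded_ops X"
  shows "0 \<le> op_norm X T"
  using norm_le_op_norm_unit_ball[OF assms zero_in_unit_ball] norm_ge_zero order_trans by blast

lemma fun_subspace_bounded_ops: "fun_subspace (bounded_ops X :: ('a \<Rightarrow> 'f::complex_normed_vector) set)"
  unfolding fun_subspace_def
proof (intro conjI ballI allI)
  show "(\<lambda>x. 0 :: 'f) \<in> bounded_ops X"
    by (rule bounded_opsI[where B = 0]) (simp_all add: scaleC_zero_right)
next
  fix T S :: "'a \<Rightarrow> 'f"
  assume TS: "T \<in> bounded_ops X" "S \<in> bounded_ops X"
  show "(\<lambda>x. T x + S x) \<in> bounded_ops X"
  proof (rule bounded_opsI[where B = "op_norm X T + op_norm X S"])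
    fix x
    assume x: "x \<in> carrier X"
    show "norm (T x + S x) \<le> (op_norm X T + op_norm X S) * vnorm X x"
      using norm_le_op_norm[OF TS(1) x] norm_le_op_norm[OF TS(2) x] norm_triangle_ineq[of "T x" "S x"]
      by (simp add: distrib_right)
  qed (simp_all add: bounded_opsD[OF TS(1)] bounded_opsD[OF TS(2)] scaleC_add_right)
next
  fix T :: "'a \<Rightarrow> 'f" and c
  assume T: "T \<in> bounded_ops X"
  show "(\<lambda>x. c *\<^sub>C T x) \<in> bounded_ops X"
  proof (rule bounded_opsI[where B = "norm c * op_norm X T"])
    fix x
    assume x: "x \<in> carrier X"
    show "norm (c *\<^sub>C T x) \<le> (norm c * op_norm X T) * vnorm X x"
      using mult_left_mono[OF norm_le_op_norm[OF T x], of "norm c"] by (simp add: norm_scaleC mult.assoc)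
  qed (simp_all add: bounded_opsD[OF T] scaleC_add_right scaleC_scaleC scaleC_zero_right mult.commute)
qed

lemma complex_normed_space_dual: "complex_normed_space (dual_space X)"
  unfolding dual_space_def
proof (rule complex_normed_space_fun_space[OF fun_subspace_bounded_ops])
  fix T :: "'a \<Rightarrow> complex"
  assume T: "T \<in> bounded_ops X"
  show "T = (\<lambda>x. 0)" if "op_norm X T = 0"
  proof
    fix x
    show "T x = 0"
      using norm_le_op_norm[OF T, of x] bounded_opsD(3)[OF T, of x] that by (cases "x \<in> carrier X") auto
  qed
  show "op_norm X (\<lambda>x. c *\<^sub>C T x) \<le> norm c * op_norm X T" for c
  proof (rule op_norm_le)
    fix x
    assume "x \<in> unit_ball X"
    then show "norm (c *\<^sub>C T x) \<le> norm c * op_norm X T"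
      using norm_le_op_norm_unit_ball[OF T, of x] by (simp add: norm_scaleC mult_left_mono)
  qed
  fix S :: "'a \<Rightarrow> complex"
  assume S: "S \<in> bounded_ops X"
  show "op_norm X (\<lambda>x. T x + S x) \<le> op_norm X T + op_norm X S"
  proof (rule op_norm_le)
    fix x
    assume x: "x \<in> unit_ball X"
    show "norm (T x + S x) \<le> op_norm X T + op_norm X S"
      by (intro norm_triangle_mono norm_le_op_norm_unit_ball x T S)
  qed
qed

text \<open>
  A Cauchy sequence of functionals converges pointwise, and the Cauchy estimates pass to the limit.
\<close>

lemma complex_banach_space_dual: "complex_banach_space (dual_space X)"
  unfolding dual_space_def
proof (rule complex_banach_space_fun_space[OF complex_normed_space_dual[unfolded dual_space_def]
      fun_subspace_bounded_ops])
  fix \<sigma> :: "nat \<Rightarrow> 'a \<Rightarrow> complex"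
  assume \<sigma>: "\<And>n. \<sigma> n \<in> bounded_ops X"
    and C: "\<And>e. 0 < e \<Longrightarrow> \<exists>M. \<forall>m\<ge>M. \<forall>n\<ge>M. op_norm X (\<lambda>x. \<sigma> m x - \<sigma> n x) < e"
  have diff: "norm (\<sigma> m x - \<sigma> n x) \<le> op_norm X (\<lambda>x. \<sigma> m x - \<sigma> n x) * vnorm X x"
    if "x \<in> carrier X" for m n x
    using norm_le_op_norm[OF fun_subspace_diff[OF fun_subspace_bounded_ops \<sigma> \<sigma>] that] .
  have Cx: "convergent (\<lambda>n. \<sigma> n x)" if x: "x \<in> carrier X" for x
  proof (rule Cauchy_convergent, rule metric_CauchyI)
    fix e :: real
    assume e: "0 < e"
    define d where "d = e / (vnorm X x + 1)"
    have pos: "0 < vnorm X x + 1"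
      using vnorm_nonneg[OF x] by simp
    then have d: "0 < d" "d * (vnorm X x + 1) = e"
      using e by (simp_all add: d_def)
    obtain M where M: "\<And>m n. M \<le> m \<Longrightarrow> M \<le> n \<Longrightarrow> op_norm X (\<lambda>x. \<sigma> m x - \<sigma> n x) < d"
      using C[OF d(1)] by blast
    have "dist (\<sigma> m x) (\<sigma> n x) < e" if "M \<le> m" "M \<le> n" for m n
    proof -
      have "dist (\<sigma> m x) (\<sigma> n x) \<le> op_norm X (\<lambda>x. \<sigma> m x - \<sigma> n x) * vnorm X x"
        using diff[OF x] by (simp add: dist_norm)
      also have "\<dots> \<le> d * vnorm X x"
        using M[OF that] vnorm_nonneg[OF x] by (intro mult_right_mono) auto
      also have "\<dots> < e"
        using d by (simp add: distrib_left)
      finally show ?thesis .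
    qed
    then show "\<exists>M. \<forall>m\<ge>M. \<forall>n\<ge>M. dist (\<sigma> m x) (\<sigma> n x) < e"
      by blast
  qed
  define T where "T x = lim (\<lambda>n. \<sigma> n x)" for x
  have lim: "(\<lambda>n. \<sigma> n x) \<longlonglongrightarrow> T x" if "x \<in> carrier X" for x
    unfolding T_def using Cx[OF that] by (simp add: convergent_LIMSEQ_iff)
  have T_add: "T (x \<oplus> y) = T x + T y" if "x \<in> carrier X" "y \<in> carrier X" for x y
  proof (rule LIMSEQ_unique)
    show "(\<lambda>n. \<sigma> n (x \<oplus> y)) \<longlonglongrightarrow> T (x \<oplus> y)"
      using that by (intro lim) simp
    show "(\<lambda>n. \<sigma> n (x \<oplus> y)) \<longlonglongrightarrow> T x + T y"
      using tendsto_add[OF lim[OF that(1)] lim[OF that(2)]] that by (simp add: bounded_opsD[OF \<sigma>])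
  qed
  have T_scale: "T (c \<odot> x) = c *\<^sub>C T x" if "x \<in> carrier X" for c x
  proof (rule LIMSEQ_unique)
    show "(\<lambda>n. \<sigma> n (c \<odot> x)) \<longlonglongrightarrow> T (c \<odot> x)"
      using that by (intro lim smult_carrier)
    show "(\<lambda>n. \<sigma> n (c \<odot> x)) \<longlonglongrightarrow> c *\<^sub>C T x"
      using bounded_linear.tendsto[OF bounded_linear_scaleC_right lim[OF that]] that
      by (simp add: bounded_opsD[OF \<sigma>])
  qed
  have T_out: "T x = 0" if "x \<notin> carrier X" for x
    unfolding T_def using that by (simp add: bounded_opsD[OF \<sigma>])
  have T_near: "norm (\<sigma> n x - T x) \<le> e * vnorm X x"
    if x: "x \<in> carrier X" and M: "\<And>m. M \<le> m \<Longrightarrow> op_norm X (\<lambda>x. \<sigma> n x - \<sigma> m x) \<le> e" for n x e M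
  proof (rule LIMSEQ_le_const2)
    show "(\<lambda>m. norm (\<sigma> n x - \<sigma> m x)) \<longlonglongrightarrow> norm (\<sigma> n x - T x)"
      by (intro tendsto_intros lim[OF x])
    have "norm (\<sigma> n x - \<sigma> m x) \<le> e * vnorm X x" if "M \<le> m" for m
      using diff[OF x, of n m] mult_right_mono[OF M[OF that] vnorm_nonneg[OF x]] by simp
    then show "\<exists>N. \<forall>m\<ge>N. norm (\<sigma> n x - \<sigma> m x) \<le> e * vnorm X x"
      by blast
  qed
  have "T \<in> bounded_ops X"
  proof -
    obtain M where M: "\<And>m n. M \<le> m \<Longrightarrow> M \<le> n \<Longrightarrow> op_norm X (\<lambda>x. \<sigma> m x - \<sigma> n x) < 1"
      using C[of 1] by auto
    show ?thesis
    proof (rule bounded_opsI[where B = "op_norm X (\<sigma> M) + 1"])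
      fix x
      assume x: "x \<in> carrier X"
      have "norm (\<sigma> M x - T x) \<le> 1 * vnorm X x"
        using M by (intro T_near[OF x, of M]) (simp add: less_imp_le)
      moreover have "norm (\<sigma> M x) \<le> op_norm X (\<sigma> M) * vnorm X x"
        by (rule norm_le_op_norm[OF \<sigma> x])
      ultimately show "norm (T x) \<le> (op_norm X (\<sigma> M) + 1) * vnorm X x"
        using norm_triangle_ineq4[of "\<sigma> M x" "\<sigma> M x - T x"] by (simp add: distrib_right)
    qed (rule T_add T_scale T_out; assumption)+
  qed
  moreover have "\<exists>M. \<forall>n\<ge>M. op_norm X (\<lambda>x. \<sigma> n x - T x) < e" if e: "0 < e" for e
  proof -
    obtain M where M: "\<And>m n. M \<le> m \<Longrightarrow> M \<le> n \<Longrightarrow> op_norm X (\<lambda>x. \<sigma> m x - \<sigma> n x) < e / 2"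
      using C[of "e / 2"] e by auto
    have "op_norm X (\<lambda>x. \<sigma> n x - T x) \<le> e / 2" if "M \<le> n" for n
    proof (rule op_norm_le)
      fix x
      assume x: "x \<in> unit_ball X"
      have "norm (\<sigma> n x - T x) \<le> e / 2 * vnorm X x"
        using M[OF that] x by (intro T_near[of x M]) (auto simp: unit_ball_def less_imp_le)
      also have "\<dots> \<le> e / 2"
        using e x by (intro mult_left_le) (auto simp: unit_ball_def)
      finally show "norm (\<sigma> n x - T x) \<le> e / 2" .
    qed
    then show ?thesis
      using e by (intro exI[of _ M]) force
  qed
  ultimately show "\<exists>T\<in>bounded_ops X. \<forall>e>0. \<exists>M. \<forall>n\<ge>M. op_norm X (\<lambda>x. \<sigma> n x - T x) < e"
    by blast
qed

end

text \<open>
  Pointwise sums and multiples of \<open>f\<close> lead to Minkowski sums and multiples of \<open>f(A)\<close>, on which \<open>m\<^sub>p\<close> is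
  subadditive and homogeneous.  Both sides of the final isometry are of this form: bounded
  holomorphic functions with \<open>A = U\<close>, and bounded operators with \<open>A\<close> the unit ball.
\<close>

lemma complex_normed_space_m_p:
  fixes V :: "('a \<Rightarrow> 'f::complex_banach) set"
  assumes p: "1 \<le> p" and V: "fun_subspace V"
    and sep: "\<And>f. f \<in> V \<Longrightarrow> (\<And>x. x \<in> A \<Longrightarrow> f x = 0) \<Longrightarrow> f = (\<lambda>x. 0)"
  shows "fun_subspace {f \<in> V. rel_p_compact p (f ` A)}"
    and "complex_normed_space (fun_space {f \<in> V. rel_p_compact p (f ` A)} (\<lambda>f. m_p p (f ` A)))"
proof -
  have add: "rel_p_compact p ((\<lambda>x. f x + g x) ` A)"
      "m_p p ((\<lambda>x. f x + g x) ` A) \<le> m_p p (f ` A) + m_p p (g ` A)"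
    if "rel_p_compact p (f ` A)" "rel_p_compact p (g ` A)" for f g :: "'a \<Rightarrow> 'f"
    using m_p_add[OF p that, of "(\<lambda>x. f x + g x) ` A"] by blast+
  have scale: "rel_p_compact p ((\<lambda>x. c *\<^sub>C f x) ` A)"
      "m_p p ((\<lambda>x. c *\<^sub>C f x) ` A) \<le> norm c * m_p p (f ` A)"
    if "rel_p_compact p (f ` A)" for c and f :: "'a \<Rightarrow> 'f"
    using m_p_scale[OF p that, of "(\<lambda>x. c *\<^sub>C f x) ` A" c] by blast+
  have "rel_p_compact p ((\<lambda>x. 0 :: 'f) ` A)"
    by (rule m_p_subset_zero[OF p]) auto
  then show S: "fun_subspace {f \<in> V. rel_p_compact p (f ` A)}"
    using fun_subspaceD[OF V] add scale by (auto simp: fun_subspace_def)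
  show "complex_normed_space (fun_space {f \<in> V. rel_p_compact p (f ` A)} (\<lambda>f. m_p p (f ` A)))"
  proof (rule complex_normed_space_fun_space[OF S])
    fix f
    assume f: "f \<in> {f \<in> V. rel_p_compact p (f ` A)}" "m_p p (f ` A) = 0"
    then have "norm (f x) \<le> 0" if "x \<in> A" for x
      using norm_le_m_p[OF p, of "f ` A" "f x"] that by auto
    then show "f = (\<lambda>x. 0)"
      using f by (intro sep) auto
  qed (use add scale in auto)
qed

section \<open>Bounded holomorphic functions and their predual\<close>

lemma Hinf_type_space_iff:
  fixes f :: "'e::complex_normed_vector \<Rightarrow> 'f::complex_normed_vector"
  shows "f \<in> Hinf U type_space \<longleftrightarrow>
    (\<forall>x\<in>U. \<exists>D. (f has_derivative D) (at x within U) \<and> (\<forall>c h. D (c *\<^sub>C h) = c *\<^sub>C D h)) \<and>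
    (\<exists>B. \<forall>x\<in>U. norm (f x) \<le> B) \<and> (\<forall>x. x \<notin> U \<longrightarrow> f x = 0)"
  by (auto simp: Hinf_def holo_on_type_space)

lemma Hinf_outside: "f \<in> Hinf U Y \<Longrightarrow> x \<notin> U \<Longrightarrow> f x = \<zero>\<^bsub>Y\<^esub>"
  by (simp add: Hinf_def)

lemma
  assumes "g \<in> Hinf U Y"
  shows sup_norm_upper: "x \<in> U \<Longrightarrow> vnorm Y (g x) \<le> sup_norm U Y g"
    and sup_norm_nonneg: "0 \<le> sup_norm U Y g"
proof -
  obtain B where "\<And>x. x \<in> U \<Longrightarrow> vnorm Y (g x) \<le> B"
    using assms by (auto simp: Hinf_def)
  then have "bdd_above (insert 0 ((\<lambda>x. vnorm Y (g x)) ` U))"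
    by (intro bdd_aboveI[of _ "max 0 B"]) (auto intro: max.coboundedI2)
  then show "x \<in> U \<Longrightarrow> vnorm Y (g x) \<le> sup_norm U Y g" "0 \<le> sup_norm U Y g"
    unfolding sup_norm_def by (auto intro: cSup_upper)
qed

lemma sup_norm_le:
  assumes "0 \<le> B" "\<And>x. x \<in> U \<Longrightarrow> vnorm Y (g x) \<le> B"
  shows "sup_norm U Y g \<le> B"
  unfolding sup_norm_def using assms by (intro cSup_least) auto

lemma Hinf_norm_le_sup_norm:
  assumes "f \<in> Hinf U type_space"
  shows "norm (f x) \<le> sup_norm U type_space f"
  using sup_norm_upper[OF assms, of x] sup_norm_nonneg[OF assms] Hinf_outside[OF assms, of x]
  by (cases "x \<in> U") auto

lemma Hinf_compose:
  fixes f :: "'e::complex_normed_vector \<Rightarrow> 'f::complex_normed_vector"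
    and L :: "'f \<Rightarrow> 'g::complex_normed_vector"
  assumes f: "f \<in> Hinf U type_space" and L: "bounded_linear L" "\<And>c y. L (c *\<^sub>C y) = c *\<^sub>C L y"
  shows "(\<lambda>x. L (f x)) \<in> Hinf U type_space"
  unfolding Hinf_type_space_iff
proof (intro conjI ballI allI impI)
  fix x
  assume "x \<in> U"
  then obtain D where "(f has_derivative D) (at x within U)" "\<forall>c h. D (c *\<^sub>C h) = c *\<^sub>C D h"
    using f by (auto simp: Hinf_type_space_iff)
  then show "\<exists>D. ((\<lambda>x. L (f x)) has_derivative D) (at x within U) \<and> (\<forall>c h. D (c *\<^sub>C h) = c *\<^sub>C D h)"
    using L by (intro exI[of _ "\<lambda>h. L (D h)"]) (simp add: bounded_linear.has_derivative)
next
  obtain K where K: "0 \<le> K" "\<And>y. norm (L y) \<le> norm y * K"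
    using bounded_linear.nonneg_bounded[OF L(1)] by blast
  have "norm (L (f x)) \<le> sup_norm U type_space f * K" for x
    using K(2)[of "f x"] mult_right_mono[OF Hinf_norm_le_sup_norm[OF f, of x] K(1)] by simp
  then show "\<exists>B. \<forall>x\<in>U. norm (L (f x)) \<le> B"
    by blast
next
  fix x
  assume "x \<notin> U"
  then show "L (f x) = 0"
    using Hinf_outside[OF f, of x] linear_0[OF bounded_linear.linear[OF L(1)]] by simp
qed

lemma fun_subspace_Hinf:
  "fun_subspace (Hinf U type_space :: ('e::complex_normed_vector \<Rightarrow> 'f::complex_normed_vector) set)"
  unfolding fun_subspace_def
proof (intro conjI ballI allI)
  show "(\<lambda>x. 0 :: 'f) \<in> Hinf U type_space"
    by (auto simp: Hinf_type_space_iff scaleC_zero_right intro!: exI[of _ "\<lambda>_. 0"])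
next
  fix f g :: "'e \<Rightarrow> 'f"
  assume f: "f \<in> Hinf U type_space" and g: "g \<in> Hinf U type_space"
  show "(\<lambda>x. f x + g x) \<in> Hinf U type_space"
    unfolding Hinf_type_space_iff
  proof (intro conjI ballI allI impI)
    fix x
    assume x: "x \<in> U"
    obtain D where D: "(f has_derivative D) (at x within U)" "\<forall>c h. D (c *\<^sub>C h) = c *\<^sub>C D h"
      using f x by (auto simp: Hinf_type_space_iff)
    obtain D' where D': "(g has_derivative D') (at x within U)" "\<forall>c h. D' (c *\<^sub>C h) = c *\<^sub>C D' h"
      using g x by (auto simp: Hinf_type_space_iff)
    show "\<exists>D. ((\<lambda>x. f x + g x) has_derivative D) (at x within U) \<and> (\<forall>c h. D (c *\<^sub>C h) = c *\<^sub>C D h)"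
      using D D' by (intro exI[of _ "\<lambda>h. D h + D' h"]) (auto intro: has_derivative_add simp: scaleC_add_right)
  next
    show "\<exists>B. \<forall>x\<in>U. norm (f x + g x) \<le> B"
      using Hinf_norm_le_sup_norm[OF f] Hinf_norm_le_sup_norm[OF g]
      by (intro exI[of _ "sup_norm U type_space f + sup_norm U type_space g"] ballI norm_triangle_mono)
  qed (use Hinf_outside[OF f] Hinf_outside[OF g] in simp)
next
  fix f :: "'e \<Rightarrow> 'f" and c
  assume "f \<in> Hinf U type_space"
  then show "(\<lambda>x. c *\<^sub>C f x) \<in> Hinf U type_space"
    by (rule Hinf_compose[OF _ bounded_linear_scaleC_right]) (simp add: scaleC_scaleC mult.commute)
qed

lemma complex_normed_space_Hinf:
  "complex_normed_space
    (Hinf_space U :: ('e::complex_normed_vector \<Rightarrow> 'f::complex_normed_vector) cspace)"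
  unfolding Hinf_space_def
proof (rule complex_normed_space_fun_space[OF fun_subspace_Hinf])
  fix f :: "'e \<Rightarrow> 'f"
  assume f: "f \<in> Hinf U type_space"
  show "f = (\<lambda>x. 0)" if "sup_norm U type_space f = 0"
    using Hinf_norm_le_sup_norm[OF f] that by auto
  show "sup_norm U type_space (\<lambda>x. c *\<^sub>C f x) \<le> norm c * sup_norm U type_space f" for c
    using sup_norm_nonneg[OF f] Hinf_norm_le_sup_norm[OF f]
    by (intro sup_norm_le) (auto simp: norm_scaleC intro: mult_left_mono)
  fix g :: "'e \<Rightarrow> 'f"
  assume g: "g \<in> Hinf U type_space"
  show "sup_norm U type_space (\<lambda>x. f x + g x) \<le> sup_norm U type_space f + sup_norm U type_space g"
    using sup_norm_nonneg[OF f] sup_norm_nonneg[OF g] Hinf_norm_le_sup_norm[OF f] Hinf_norm_le_sup_norm[OF g]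
    by (intro sup_norm_le) (auto intro: norm_triangle_mono)
qed

lemma Hinf_space_simps [simp]:
  "carrier (Hinf_space U) = Hinf U type_space" "zero (Hinf_space U) = (\<lambda>x. 0)"
  "add (Hinf_space U) = (\<lambda>f g x. f x + g x)" "smult (Hinf_space U) = (\<lambda>c f x. c *\<^sub>C f x)"
  "vnorm (Hinf_space U) = sup_norm U type_space"
  by (simp_all add: Hinf_space_def)

abbreviation Hinf_dual :: "'e::complex_normed_vector set \<Rightarrow> (('e \<Rightarrow> complex) \<Rightarrow> complex) set"
  where "Hinf_dual U \<equiv> bounded_ops (Hinf_space U)"

abbreviation dual_norm :: "'e::complex_normed_vector set \<Rightarrow> (('e \<Rightarrow> complex) \<Rightarrow> complex) \<Rightarrow> real"
  where "dual_norm U \<equiv> op_norm (Hinf_space U)"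

lemmas norm_le_Hinf_dual_norm =
  complex_normed_space.norm_le_op_norm[OF complex_normed_space_Hinf, unfolded Hinf_space_simps]

lemmas fun_subspace_Hinf_dual =
  complex_normed_space.fun_subspace_bounded_ops[OF complex_normed_space_Hinf]

lemma Hinf_dual_norm_le:
  assumes "\<And>f. f \<in> Hinf U type_space \<Longrightarrow> sup_norm U type_space f \<le> 1 \<Longrightarrow> norm (\<phi> f) \<le> B"
  shows "dual_norm U \<phi> \<le> B"
  by (rule complex_normed_space.op_norm_le[OF complex_normed_space_Hinf])
    (use assms in \<open>auto simp: unit_ball_def\<close>)

lemma delta_in_dual: "delta U x \<in> Hinf_dual U"
proof (rule bounded_opsI[where B = 1])
  fix f g :: "'a \<Rightarrow> complex"
  assume "f \<in> carrier (Hinf_space U)" "g \<in> carrier (Hinf_space U)"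
  then show "delta U x (f \<oplus>\<^bsub>Hinf_space U\<^esub> g) = delta U x f + delta U x g"
    using fun_subspaceD(2)[OF fun_subspace_Hinf, of f U g] by (simp add: delta_def)
next
  fix f :: "'a \<Rightarrow> complex" and c
  assume "f \<in> carrier (Hinf_space U)"
  then show "delta U x (c \<odot>\<^bsub>Hinf_space U\<^esub> f) = c *\<^sub>C delta U x f"
    using fun_subspaceD(3)[OF fun_subspace_Hinf, of f U c] by (simp add: delta_def)
qed (use Hinf_norm_le_sup_norm[of _ U x] in \<open>auto simp: delta_def\<close>)

lemma delta_image_subset_dual: "delta U ` U \<subseteq> Hinf_dual U"
  using delta_in_dual by blast

lemma delta_norm_le: "dual_norm U (delta U x) \<le> 1"
proof (rule Hinf_dual_norm_le)
  fix f :: "'a \<Rightarrow> complex"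
  assume "f \<in> Hinf U type_space" "sup_norm U type_space f \<le> 1"
  then show "norm (delta U x f) \<le> 1"
    using Hinf_norm_le_sup_norm[of f U x] by (simp add: delta_def)
qed

text \<open>
  As a closed linear span in a function space, \<open>G\<^sup>\<infinity>(U)\<close> inherits the general results on such spans.
\<close>

lemma Ginf_eq_fun_space:
  "Ginf U = fun_space (closed_lin_span (fun_space (Hinf_dual U) (dual_norm U)) (delta U ` U))
    (dual_norm U)"
  by (simp add: Ginf_def dual_space_def fun_space_def)

lemma Ginf_simps [simp]:
  "zero (Ginf U) = (\<lambda>x. 0)"
  "add (Ginf U) = (\<lambda>f g x. f x + g x)" "smult (Ginf U) = (\<lambda>c f x. c *\<^sub>C f x)"
  "vnorm (Ginf U) = dual_norm U"
  by (simp_all add: Ginf_eq_fun_space)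

lemma carrier_Ginf:
  "carrier (Ginf U) = closed_lin_span (fun_space (Hinf_dual U) (dual_norm U)) (delta U ` U)"
  by (simp add: Ginf_eq_fun_space)

lemmas complex_normed_space_Hinf_dual =
  complex_normed_space.complex_normed_space_dual[OF complex_normed_space_Hinf, unfolded dual_space_def]

lemmas closed_lin_span_Ginf_premises =
  complex_normed_space_Hinf_dual fun_subspace_Hinf_dual delta_image_subset_dual

lemma Ginf_subset_dual: "carrier (Ginf U) \<subseteq> Hinf_dual U"
  unfolding carrier_Ginf by (rule closed_lin_span_subset[OF closed_lin_span_Ginf_premises])

lemma delta_in_Ginf: "x \<in> U \<Longrightarrow> delta U x \<in> carrier (Ginf U)"
  using closed_lin_span_superset[OF closed_lin_span_Ginf_premises] by (auto simp: carrier_Ginf)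

lemma fun_subspace_Ginf: "fun_subspace (carrier (Ginf U))"
  unfolding carrier_Ginf by (rule fun_subspace_closed_lin_span[OF closed_lin_span_Ginf_premises])

lemma Ginf_closed:
  assumes "\<phi> \<in> Hinf_dual U"
    and "\<And>e. 0 < e \<Longrightarrow> \<exists>\<psi>\<in>carrier (Ginf U). dual_norm U (\<lambda>f. \<phi> f - \<psi> f) < e"
  shows "\<phi> \<in> carrier (Ginf U)"
  unfolding carrier_Ginf
  by (rule closed_lin_span_closed[OF closed_lin_span_Ginf_premises assms(1)])
    (use assms(2) in \<open>simp add: carrier_Ginf\<close>)

lemma Ginf_least:
  assumes "delta U ` U \<subseteq> W" and W: "fun_subspace W" "W \<subseteq> Hinf_dual U"
    and closed: "\<And>\<phi>. \<phi> \<in> carrier (Ginf U) \<Longrightarrow>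
      (\<And>e. 0 < e \<Longrightarrow> \<exists>\<psi>\<in>W. dual_norm U (\<lambda>f. \<phi> f - \<psi> f) < e) \<Longrightarrow> \<phi> \<in> W"
  shows "carrier (Ginf U) \<subseteq> W"
  unfolding carrier_Ginf
  by (rule closed_lin_span_least[OF closed_lin_span_Ginf_premises assms(1-3)])
    (use closed in \<open>simp add: carrier_Ginf\<close>)

lemma complex_banach_space_Ginf: "complex_banach_space (Ginf U)"
  unfolding Ginf_eq_fun_space
  by (rule complex_banach_space_closed_lin_span[OF closed_lin_span_Ginf_premises
        complex_normed_space.complex_banach_space_dual[OF complex_normed_space_Hinf, unfolded dual_space_def]])

lemma minus_Ginf: "\<psi> \<in> carrier (Ginf U) \<Longrightarrow> \<phi> \<ominus>\<^bsub>Ginf U\<^esub> \<psi> = (\<lambda>f. \<phi> f - \<psi> f)"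
  unfolding Ginf_eq_fun_space using fun_subspace_Ginf[of U]
  by (intro minus_fun_space) (simp_all add: carrier_Ginf)

section \<open>Cauchy estimates\<close>

text \<open>
  Cauchy's estimate on the disc of radius \<open>R / 2\<close>, up to whose boundary \<open>h\<close> is continuous; the values lie
  strictly inside the disc of radius 2.
\<close>

lemma deriv_0_bound:
  assumes h: "h holomorphic_on ball 0 R" and R: "0 < R" and le: "\<And>z. z \<in> ball 0 R \<Longrightarrow> norm (h z) \<le> 1"
  shows "norm (deriv h 0) \<le> 4 / R"
proof -
  have sub: "cball 0 (R / 2) \<subseteq> ball (0::complex) R"
    using R by auto
  have "norm ((deriv ^^ 1) h 0) \<le> fact 1 * 2 / (R / 2) ^ 1"
  proof (rule Cauchy_higher_deriv_bound[where y = 0])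
    show "h holomorphic_on ball 0 (R / 2)"
      using holomorphic_on_subset[OF h] sub ball_subset_cball by blast
    show "continuous_on (cball 0 (R / 2)) h"
      using holomorphic_on_imp_continuous_on[OF h] sub continuous_on_subset by blast
    show "h w \<in> ball 0 2" if "w \<in> ball 0 (R / 2)" for w
      using le[of w] that R by auto
  qed (use R in auto)
  then show ?thesis
    by simp
qed

text \<open>
  For \<open>R \<ge> 4\<close>, discs of radius \<open>R / 2\<close> around points of the closed unit disc stay in the domain.
  So Cauchy's estimate bounds the second derivative on the unit disc, and Taylor's formula applies.
\<close>

lemma first_order_remainder_bound:
  assumes h: "h holomorphic_on ball 0 R" and R: "4 \<le> R" and le: "\<And>z. z \<in> ball 0 R \<Longrightarrow> norm (h z) \<le> 1"
  shows "norm (h 1 - h 0 - deriv h 0) \<le> 16 / R\<^sup>2"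
proof -
  have second: "norm ((deriv ^^ 2) h z) \<le> 16 / R\<^sup>2" if z: "z \<in> cball 0 1" for z
  proof -
    have sub: "cball z (R / 2) \<subseteq> ball 0 R"
    proof
      fix w
      assume "w \<in> cball z (R / 2)"
      then have "norm w \<le> 1 + R / 2"
        using z norm_triangle_ineq4[of z "z - w"] by (simp add: dist_norm)
      then show "w \<in> ball 0 R"
        using R by simp
    qed
    have "norm ((deriv ^^ 2) h z) \<le> fact 2 * 2 / (R / 2) ^ 2"
    proof (rule Cauchy_higher_deriv_bound[where y = 0])
      show "h holomorphic_on ball z (R / 2)"
        using holomorphic_on_subset[OF h] sub ball_subset_cball by blast
      show "continuous_on (cball z (R / 2)) h"
        using holomorphic_on_imp_continuous_on[OF h] sub continuous_on_subset by blast
      show "h w \<in> ball 0 2" if "w \<in> ball z (R / 2)" for w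
      proof -
        have "w \<in> ball 0 R"
          using that sub ball_subset_cball by blast
        from le[OF this] show ?thesis
          by simp
      qed
    qed (use R in auto)
    then show ?thesis
      by (simp add: power_divide fact_numeral)
  qed
  have "norm ((deriv ^^ 0) h 1 - (\<Sum>i\<le>1. (deriv ^^ i) h 0 * (1 - 0) ^ i / fact i))
      \<le> 16 / R\<^sup>2 * norm (1 - 0 :: complex) ^ Suc 1 / fact 1"
  proof (rule complex_Taylor[where f = "\<lambda>i. (deriv ^^ i) h" and S = "cball 0 1"])
    show "((deriv ^^ i) h has_field_derivative (deriv ^^ Suc i) h z) (at z within cball 0 1)"
      if "z \<in> cball 0 1" for i z
    proof -
      have "(deriv ^^ i) h holomorphic_on ball 0 R"
        by (rule holomorphic_higher_deriv[OF h open_ball])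
      moreover have "z \<in> ball 0 R"
        using that R by auto
      ultimately show ?thesis
        using holomorphic_derivI[OF _ open_ball] by simp
    qed
    show "norm ((deriv ^^ Suc 1) h z) \<le> 16 / R\<^sup>2" if "z \<in> cball 0 1" for z
      using second[OF that] by (simp add: numeral_2_eq_2)
  qed auto
  then show ?thesis
    by (simp add: algebra_simps)
qed

section \<open>Holomorphy of the evaluation map\<close>

text \<open>
  The functional \<open>f \<mapsto> f'(x)k\<close>, which is the derivative of \<open>\<delta>\<close> at \<open>x\<close> in the direction \<open>k\<close>.
\<close>

definition delta_deriv :: "'e::complex_normed_vector set \<Rightarrow> 'e \<Rightarrow> 'e \<Rightarrow> ('e \<Rightarrow> complex) \<Rightarrow> complex"
  where "delta_deriv U x k = (\<lambda>f. if f \<in> Hinf U type_space then frechet_derivative f (at x) k else 0)"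

lemma Hinf_has_derivative:
  fixes f :: "'e::complex_normed_vector \<Rightarrow> 'f::complex_normed_vector"
  assumes "open U" "f \<in> Hinf U type_space" "x \<in> U"
  shows "(f has_derivative frechet_derivative f (at x)) (at x)"
    "frechet_derivative f (at x) (c *\<^sub>C k) = c *\<^sub>C frechet_derivative f (at x) k"
proof -
  obtain D where "(f has_derivative D) (at x within U)" "\<forall>c h. D (c *\<^sub>C h) = c *\<^sub>C D h"
    using assms by (auto simp: Hinf_type_space_iff)
  then have D: "(f has_derivative D) (at x)" "\<And>c h. D (c *\<^sub>C h) = c *\<^sub>C D h"
    using assms at_within_open[of x U] by auto
  have "D = frechet_derivative f (at x)"
    by (rule frechet_derivative_at[OF D(1)])
  with D show "(f has_derivative frechet_derivative f (at x)) (at x)"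
    "frechet_derivative f (at x) (c *\<^sub>C k) = c *\<^sub>C frechet_derivative f (at x) k"
    by auto
qed

text \<open>
  The bound on \<open>\<parallel>k\<parallel> R\<close> makes the disc of radius \<open>R\<close> in the line \<open>x + z k\<close> stay in \<open>U\<close>.
\<close>

lemma Hinf_restrict_line:
  fixes f :: "'e::complex_normed_vector \<Rightarrow> complex"
  assumes U: "open U" and f: "f \<in> Hinf U type_space" and sub: "ball x r \<subseteq> U" and r: "0 < r"
    and k: "norm k * R \<le> r" and R: "0 < R"
  defines "h \<equiv> \<lambda>z. f (x + z *\<^sub>C k)"
  shows "h holomorphic_on ball 0 R" "deriv h 0 = frechet_derivative f (at x) k"
proof -
  have deriv: "(h has_field_derivative frechet_derivative f (at (x + z *\<^sub>C k)) k) (at z)" if z: "z \<in> ball 0 R" for z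
  proof -
    have "norm (z *\<^sub>C k) < r"
    proof (cases "k = 0")
      case False
      then have "norm z * norm k < R * norm k"
        using z by (intro mult_strict_right_mono) auto
      then show ?thesis
        using k by (simp add: norm_scaleC mult.commute)
    qed (use r in \<open>simp add: scaleC_zero_right\<close>)
    then have "x + z *\<^sub>C k \<in> U"
      using sub by (auto simp: dist_norm)
    note D = Hinf_has_derivative[OF U f this]
    have "((\<lambda>z. x + z *\<^sub>C k) has_derivative (\<lambda>w. w *\<^sub>C k)) (at z)"
      using has_derivative_add[OF has_derivative_const bounded_linear.has_derivative[OF
            bounded_linear_scaleC_left has_derivative_ident]] by simp
    then have "(h has_derivative (\<lambda>w. frechet_derivative f (at (x + z *\<^sub>C k)) (w *\<^sub>C k))) (at z)"
      unfolding h_def by (rule has_derivative_compose[where g = f]) (rule D(1))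
    then show ?thesis
      by (simp add: has_field_derivative_def D(2) scaleC_complex_def mult_commute_abs)
  qed
  show "h holomorphic_on ball 0 R"
    unfolding holomorphic_on_open[OF open_ball] using deriv by blast
  show "deriv h 0 = frechet_derivative f (at x) k"
    using DERIV_imp_deriv[OF deriv[of 0]] R by (simp add: scaleC_zero_left)
qed

text \<open>
  One-variable estimates on the disc of radius \<open>r / \<parallel>k\<parallel>\<close> in the line through \<open>x\<close> in the direction
  \<open>k\<close>.  The constants are the same for all \<open>f\<close> in the unit ball, which is why \<open>\<delta>\<close> is
  differentiable in the norm of the dual and not merely pointwise.
\<close>

lemma Hinf_derivative_bounds:
  fixes f :: "'e::complex_normed_vector \<Rightarrow> complex"
  assumes U: "open U" and f: "f \<in> Hinf U type_space" "sup_norm U type_space f \<le> 1"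
    and sub: "ball x r \<subseteq> U" and r: "0 < r"
  shows "norm (frechet_derivative f (at x) k) \<le> 4 / r * norm k"
    and "norm k \<le> r / 4 \<Longrightarrow>
      norm (f (x + k) - f x - frechet_derivative f (at x) k) \<le> 16 / r\<^sup>2 * (norm k)\<^sup>2"
proof -
  have le: "norm (f y) \<le> 1" for y
    using Hinf_norm_le_sup_norm[OF f(1), of y] f(2) by simp
  have x: "x \<in> U"
    using sub r by auto
  have lin: "linear (frechet_derivative f (at x))"
    using Hinf_has_derivative(1)[OF U f(1) x] has_derivative_linear by blast
  show "norm (frechet_derivative f (at x) k) \<le> 4 / r * norm k"
  proof (cases "k = 0")
    case True
    then show ?thesis
      using linear_0[OF lin] by simp
  next
    case False
    have "norm (deriv (\<lambda>z. f (x + z *\<^sub>C k)) 0) \<le> 4 / (r / norm k)"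
      using False r le by (intro deriv_0_bound Hinf_restrict_line(1)[OF U f(1) sub r]) auto
    also have "deriv (\<lambda>z. f (x + z *\<^sub>C k)) 0 = frechet_derivative f (at x) k"
      using False r by (intro Hinf_restrict_line(2)[OF U f(1) sub r, of k "r / norm k"]) auto
    finally show ?thesis
      by simp
  qed
  assume k: "norm k \<le> r / 4"
  show "norm (f (x + k) - f x - frechet_derivative f (at x) k) \<le> 16 / r\<^sup>2 * (norm k)\<^sup>2"
  proof (cases "k = 0")
    case True
    then show ?thesis
      using linear_0[OF lin] by simp
  next
    case False
    have "norm (f (x + 1 *\<^sub>C k) - f (x + 0 *\<^sub>C k) - deriv (\<lambda>z. f (x + z *\<^sub>C k)) 0) \<le> 16 / (r / norm k)\<^sup>2"
      using False r le k
      by (intro first_order_remainder_bound Hinf_restrict_line(1)[OF U f(1) sub r])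
        (auto simp: field_simps)
    also have "deriv (\<lambda>z. f (x + z *\<^sub>C k)) 0 = frechet_derivative f (at x) k"
      using False r by (intro Hinf_restrict_line(2)[OF U f(1) sub r, of k "r / norm k"]) auto
    finally show ?thesis
      by (simp add: scaleC_one scaleC_zero_left power_divide)
  qed
qed

lemma delta_deriv_in_dual:
  fixes U :: "'e::complex_normed_vector set"
  assumes U: "open U" and sub: "ball x r \<subseteq> U" and r: "0 < r"
  shows "delta_deriv U x k \<in> Hinf_dual U"
    "dual_norm U (delta_deriv U x k) \<le> 4 / r * norm k"
proof -
  have x: "x \<in> U"
    using sub r by auto
  note D = Hinf_has_derivative[OF U _ x]
  have le: "norm (delta_deriv U x k f) \<le> 4 / r * norm k"
    if "f \<in> Hinf U type_space" "sup_norm U type_space f \<le> 1" for f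
    using Hinf_derivative_bounds(1)[OF U that sub r] that by (simp add: delta_deriv_def)
  then show "dual_norm U (delta_deriv U x k) \<le> 4 / r * norm k"
    by (rule Hinf_dual_norm_le)
  have scale: "delta_deriv U x k (\<lambda>x. c *\<^sub>C f x) = c *\<^sub>C delta_deriv U x k f"
    if f: "f \<in> Hinf U type_space" for c f
  proof -
    have "frechet_derivative (\<lambda>x. c *\<^sub>C f x) (at x) = (\<lambda>h. c *\<^sub>C frechet_derivative f (at x) h)"
      by (rule frechet_derivative_at[symmetric])
        (rule bounded_linear.has_derivative[OF bounded_linear_scaleC_right D(1)[OF f]])
    then show ?thesis
      using f fun_subspaceD(3)[OF fun_subspace_Hinf f, of c] by (simp add: delta_deriv_def)
  qed
  show "delta_deriv U x k \<in> Hinf_dual U"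
  proof (rule bounded_opsI[where B = "4 / r * norm k"])
    fix f g :: "'e \<Rightarrow> complex"
    assume fg: "f \<in> carrier (Hinf_space U)" "g \<in> carrier (Hinf_space U)"
    then have f: "f \<in> Hinf U type_space" and g: "g \<in> Hinf U type_space"
      by simp_all
    have "frechet_derivative (\<lambda>x. f x + g x) (at x) =
        (\<lambda>h. frechet_derivative f (at x) h + frechet_derivative g (at x) h)"
      by (rule frechet_derivative_at[symmetric]) (rule has_derivative_add[OF D(1)[OF f] D(1)[OF g]])
    then show "delta_deriv U x k (f \<oplus>\<^bsub>Hinf_space U\<^esub> g) = delta_deriv U x k f + delta_deriv U x k g"
      using f g fun_subspaceD(2)[OF fun_subspace_Hinf f g] by (simp add: delta_deriv_def)
  next
    fix f :: "'e \<Rightarrow> complex"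
    assume "f \<in> carrier (Hinf_space U)"
    then show "norm (delta_deriv U x k f) \<le> 4 / r * norm k * vnorm (Hinf_space U) f"
      by (intro complex_normed_space.homogeneous_norm_bound[OF complex_normed_space_Hinf])
        (use le scale in \<open>auto simp: unit_ball_def\<close>)
  qed (use scale in \<open>auto simp: delta_deriv_def\<close>)
qed

lemma delta_first_order:
  fixes U :: "'e::complex_normed_vector set"
  assumes U: "open U" and sub: "ball x r \<subseteq> U" and r: "0 < r" and k: "norm k \<le> r / 4"
  shows "dual_norm U (\<lambda>f. delta U (x + k) f - delta U x f - delta_deriv U x k f)
    \<le> 16 / r\<^sup>2 * (norm k)\<^sup>2"
proof (rule Hinf_dual_norm_le)
  fix f :: "'e \<Rightarrow> complex"
  assume f: "f \<in> Hinf U type_space" "sup_norm U type_space f \<le> 1"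
  show "norm (delta U (x + k) f - delta U x f - delta_deriv U x k f) \<le> 16 / r\<^sup>2 * (norm k)\<^sup>2"
    using Hinf_derivative_bounds(2)[OF U f sub r k] f by (simp add: delta_def delta_deriv_def)
qed

lemma delta_deriv_scale:
  assumes "open U" "x \<in> U"
  shows "delta_deriv U x (c *\<^sub>C k) = (\<lambda>f. c *\<^sub>C delta_deriv U x k f)"
  by (rule ext) (simp add: delta_deriv_def scaleC_zero_right Hinf_has_derivative(2)[OF assms(1) _ assms(2)])

text \<open>
  The difference quotients of \<open>\<delta>\<close> lie in the span of the evaluations and converge to the
  derivative in norm.
\<close>

lemma delta_deriv_in_Ginf:
  fixes U :: "'e::complex_normed_vector set"
  assumes U: "open U" and sub: "ball x r \<subseteq> U" and r: "0 < r"
  shows "delta_deriv U x k \<in> carrier (Ginf U)"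
proof (rule Ginf_closed[OF delta_deriv_in_dual(1)[OF assms]])
  fix e :: real
  assume e: "0 < e"
  have x: "x \<in> U"
    using sub r by auto
  define C where "C = 16 / r\<^sup>2 * (norm k)\<^sup>2"
  have C: "0 \<le> C"
    by (simp add: C_def)
  \<comment> \<open>a step so small that \<open>delta_first_order\<close> applies to \<open>t k\<close> and the quotient is \<open>e\<close>-close\<close>
  define t where "t = min (e / (2 * (C + 1))) (r / (4 * (norm k + 1)))"
  have k1: "0 < norm k + 1"
    by (simp add: add_nonneg_pos)
  have t: "0 < t" "t \<le> e / (2 * (C + 1))" "t \<le> r / (4 * (norm k + 1))"
    using e r C k1 by (simp_all add: t_def)
  have "t * (norm k + 1) \<le> r / 4"
    using t(3) k1 by (simp add: field_simps)
  then have tk: "norm (of_real t *\<^sub>C k) \<le> r / 4"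
    using t(1) by (simp add: norm_scaleC distrib_left)
  have tC: "t * C < e"
  proof -
    have "t * (C + 1) \<le> e / 2"
      using t(2) C by (simp add: field_simps)
    then show ?thesis
      using t(1) e by (simp add: distrib_left)
  qed
  define \<psi> where "\<psi> = (\<lambda>f. of_real (1 / t) *\<^sub>C (delta U (x + of_real t *\<^sub>C k) f - delta U x f))"
  have "ball x r \<subseteq> U" "norm (of_real t *\<^sub>C k) < r"
    using sub tk r by auto
  then have "x + of_real t *\<^sub>C k \<in> U"
    by (auto simp: dist_norm)
  then have \<psi>: "\<psi> \<in> carrier (Ginf U)"
    unfolding \<psi>_def using x
    by (intro fun_subspaceD(3)[OF fun_subspace_Ginf] fun_subspace_diff[OF fun_subspace_Ginf] delta_in_Ginf)
  let ?rem = "\<lambda>f. delta U (x + of_real t *\<^sub>C k) f - delta U x f - delta_deriv U x (of_real t *\<^sub>C k) f"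
  have rem: "?rem \<in> Hinf_dual U"
    by (intro fun_subspace_diff[OF fun_subspace_Hinf_dual] delta_in_dual delta_deriv_in_dual(1)[OF U sub r])
  have "(\<lambda>f. delta_deriv U x k f - \<psi> f) = (\<lambda>f. of_real (- 1 / t) *\<^sub>C ?rem f)"
    using t(1) by (simp add: \<psi>_def delta_deriv_scale[OF U x] scaleC_complex_def algebra_simps)
  then have "dual_norm U (\<lambda>f. delta_deriv U x k f - \<psi> f) =
      norm (of_real (- 1 / t) :: complex) * dual_norm U ?rem"
    using fun_norm_scale[OF complex_normed_space_Hinf_dual fun_subspace_Hinf_dual rem] by simp
  also have "\<dots> \<le> (1 / t) * (16 / r\<^sup>2 * (norm (of_real t *\<^sub>C k))\<^sup>2)"
    using t(1) mult_left_mono[OF delta_first_order[OF U sub r tk], of "1 / t"] by (simp add: norm_divide)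
  also have "\<dots> = t * C"
    using t(1) by (simp add: C_def norm_scaleC power_mult_distrib power2_eq_square)
  finally show "\<exists>\<psi>\<in>carrier (Ginf U). dual_norm U (\<lambda>f. delta_deriv U x k f - \<psi> f) < e"
    using \<psi> tC by (intro bexI[of _ \<psi>]) auto
qed

lemma bounded_clinear_delta_deriv:
  fixes U :: "'e::complex_normed_vector set"
  assumes U: "open U" and sub: "ball x r \<subseteq> U" and r: "0 < r"
  shows "bounded_clinear_on type_space (Ginf U) (delta_deriv U x)"
proof -
  have x: "x \<in> U"
    using sub r by auto
  have "delta_deriv U x (k + l) = (\<lambda>f. delta_deriv U x k f + delta_deriv U x l f)" for k l
    by (rule ext)
      (simp add: delta_deriv_def linear_add[OF has_derivative_linear[OF Hinf_has_derivative(1)[OF U _ x]]])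
  then show ?thesis
    using delta_deriv_in_Ginf[OF assms] delta_deriv_in_dual(2)[OF assms] delta_deriv_scale[OF U x]
    by (auto simp: bounded_clinear_on_def clinear_on_def intro!: exI[of _ "4 / r"])
qed

lemma delta_in_Hinf:
  fixes U :: "'e::complex_normed_vector set"
  assumes U: "open U"
  shows "delta U \<in> Hinf U (Ginf U)"
proof -
  have "\<exists>D. bounded_clinear_on type_space (Ginf U) D \<and>
      ((\<lambda>y. vnorm (Ginf U) ((delta U y \<ominus>\<^bsub>Ginf U\<^esub> delta U x) \<ominus>\<^bsub>Ginf U\<^esub> D (y - x)) / norm (y - x)) \<longlongrightarrow> 0)
        (at x within U)" if x: "x \<in> U" for x
  proof -
    obtain r where r: "0 < r" "ball x r \<subseteq> U"
      using U x openE by blast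
    note sub = U r(2,1)
    let ?D = "delta_deriv U x"
    let ?q = "\<lambda>y. dual_norm U (\<lambda>f. delta U y f - delta U x f - ?D (y - x) f) / norm (y - x)"
    have minus: "(\<phi> \<ominus>\<^bsub>Ginf U\<^esub> delta U x) \<ominus>\<^bsub>Ginf U\<^esub> ?D k = (\<lambda>f. \<phi> f - delta U x f - ?D k f)" for \<phi> k
      using delta_in_Ginf[OF x] delta_deriv_in_Ginf[OF sub] by (simp add: minus_Ginf)
    have "(?q \<longlongrightarrow> 0) (at x within U)"
    proof (rule tendsto_sandwich[OF _ _ tendsto_const])
      show "\<forall>\<^sub>F y in at x within U. 0 \<le> ?q y"
        by (intro always_eventually allI divide_nonneg_nonneg
            complex_normed_space.op_norm_nonneg[OF complex_normed_space_Hinf]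
            fun_subspace_diff[OF fun_subspace_Hinf_dual] delta_in_dual delta_deriv_in_dual(1)[OF sub]) simp
      have "\<forall>\<^sub>F y in at x within U. dist y x < r / 4"
        using r(1) by (auto simp: eventually_at intro!: exI[of _ "r / 4"])
      then show "\<forall>\<^sub>F y in at x within U. ?q y \<le> 16 / r\<^sup>2 * norm (y - x)"
      proof (rule eventually_mono)
        fix y
        assume "dist y x < r / 4"
        then have "dual_norm U (\<lambda>f. delta U (x + (y - x)) f - delta U x f - ?D (y - x) f)
            \<le> 16 / r\<^sup>2 * (norm (y - x))\<^sup>2"
          by (intro delta_first_order[OF sub]) (simp add: dist_norm)
        then have "?q y \<le> 16 / r\<^sup>2 * (norm (y - x))\<^sup>2 / norm (y - x)"
          by (intro divide_right_mono) simp_all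
        also have "\<dots> = 16 / r\<^sup>2 * norm (y - x)"
          by (simp add: power2_eq_square)
        finally show "?q y \<le> 16 / r\<^sup>2 * norm (y - x)" .
      qed
      have "((\<lambda>y. 16 / r\<^sup>2 * norm (y - x)) \<longlongrightarrow> 16 / r\<^sup>2 * norm (x - x)) (at x within U)"
        by (intro tendsto_intros)
      then show "((\<lambda>y. 16 / r\<^sup>2 * norm (y - x)) \<longlongrightarrow> 0) (at x within U)"
        by simp
    qed
    then show ?thesis
      using bounded_clinear_delta_deriv[OF sub] by (intro exI[of _ ?D]) (simp add: minus)
  qed
  moreover have "delta U x = (\<lambda>f. 0)" if "x \<notin> U" for x
    using that Hinf_outside[of _ U "type_space :: complex cspace" x] by (auto simp: delta_def)
  ultimately show ?thesis
    using delta_in_Ginf delta_norm_le by (auto simp: Hinf_def holo_on_def intro!: exI[of _ 1])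
qed

text \<open>
  The value 1 is reached because evaluations take the value 1 at the constant function 1.
\<close>

lemma sup_norm_delta:
  fixes U :: "'e::complex_normed_vector set"
  assumes U: "open U"
  shows "sup_norm U (Ginf U) (delta U) = (if U = {} then 0 else 1)"
proof (cases "U = {}")
  case True
  then show ?thesis
    by (simp add: sup_norm_def)
next
  case False
  then obtain x where x: "x \<in> U"
    by blast
  \<comment> \<open>the constant function, cut off outside \<open>U\<close> as members of \<open>H\<^sup>\<infinity>(U)\<close> have to be\<close>
  define one where "one = (\<lambda>y. if y \<in> U then 1 else 0 :: complex)"
  have "(one has_derivative (\<lambda>_. 0)) (at y within U)" if "y \<in> U" for y
    by (rule has_derivative_transform[OF that _ has_derivative_const[of 1]]) (simp add: one_def)
  then have one: "one \<in> Hinf U type_space"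
    by (auto simp: Hinf_type_space_iff one_def scaleC_zero_right intro!: exI[of _ "\<lambda>_. 0"])
  have "1 = norm (delta U x one)"
    using one x by (simp add: delta_def) (simp add: one_def)
  also have "\<dots> \<le> dual_norm U (delta U x) * sup_norm U type_space one"
    by (rule norm_le_Hinf_dual_norm[OF delta_in_dual one])
  also have "\<dots> \<le> dual_norm U (delta U x) * 1"
    by (intro mult_left_mono sup_norm_le complex_normed_space.op_norm_nonneg[OF complex_normed_space_Hinf]
        delta_in_dual) (auto simp: one_def)
  also have "\<dots> \<le> sup_norm U (Ginf U) (delta U)"
    using sup_norm_upper[OF delta_in_Hinf[OF U] x] by simp
  finally have "1 \<le> sup_norm U (Ginf U) (delta U)" .
  moreover have "sup_norm U (Ginf U) (delta U) \<le> 1"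
    using delta_norm_le by (intro sup_norm_le) auto
  ultimately show ?thesis
    using False by simp
qed

section \<open>Linearization\<close>

text \<open>
  This characterizes the value \<open>y = T\<^sub>f \<phi>\<close> without reference to an approximation of \<open>\<phi>\<close> by linear
  combinations of evaluations, so no well-definedness has to be checked.
\<close>

definition represents :: "('e::complex_normed_vector \<Rightarrow> 'f::complex_normed_vector) \<Rightarrow>
    (('e \<Rightarrow> complex) \<Rightarrow> complex) \<Rightarrow> 'f \<Rightarrow> bool"
  where "represents f \<phi> y \<longleftrightarrow> (\<forall>u. cfunctional u \<longrightarrow> u y = \<phi> (\<lambda>x. u (f x)))"

lemma represents_unique: "represents f \<phi> y \<Longrightarrow> represents f \<phi> z \<Longrightarrow> y = z"
  unfolding represents_def by (rule functionals_separate) metis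

lemma Hinf_functional:
  assumes "f \<in> Hinf U type_space" "cfunctional u"
  shows "(\<lambda>x. u (f x)) \<in> Hinf U type_space"
  using Hinf_compose[OF assms(1) cfunctionalD(1)[OF assms(2)]] cfunctionalD(2)[OF assms(2)]
  by (simp add: scaleC_complex_def)

lemma represents_zero: "represents f (\<lambda>_. 0) 0"
  by (simp add: represents_def cfunctionalD)

lemma represents_add:
  "represents f \<phi> y \<Longrightarrow> represents f \<psi> z \<Longrightarrow> represents f (\<lambda>g. \<phi> g + \<psi> g) (y + z)"
  by (simp add: represents_def cfunctionalD)

lemma represents_scale: "represents f \<phi> y \<Longrightarrow> represents f (\<lambda>g. c *\<^sub>C \<phi> g) (c *\<^sub>C y)"
  by (simp add: represents_def cfunctionalD scaleC_complex_def)

lemma represents_diff: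
  "represents f \<phi> y \<Longrightarrow> represents f \<psi> z \<Longrightarrow> represents f (\<lambda>g. \<phi> g - \<psi> g) (y - z)"
  by (simp add: represents_def cfunctionalD)

lemma represents_delta: "f \<in> Hinf U type_space \<Longrightarrow> represents f (delta U x) (f x)"
  by (simp add: represents_def delta_def Hinf_functional)

text \<open>
  Test with a functional \<open>u\<close> of norm at most 1 that attains the norm of \<open>y\<close>; then \<open>\<parallel>u \<circ> f\<parallel> \<le> \<parallel>f\<parallel>\<close>.
\<close>

lemma represents_norm_le:
  assumes f: "f \<in> Hinf U type_space" and \<phi>: "\<phi> \<in> Hinf_dual U" and y: "represents f \<phi> y"
  shows "norm y \<le> dual_norm U \<phi> * sup_norm U type_space f"
proof -
  obtain u where u: "cfunctional u" "\<And>x. norm (u x) \<le> norm x" "u y = of_real (norm y)"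
    using norming_functional[of y] by blast
  have "norm y = norm (u y)"
    by (simp add: u(3))
  also have "\<dots> = norm (\<phi> (\<lambda>x. u (f x)))"
    using y u(1) by (simp add: represents_def)
  also have "\<dots> \<le> dual_norm U \<phi> * sup_norm U type_space (\<lambda>x. u (f x))"
    by (rule norm_le_Hinf_dual_norm[OF \<phi> Hinf_functional[OF f u(1)]])
  also have "\<dots> \<le> dual_norm U \<phi> * sup_norm U type_space f"
  proof (intro mult_left_mono sup_norm_le sup_norm_nonneg[OF f])
    show "vnorm type_space (u (f x)) \<le> sup_norm U type_space f" for x
      using order_trans[OF u(2) Hinf_norm_le_sup_norm[OF f]] by simp
    show "0 \<le> dual_norm U \<phi>"
      by (rule complex_normed_space.op_norm_nonneg[OF complex_normed_space_Hinf \<phi>])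
  qed
  finally show ?thesis .
qed

text \<open>
  The norm estimate makes the vectors that belong to approximations \<open>\<psi>\<^sub>n\<close> of \<open>\<phi>\<close> a Cauchy sequence,
  whose limit belongs to \<open>\<phi>\<close>.
\<close>

lemma represents_closed:
  fixes f :: "'e::complex_normed_vector \<Rightarrow> 'f::complex_banach"
  assumes f: "f \<in> Hinf U type_space" and \<phi>: "\<phi> \<in> Hinf_dual U"
    and approx: "\<And>e. 0 < e \<Longrightarrow> \<exists>\<psi>\<in>Hinf_dual U. (\<exists>y. represents f \<psi> y) \<and>
      dual_norm U (\<lambda>g. \<phi> g - \<psi> g) < e"
  shows "\<exists>y. represents f \<phi> y"
proof -
  let ?N = "dual_norm U" and ?B = "sup_norm U type_space f"
  have "\<exists>\<psi> y. \<psi> \<in> Hinf_dual U \<and> represents f \<psi> y \<and> ?N (\<lambda>g. \<phi> g - \<psi> g) < 1 / real (Suc n)" for n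
    using approx[of "1 / real (Suc n)"] by auto
  then obtain \<psi> y where \<psi>: "\<And>n. \<psi> n \<in> Hinf_dual U" "\<And>n. represents f (\<psi> n) (y n)"
    "\<And>n. ?N (\<lambda>g. \<phi> g - \<psi> n g) < 1 / real (Suc n)"
    by metis
  have lim0: "(\<lambda>n. ?N (\<lambda>g. \<phi> g - \<psi> n g)) \<longlonglongrightarrow> 0"
  proof (rule tendsto_sandwich[OF _ _ tendsto_const])
    show "\<forall>\<^sub>F n in sequentially. 0 \<le> ?N (\<lambda>g. \<phi> g - \<psi> n g)"
      by (intro always_eventually allI complex_normed_space.op_norm_nonneg[OF complex_normed_space_Hinf]
          fun_subspace_diff[OF fun_subspace_Hinf_dual] \<phi> \<psi>)
    show "\<forall>\<^sub>F n in sequentially. ?N (\<lambda>g. \<phi> g - \<psi> n g) \<le> 1 / real (Suc n)"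
      by (intro always_eventually allI less_imp_le \<psi>(3))
    show "(\<lambda>n. 1 / real (Suc n)) \<longlonglongrightarrow> 0"
      by (rule LIMSEQ_Suc[OF lim_1_over_n])
  qed
  have "dist (y m) (y n) \<le> (?N (\<lambda>g. \<phi> g - \<psi> m g) + ?N (\<lambda>g. \<phi> g - \<psi> n g)) * ?B" for m n
  proof -
    have "norm (y m - y n) \<le> ?N (\<lambda>g. \<psi> m g - \<psi> n g) * ?B"
      by (intro represents_norm_le f fun_subspace_diff[OF fun_subspace_Hinf_dual] \<psi> represents_diff)
    also have "\<dots> \<le> (?N (\<lambda>g. \<psi> m g - \<phi> g) + ?N (\<lambda>g. \<phi> g - \<psi> n g)) * ?B"
      by (intro mult_right_mono sup_norm_nonneg[OF f]
          fun_norm_triangle_diff[OF complex_normed_space_Hinf_dual fun_subspace_Hinf_dual] \<phi> \<psi>)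
    also have "?N (\<lambda>g. \<psi> m g - \<phi> g) = ?N (\<lambda>g. \<phi> g - \<psi> m g)"
      by (intro fun_norm_minus_commute[OF complex_normed_space_Hinf_dual fun_subspace_Hinf_dual] \<phi> \<psi>)
    finally show ?thesis
      by (simp add: dist_norm)
  qed
  note dist_y = this
  have "Cauchy y"
  proof (rule metric_CauchyI)
    fix e :: real
    assume e: "0 < e"
    have "(\<lambda>n. ?N (\<lambda>g. \<phi> g - \<psi> n g) * ?B) \<longlonglongrightarrow> 0 * ?B"
      by (intro tendsto_intros lim0)
    then have "\<forall>\<^sub>F n in sequentially. ?N (\<lambda>g. \<phi> g - \<psi> n g) * ?B < e / 2"
      using e by (intro order_tendstoD(2)) auto
    then obtain M where M: "\<And>n. M \<le> n \<Longrightarrow> ?N (\<lambda>g. \<phi> g - \<psi> n g) * ?B < e / 2"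
      by (auto simp: eventually_sequentially)
    have "dist (y m) (y n) < e" if "M \<le> m" "M \<le> n" for m n
      using dist_y[of m n] M[OF that(1)] M[OF that(2)] by (simp add: distrib_right)
    then show "\<exists>M. \<forall>m\<ge>M. \<forall>n\<ge>M. dist (y m) (y n) < e"
      by blast
  qed
  then obtain z where z: "y \<longlonglongrightarrow> z"
    using Cauchy_convergent convergent_def by blast
  have "u z = \<phi> (\<lambda>x. u (f x))" if u: "cfunctional u" for u
  proof (rule LIMSEQ_unique)
    show "(\<lambda>n. u (y n)) \<longlonglongrightarrow> u z"
      by (rule bounded_linear.tendsto[OF cfunctionalD(1)[OF u] z])
    let ?g = "\<lambda>x. u (f x)"
    have g: "?g \<in> Hinf U type_space"
      by (rule Hinf_functional[OF f u])
    have "(\<lambda>n. \<phi> ?g - \<psi> n ?g) \<longlonglongrightarrow> 0"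
    proof (rule Lim_null_comparison)
      show "\<forall>\<^sub>F n in sequentially. norm (\<phi> ?g - \<psi> n ?g) \<le>
          ?N (\<lambda>g. \<phi> g - \<psi> n g) * sup_norm U type_space ?g"
        by (intro always_eventually allI norm_le_Hinf_dual_norm[OF _ g]
            fun_subspace_diff[OF fun_subspace_Hinf_dual] \<phi> \<psi>)
      show "(\<lambda>n. ?N (\<lambda>g. \<phi> g - \<psi> n g) * sup_norm U type_space ?g) \<longlonglongrightarrow> 0"
        using tendsto_mult_right[OF lim0, of "sup_norm U type_space ?g"] by simp
    qed
    then have "(\<lambda>n. \<psi> n ?g) \<longlonglongrightarrow> \<phi> ?g"
      using tendsto_diff[OF tendsto_const[of "\<phi> ?g"]] by fastforce
    then show "(\<lambda>n. u (y n)) \<longlonglongrightarrow> \<phi> ?g"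
      using \<psi>(2) u by (simp add: represents_def)
  qed
  then show ?thesis
    by (auto simp: represents_def)
qed

lemma represents_exists:
  fixes f :: "'e::complex_normed_vector \<Rightarrow> 'f::complex_banach"
  assumes f: "f \<in> Hinf U type_space" and \<phi>: "\<phi> \<in> carrier (Ginf U)"
  shows "\<exists>y. represents f \<phi> y"
proof -
  let ?W = "{\<phi> \<in> Hinf_dual U. \<exists>y. represents f \<phi> y}"
  have "carrier (Ginf U) \<subseteq> ?W"
  proof (rule Ginf_least)
    show "delta U ` U \<subseteq> ?W"
      using delta_in_dual represents_delta[OF f] by blast
    show "fun_subspace ?W"
      using fun_subspaceD[OF fun_subspace_Hinf_dual] represents_zero represents_add represents_scale
      by (auto simp: fun_subspace_def) blast+
    fix \<phi>
    assume \<phi>: "\<phi> \<in> carrier (Ginf U)" "\<And>e. 0 < e \<Longrightarrow> \<exists>\<psi>\<in>?W. dual_norm U (\<lambda>f. \<phi> f - \<psi> f) < e"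
    have "\<phi> \<in> Hinf_dual U"
      using \<phi>(1) Ginf_subset_dual by blast
    moreover have "\<exists>y. represents f \<phi> y"
      using \<phi>(2) by (intro represents_closed[OF f \<open>\<phi> \<in> Hinf_dual U\<close>]) blast
    ultimately show "\<phi> \<in> ?W"
      by simp
  qed auto
  with \<phi> show ?thesis
    by blast
qed

lemma complex_normed_space_Ginf: "complex_normed_space (Ginf U)"
  using complex_banach_space_Ginf by (rule complex_banach_space.axioms(1))

text \<open>
  The zeros of \<open>S - T\<close> form a closed subspace that contains the evaluations.
\<close>

lemma bounded_ops_Ginf_eqI:
  fixes S T :: "(('e::complex_normed_vector \<Rightarrow> complex) \<Rightarrow> complex) \<Rightarrow> 'f::complex_normed_vector"
  assumes S: "S \<in> bounded_ops (Ginf U)" and T: "T \<in> bounded_ops (Ginf U)"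
    and eq: "\<And>x. x \<in> U \<Longrightarrow> S (delta U x) = T (delta U x)"
  shows "S = T"
proof
  fix \<phi>
  define D where "D = (\<lambda>\<phi>. S \<phi> - T \<phi>)"
  have D: "D \<in> bounded_ops (Ginf U)"
    unfolding D_def
    by (rule fun_subspace_diff[OF complex_normed_space.fun_subspace_bounded_ops[OF complex_normed_space_Ginf] S T])
  note DD = bounded_opsD[OF D, unfolded Ginf_simps]
  note Dle = complex_normed_space.norm_le_op_norm[OF complex_normed_space_Ginf D, unfolded Ginf_simps]
  note D0 = complex_normed_space.op_norm_nonneg[OF complex_normed_space_Ginf D]
  let ?W = "{\<phi> \<in> carrier (Ginf U). D \<phi> = 0}"
  have "carrier (Ginf U) \<subseteq> ?W"
  proof (rule Ginf_least)
    show "delta U ` U \<subseteq> ?W"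
      using delta_in_Ginf eq by (auto simp: D_def)
    have "D (\<lambda>f. 0) = 0"
      using DD(2)[OF fun_subspaceD(1)[OF fun_subspace_Ginf], of 0] by (simp add: scaleC_zero_left)
    then show "fun_subspace ?W"
      using fun_subspaceD[OF fun_subspace_Ginf[of U]] DD(1,2)
      by (auto simp: fun_subspace_def scaleC_zero_right)
    show "?W \<subseteq> Hinf_dual U"
      using Ginf_subset_dual by auto
    fix \<phi>
    assume \<phi>: "\<phi> \<in> carrier (Ginf U)" "\<And>e. 0 < e \<Longrightarrow> \<exists>\<psi>\<in>?W. dual_norm U (\<lambda>f. \<phi> f - \<psi> f) < e"
    have "norm (D \<phi>) \<le> 0 + e" if e: "0 < e" for e
    proof -
      have pos: "0 < op_norm (Ginf U) D + 1"
        using D0 by simp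
      then obtain \<psi> where \<psi>: "\<psi> \<in> carrier (Ginf U)" "D \<psi> = 0"
        "dual_norm U (\<lambda>f. \<phi> f - \<psi> f) < e / (op_norm (Ginf U) D + 1)"
        using \<phi>(2)[of "e / (op_norm (Ginf U) D + 1)"] e by auto
      have diff: "(\<lambda>f. \<phi> f - \<psi> f) \<in> carrier (Ginf U)"
        by (rule fun_subspace_diff[OF fun_subspace_Ginf \<phi>(1) \<psi>(1)])
      have "D \<phi> = D (\<lambda>f. \<phi> f - \<psi> f)"
        using DD(1)[OF diff \<psi>(1)] \<psi>(2) by simp
      then have "norm (D \<phi>) \<le> op_norm (Ginf U) D * dual_norm U (\<lambda>f. \<phi> f - \<psi> f)"
        using Dle[OF diff] by simp
      also have "\<dots> \<le> op_norm (Ginf U) D * (e / (op_norm (Ginf U) D + 1))"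
        using \<psi>(3) D0 by (intro mult_left_mono) auto
      also have "\<dots> \<le> e"
        using pos e by (simp add: field_simps)
      finally show ?thesis
        by simp
    qed
    then have "norm (D \<phi>) \<le> 0"
      by (rule field_le_epsilon)
    with \<phi>(1) show "\<phi> \<in> ?W"
      by simp
  qed
  then show "S \<phi> = T \<phi>"
    using DD(3)[of \<phi>] by (auto simp: D_def)
qed

lemma linearization_exists:
  fixes f :: "'e::complex_normed_vector \<Rightarrow> 'f::complex_banach"
  assumes f: "f \<in> Hinf U type_space"
  obtains T where "T \<in> bounded_ops (Ginf U)" "\<And>x. x \<in> U \<Longrightarrow> T (delta U x) = f x"
    "\<And>\<phi>. \<phi> \<in> carrier (Ginf U) \<Longrightarrow> represents f \<phi> (T \<phi>)"
proof -
  define T where "T \<phi> = (if \<phi> \<in> carrier (Ginf U) then THE y. represents f \<phi> y else 0)" for \<phi>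
  have T_eq: "T \<phi> = y" if "\<phi> \<in> carrier (Ginf U)" "represents f \<phi> y" for \<phi> y
    using that represents_unique[of f \<phi>] by (simp add: T_def the_equality)
  have rep: "represents f \<phi> (T \<phi>)" if "\<phi> \<in> carrier (Ginf U)" for \<phi>
    using represents_exists[OF f that] T_eq[OF that] by auto
  have "T \<in> bounded_ops (Ginf U)"
  proof (rule bounded_opsI[where B = "sup_norm U type_space f"])
    fix \<phi>
    assume \<phi>: "\<phi> \<in> carrier (Ginf U)"
    show "norm (T \<phi>) \<le> sup_norm U type_space f * vnorm (Ginf U) \<phi>"
      using represents_norm_le[OF f _ rep[OF \<phi>]] \<phi> Ginf_subset_dual by (auto simp: mult.commute)
    show "T (c \<odot>\<^bsub>Ginf U\<^esub> \<phi>) = c *\<^sub>C T \<phi>" for c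
      using fun_subspaceD(3)[OF fun_subspace_Ginf \<phi>] represents_scale[OF rep[OF \<phi>]] by (simp add: T_eq)
    fix \<psi>
    assume \<psi>: "\<psi> \<in> carrier (Ginf U)"
    show "T (\<phi> \<oplus>\<^bsub>Ginf U\<^esub> \<psi>) = T \<phi> + T \<psi>"
      using fun_subspaceD(2)[OF fun_subspace_Ginf \<phi> \<psi>] represents_add[OF rep[OF \<phi>] rep[OF \<psi>]]
      by (simp add: T_eq)
  qed (simp add: T_def)
  then show thesis
    using that rep T_eq[OF delta_in_Ginf represents_delta[OF f]] by blast
qed

lemma linearization_eqI:
  fixes f :: "'e::complex_normed_vector \<Rightarrow> 'f::complex_normed_vector"
  assumes "T \<in> bounded_ops (Ginf U)" "\<And>x. x \<in> U \<Longrightarrow> T (delta U x) = f x"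
  shows "linearization U f = T"
  unfolding linearization_def
proof (rule the_equality)
  fix S
  assume "S \<in> bounded_ops (Ginf U) \<and> (\<forall>x\<in>U. S (delta U x) = f x)"
  then show "S = T"
    using assms by (intro bounded_ops_Ginf_eqI[of S U T]) auto
qed (use assms in blast)

lemma linearization_props:
  fixes f :: "'e::complex_normed_vector \<Rightarrow> 'f::complex_banach"
  assumes f: "f \<in> Hinf U type_space"
  shows "linearization U f \<in> bounded_ops (Ginf U)"
    "x \<in> U \<Longrightarrow> linearization U f (delta U x) = f x"
    "\<phi> \<in> carrier (Ginf U) \<Longrightarrow> represents f \<phi> (linearization U f \<phi>)"
  using linearization_exists[OF f] linearization_eqI[of _ U f] by metis+

lemma delta_in_unit_ball: "x \<in> U \<Longrightarrow> delta U x \<in> unit_ball (Ginf U)"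
  by (simp add: unit_ball_def delta_in_Ginf delta_norm_le)

text \<open>
  The polar of \<open>f(U)\<close> is contained in the polar of \<open>T\<^sub>f(B)\<close> because \<open>u(T\<^sub>f \<phi>) = \<phi>(u \<circ> f)\<close>.
\<close>

theorem linearization_p_compact:
  fixes f :: "'e::complex_normed_vector \<Rightarrow> 'f::complex_banach"
  assumes p: "1 \<le> p" and f: "f \<in> Hinf U type_space" and K: "rel_p_compact p (f ` U)"
  shows "rel_p_compact p (linearization U f ` unit_ball (Ginf U))"
    "k_p p (Ginf U) (linearization U f) = m_p p (f ` U)"
proof -
  have polar: "norm (u y) \<le> 1" if y: "y \<in> linearization U f ` unit_ball (Ginf U)"
    and u: "cfunctional u" and le: "\<And>z. z \<in> f ` U \<Longrightarrow> norm (u z) \<le> 1" for u y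
  proof -
    obtain \<phi> where \<phi>: "\<phi> \<in> carrier (Ginf U)" "dual_norm U \<phi> \<le> 1" "y = linearization U f \<phi>"
      using y by (auto simp: unit_ball_def)
    have \<phi>d: "\<phi> \<in> Hinf_dual U"
      using \<phi>(1) Ginf_subset_dual by blast
    have g: "(\<lambda>x. u (f x)) \<in> Hinf U type_space"
      by (rule Hinf_functional[OF f u])
    have "norm (u y) = norm (\<phi> (\<lambda>x. u (f x)))"
      using linearization_props(3)[OF f \<phi>(1)] u by (simp add: represents_def \<phi>(3))
    also have "\<dots> \<le> dual_norm U \<phi> * sup_norm U type_space (\<lambda>x. u (f x))"
      by (rule norm_le_Hinf_dual_norm[OF \<phi>d g])
    also have "\<dots> \<le> 1 * 1"
      using \<phi>(2) le sup_norm_nonneg[OF g]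
      by (intro mult_mono sup_norm_le) auto
    finally show ?thesis
      by simp
  qed
  show T: "rel_p_compact p (linearization U f ` unit_ball (Ginf U))"
    by (rule m_p_polar(1)[OF p K]) (rule polar)
  have "m_p p (linearization U f ` unit_ball (Ginf U)) \<le> m_p p (f ` U)"
    by (rule m_p_polar(2)[OF p K]) (rule polar)
  moreover have "f ` U \<subseteq> linearization U f ` unit_ball (Ginf U)"
  proof
    fix y
    assume "y \<in> f ` U"
    then obtain x where x: "x \<in> U" "y = f x"
      by blast
    then have "delta U x \<in> unit_ball (Ginf U)" "y = linearization U f (delta U x)"
      using delta_in_unit_ball linearization_props(2)[OF f] by auto
    then show "y \<in> linearization U f ` unit_ball (Ginf U)"
      by blast
  qed
  then have "m_p p (f ` U) \<le> m_p p (linearization U f ` unit_ball (Ginf U))"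
    by (rule m_p_mono[OF T])
  ultimately show "k_p p (Ginf U) (linearization U f) = m_p p (f ` U)"
    by (simp add: k_p_def)
qed

section \<open>Factorization through p-compact operators\<close>

context complex_normed_space
begin

lemma bounded_ops_minus:
  fixes T :: "'a \<Rightarrow> 'f::complex_normed_vector"
  assumes T: "T \<in> bounded_ops X" and "x \<in> carrier X" "y \<in> carrier X"
  shows "T (x \<ominus> y) = T x - T y"
proof -
  have "T \<zero> = 0"
    using bounded_opsD(2)[OF T zero_closed, of 0] by (simp add: smult_zero_left scaleC_zero_left)
  then have "T y + T (\<ominus> y) = 0"
    using bounded_opsD(1)[OF T assms(3), of "\<ominus> y"] assms(3) by (simp add: r_neg)
  then have "T (\<ominus> y) = - T y"
    by (simp add: eq_neg_iff_add_eq_0 add.commute)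
  then show ?thesis
    using bounded_opsD(1)[OF T assms(2), of "\<ominus> y"] assms(3) by (simp add: a_minus_def)
qed

text \<open>
  The chain rule: \<open>T\<close> maps the first-order remainder of \<open>g\<close> to the one of \<open>T \<circ> g\<close>, enlarging it at most by
  the factor \<open>\<parallel>T\<parallel>\<close>.
\<close>

lemma Hinf_comp_bounded_op:
  fixes T :: "'a \<Rightarrow> 'f::complex_normed_vector" and g :: "'e::complex_normed_vector \<Rightarrow> 'a"
  assumes g: "g \<in> Hinf U X" and T: "T \<in> bounded_ops X"
  shows "(\<lambda>x. T (g x)) \<in> Hinf U type_space"
proof -
  note Tle = norm_le_op_norm[OF T] and T0 = op_norm_nonneg[OF T]
  have gX: "g x \<in> carrier X" if "x \<in> U" for x
    using g that by (auto simp: Hinf_def holo_on_def)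
  have "\<exists>D. bounded_clinear_on type_space type_space D \<and>
      ((\<lambda>y. norm ((T (g y) - T (g x)) - D (y - x)) / norm (y - x)) \<longlongrightarrow> 0) (at x within U)"
    if x: "x \<in> U" for x
  proof -
    obtain D where D: "bounded_clinear_on type_space X D"
      and lim: "((\<lambda>y. vnorm X ((g y \<ominus> g x) \<ominus> D (y - x)) / norm (y - x)) \<longlongrightarrow> 0) (at x within U)"
      using g x by (auto simp: Hinf_def holo_on_def)
    have DX: "D h \<in> carrier X" for h
      using D by (auto simp: bounded_clinear_on_def clinear_on_def)
    obtain B where B: "\<And>h. vnorm X (D h) \<le> B * norm h"
      using D by (auto simp: bounded_clinear_on_def)
    have "norm (T (D h)) \<le> (op_norm X T * B) * norm h" for h
      using Tle[OF DX, of h] mult_left_mono[OF B T0, of h] by (simp add: mult.assoc)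
    then have "bounded_clinear_on type_space type_space (\<lambda>h. T (D h))"
      using D DX bounded_opsD(1,2)[OF T]
      by (auto simp: bounded_clinear_on_def clinear_on_def intro!: exI[of _ "op_norm X T * B"])
    moreover have "((\<lambda>y. norm ((T (g y) - T (g x)) - T (D (y - x))) / norm (y - x)) \<longlongrightarrow> 0) (at x within U)"
    proof (rule tendsto_sandwich[OF _ _ tendsto_const])
      show "\<forall>\<^sub>F y in at x within U. norm ((T (g y) - T (g x)) - T (D (y - x))) / norm (y - x) \<le>
          op_norm X T * (vnorm X ((g y \<ominus> g x) \<ominus> D (y - x)) / norm (y - x))"
        unfolding eventually_at_filter
      proof (intro always_eventually allI impI)
        fix y
        assume "y \<in> U"
        then have "norm (T ((g y \<ominus> g x) \<ominus> D (y - x))) \<le> op_norm X T * vnorm X ((g y \<ominus> g x) \<ominus> D (y - x))"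
          using gX x DX by (intro Tle) simp
        then show "norm ((T (g y) - T (g x)) - T (D (y - x))) / norm (y - x) \<le>
            op_norm X T * (vnorm X ((g y \<ominus> g x) \<ominus> D (y - x)) / norm (y - x))"
          using gX x DX \<open>y \<in> U\<close> by (simp add: bounded_ops_minus[OF T] divide_right_mono)
      qed
      show "((\<lambda>y. op_norm X T * (vnorm X ((g y \<ominus> g x) \<ominus> D (y - x)) / norm (y - x))) \<longlongrightarrow> 0) (at x within U)"
        using tendsto_mult_left[OF lim, of "op_norm X T"] by simp
    qed simp
    ultimately show ?thesis
      by blast
  qed
  moreover have "norm (T (g x)) \<le> op_norm X T * sup_norm U X g" if "x \<in> U" for x
    using Tle[OF gX[OF that]] mult_left_mono[OF sup_norm_upper[OF g that] T0] by simp
  moreover have "T (g x) = 0" if "x \<notin> U" for x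
    using Hinf_outside[OF g that] bounded_opsD(2)[OF T zero_closed, of 0]
    by (simp add: smult_zero_left scaleC_zero_left)
  ultimately show ?thesis
    unfolding Hinf_def holo_on_def minus_type_space by auto
qed

text \<open>
  A relatively \<open>p\<close>-compact set is bounded, so a \<open>p\<close>-compact linear map is a bounded operator.
\<close>

lemma p_compact_ops_eq:
  assumes p: "1 \<le> p"
  shows "(p_compact_ops p X :: ('a \<Rightarrow> 'f::complex_banach) set) =
    {T \<in> bounded_ops X. rel_p_compact p (T ` unit_ball X)}"
proof -
  have "T \<in> bounded_ops X" if "T \<in> p_compact_ops p X" for T :: "'a \<Rightarrow> 'f"
  proof -
    have T: "clinear_on X type_space T" "rel_p_compact p (T ` unit_ball X)" "\<And>x. x \<notin> carrier X \<Longrightarrow> T x = 0"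
      using that by (auto simp: p_compact_ops_def)
    have "norm (T x) \<le> m_p p (T ` unit_ball X) * vnorm X x" if "x \<in> carrier X" for x
      using T(1) norm_le_m_p[OF p T(2)] that
      by (intro homogeneous_norm_bound) (auto simp: clinear_on_def)
    then show ?thesis
      using T(1,3) by (intro bounded_opsI[where B = "m_p p (T ` unit_ball X)"]) (auto simp: clinear_on_def)
  qed
  then show ?thesis
    by (auto simp: p_compact_ops_def bounded_ops_def bounded_clinear_on_def)
qed

lemma complex_normed_space_p_compact_space:
  assumes p: "1 \<le> p"
  shows "complex_normed_space (p_compact_space p X :: ('a \<Rightarrow> 'f::complex_banach) cspace)"
proof -
  have "T = (\<lambda>x. 0)" if T: "T \<in> bounded_ops X" and 0: "\<And>x. x \<in> unit_ball X \<Longrightarrow> T x = 0" for T :: "'a \<Rightarrow> 'f"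
  proof
    fix x
    show "T x = 0"
    proof (cases "x \<in> carrier X")
      case True
      then have "norm (T x) \<le> 0 * vnorm X x"
        using 0 bounded_opsD(2)[OF T] by (intro homogeneous_norm_bound) auto
      then show ?thesis
        by simp
    qed (rule bounded_opsD(3)[OF T])
  qed
  then show ?thesis
    unfolding p_compact_space_def p_compact_ops_eq[OF p] k_p_def[abs_def]
    by (rule complex_normed_space_m_p(2)[OF p fun_subspace_bounded_ops])
qed

end

text \<open>
  \<open>f(U)\<close> consists of multiples by \<open>\<parallel>g\<parallel>\<close> of elements of \<open>T(B\<^sub>G)\<close>, also if \<open>\<parallel>g\<parallel> = 0\<close>.
\<close>

lemma factorization_m_p_le:
  fixes f :: "'e::complex_normed_vector \<Rightarrow> 'f::complex_banach"
  assumes p: "1 \<le> p" and F: "factorization p U f G g T"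
  shows "rel_p_compact p (f ` U)" "m_p p (f ` U) \<le> k_p p G T * sup_norm U G g"
proof -
  have G: "complex_normed_space G" and g: "g \<in> Hinf U G" and T: "T \<in> p_compact_ops p G"
    and f: "\<And>x. x \<in> U \<Longrightarrow> f x = T (g x)"
    using F by (auto simp: factorization_def complex_banach_space_def)
  interpret complex_normed_space G by fact
  have K: "rel_p_compact p (T ` unit_ball G)" and lin: "clinear_on G type_space T"
    using T by (auto simp: p_compact_ops_def)
  have "\<exists>z\<in>T ` unit_ball G. y = of_real (sup_norm U G g) *\<^sub>C z" if y: "y \<in> f ` U" for y
  proof -
    obtain x where x: "x \<in> U" "y = f x"
      using y by blast
    have "g x \<in> carrier G"
      using g x(1) by (auto simp: Hinf_def holo_on_def)
    then obtain w where w: "w \<in> unit_ball G" "g x = of_real (sup_norm U G g) \<odot>\<^bsub>G\<^esub> w"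
      using unit_ball_normalize[OF _ sup_norm_nonneg[OF g] sup_norm_upper[OF g x(1)]] by blast
    then have "y = of_real (sup_norm U G g) *\<^sub>C T w"
      using f[OF x(1)] x(2) lin by (auto simp: clinear_on_def unit_ball_def)
    with w(1) show ?thesis
      by blast
  qed
  note * = m_p_scale[OF p K this]
  show "rel_p_compact p (f ` U)"
    by (rule *(1))
  show "m_p p (f ` U) \<le> k_p p G T * sup_norm U G g"
    using *(2) sup_norm_nonneg[OF g] by (simp add: k_p_def mult.commute)
qed

text \<open>
  For empty \<open>U\<close> the norm of \<open>\<delta>\<close> is 0 instead of 1, and both sides of the equation vanish.
\<close>

lemma factorization_linearization:
  fixes f :: "'e::complex_normed_vector \<Rightarrow> 'f::complex_banach"
  assumes p: "1 \<le> p" and U: "open U" and f: "f \<in> Hinf U type_space" and K: "rel_p_compact p (f ` U)"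
  shows "factorization p U f (Ginf U) (delta U) (linearization U f)"
    "k_p p (Ginf U) (linearization U f) * sup_norm U (Ginf U) (delta U) = m_p p (f ` U)"
proof -
  interpret complex_normed_space "Ginf U"
    by (rule complex_normed_space_Ginf)
  show "factorization p U f (Ginf U) (delta U) (linearization U f)"
    using linearization_props(1,2)[OF f] linearization_p_compact(1)[OF p f K] delta_in_Hinf[OF U]
      complex_banach_space_Ginf
    by (auto simp: factorization_def p_compact_ops_eq[OF p])
  show "k_p p (Ginf U) (linearization U f) * sup_norm U (Ginf U) (delta U) = m_p p (f ` U)"
    using m_p_subset_zero(2)[OF p, of "{} :: 'f set"]
    by (simp add: linearization_p_compact(2)[OF p f K] sup_norm_delta[OF U])
qed

section \<open>Copies of normed spaces along injections\<close>

text \<open>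
  An isometric copy of \<open>X\<close>.  It moves \<open>G\<^sup>\<infinity>(U)\<close> into the type over which the spaces of a
  factorization range.
\<close>

definition transfer_space :: "('a \<Rightarrow> 'b) \<Rightarrow> 'a cspace \<Rightarrow> 'b cspace"
  where "transfer_space j X = \<lparr>carrier = j ` carrier X, mult = undefined, one = undefined,
    zero = j \<zero>\<^bsub>X\<^esub>, add = (\<lambda>a b. j (the_inv j a \<oplus>\<^bsub>X\<^esub> the_inv j b)),
    smult = (\<lambda>c a. j (c \<odot>\<^bsub>X\<^esub> the_inv j a)), vnorm = (\<lambda>a. vnorm X (the_inv j a))\<rparr>"

lemma transfer_space_simps:
  assumes "inj j"
  shows "carrier (transfer_space j X) = j ` carrier X" "zero (transfer_space j X) = j \<zero>\<^bsub>X\<^esub>"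
    "j x \<oplus>\<^bsub>transfer_space j X\<^esub> j y = j (x \<oplus>\<^bsub>X\<^esub> y)" "c \<odot>\<^bsub>transfer_space j X\<^esub> j x = j (c \<odot>\<^bsub>X\<^esub> x)"
    "vnorm (transfer_space j X) (j x) = vnorm X x"
  by (simp_all add: transfer_space_def the_inv_f_f[OF assms])

context complex_normed_space
begin

context
  fixes j :: "'a \<Rightarrow> 'b"
  assumes j: "inj j"
begin

lemma abelian_group_transfer_space: "abelian_group (transfer_space j X)"
proof (rule abelian_groupI)
  fix y
  assume "y \<in> carrier (transfer_space j X)"
  then obtain x where "x \<in> carrier X" "y = j x"
    by (auto simp: transfer_space_simps[OF j])
  then show "\<exists>z\<in>carrier (transfer_space j X). z \<oplus>\<^bsub>transfer_space j X\<^esub> y = \<zero>\<^bsub>transfer_space j X\<^esub>"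
    by (intro bexI[of _ "j (\<ominus> x)"]) (simp_all add: transfer_space_simps[OF j] l_neg)
qed (auto simp: transfer_space_simps[OF j] a_ac)

lemma minus_transfer_space:
  assumes "x \<in> carrier X" "y \<in> carrier X"
  shows "j x \<ominus>\<^bsub>transfer_space j X\<^esub> j y = j (x \<ominus> y)"
proof -
  interpret Y: abelian_group "transfer_space j X"
    by (rule abelian_group_transfer_space)
  have "\<ominus>\<^bsub>transfer_space j X\<^esub> j y = j (\<ominus> y)"
    by (rule Y.minus_equality) (use assms in \<open>simp_all add: transfer_space_simps[OF j] l_neg\<close>)
  then show ?thesis
    by (simp add: a_minus_def transfer_space_simps[OF j])
qed

lemma complex_normed_space_transfer_space: "complex_normed_space (transfer_space j X)"
proof (intro complex_normed_space.intro complex_normed_space_axioms.intro)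
  show "module (ring_of_type_algebra :: complex ring) (transfer_space j X)"
    by (rule moduleI[OF cring_from_type_algebra abelian_group_transfer_space])
      (auto simp: transfer_space_simps[OF j] smult_carrier smult_l_distr smult_r_distr smult_assoc
        smult_one_complex ring_of_type_algebra_def
        smult_l_distr[unfolded ring_of_type_algebra_def, simplified]
        smult_r_distr[unfolded ring_of_type_algebra_def, simplified])
qed (auto simp: transfer_space_simps[OF j] vnorm_eq_zero vnorm_triangle vnorm_smult inj_eq[OF j])

lemma vdist_transfer_space:
  "x \<in> carrier X \<Longrightarrow> y \<in> carrier X \<Longrightarrow> vdist (transfer_space j X) (j x) (j y) = vdist X x y"
  by (simp add: vdist_def minus_transfer_space transfer_space_simps[OF j])

lemma unit_ball_transfer_space: "unit_ball (transfer_space j X) = j ` unit_ball X"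
  by (auto simp: unit_ball_def transfer_space_simps[OF j])

lemma Hinf_transfer_space:
  fixes g :: "'e::complex_normed_vector \<Rightarrow> 'a"
  assumes g: "g \<in> Hinf U X"
  shows "(\<lambda>x. j (g x)) \<in> Hinf U (transfer_space j X)" "sup_norm U (transfer_space j X) (\<lambda>x. j (g x)) = sup_norm U X g"
proof -
  have gX: "g x \<in> carrier X" if "x \<in> U" for x
    using g that by (auto simp: Hinf_def holo_on_def)
  have "\<exists>D. bounded_clinear_on type_space (transfer_space j X) D \<and>
      ((\<lambda>y. vnorm (transfer_space j X) ((j (g y) \<ominus>\<^bsub>transfer_space j X\<^esub> j (g x)) \<ominus>\<^bsub>transfer_space j X\<^esub> D (y - x)) / norm (y - x)) \<longlongrightarrow> 0) (at x within U)"
    if x: "x \<in> U" for x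
  proof -
    obtain D where D: "bounded_clinear_on type_space X D"
      and lim: "((\<lambda>y. vnorm X ((g y \<ominus> g x) \<ominus> D (y - x)) / norm (y - x)) \<longlongrightarrow> 0) (at x within U)"
      using g x by (auto simp: Hinf_def holo_on_def)
    have DX: "D h \<in> carrier X" for h
      using D by (auto simp: bounded_clinear_on_def clinear_on_def)
    have "bounded_clinear_on type_space (transfer_space j X) (\<lambda>h. j (D h))"
      using D by (auto simp: bounded_clinear_on_def clinear_on_def transfer_space_simps[OF j])
    moreover have "((\<lambda>y. vnorm (transfer_space j X) ((j (g y) \<ominus>\<^bsub>transfer_space j X\<^esub> j (g x)) \<ominus>\<^bsub>transfer_space j X\<^esub> j (D (y - x))) / norm (y - x)) \<longlongrightarrow> 0)
        (at x within U)"
    proof (rule Lim_transform_eventually[OF lim])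
      show "\<forall>\<^sub>F y in at x within U. vnorm X ((g y \<ominus> g x) \<ominus> D (y - x)) / norm (y - x) =
          vnorm (transfer_space j X) ((j (g y) \<ominus>\<^bsub>transfer_space j X\<^esub> j (g x)) \<ominus>\<^bsub>transfer_space j X\<^esub> j (D (y - x))) / norm (y - x)"
        unfolding eventually_at_filter
        by (intro always_eventually allI impI)
          (use gX x DX in \<open>simp add: minus_transfer_space transfer_space_simps[OF j]\<close>)
    qed
    ultimately show ?thesis
      by blast
  qed
  then show "(\<lambda>x. j (g x)) \<in> Hinf U (transfer_space j X)"
    using g gX by (auto simp: Hinf_def holo_on_def transfer_space_simps[OF j])
  show "sup_norm U (transfer_space j X) (\<lambda>x. j (g x)) = sup_norm U X g"
    by (simp add: sup_norm_def transfer_space_simps[OF j])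
qed

end

end

lemma complex_banach_space_transfer_space:
  assumes X: "complex_banach_space X" and j: "inj j"
  shows "complex_banach_space (transfer_space j X)"
proof -
  interpret complex_banach_space X by fact
  let ?Y = "transfer_space j X"
  interpret Y: complex_normed_space ?Y
    by (rule complex_normed_space_transfer_space[OF j])
  interpret MX: Metric_space "carrier X" "vdist X"
    by (rule Metric_space_vdist)
  interpret MY: Metric_space "carrier ?Y" "vdist ?Y"
    by (rule Y.Metric_space_vdist)
  have "MY.mcomplete"
    unfolding MY.mcomplete_def
  proof (intro allI impI)
    fix \<sigma>
    assume C: "MY.MCauchy \<sigma>"
    have "range \<sigma> \<subseteq> carrier ?Y"
      using C unfolding MY.MCauchy_def by blast
    then have "\<sigma> n \<in> j ` carrier X" for n
      by (auto simp: transfer_space_simps(1)[OF j])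
    then have "\<forall>n. \<exists>x. x \<in> carrier X \<and> \<sigma> n = j x"
      by blast
    then obtain \<tau> where \<tau>: "\<And>n. \<tau> n \<in> carrier X" "\<And>n. \<sigma> n = j (\<tau> n)"
      by metis
    have "MX.MCauchy \<tau>"
      using C \<tau> by (auto simp: MY.MCauchy_def MX.MCauchy_def vdist_transfer_space[OF j])
    then obtain x where "limitin MX.mtopology \<tau> x sequentially"
      using complete by (auto simp: MX.mcomplete_def)
    then have "limitin MY.mtopology \<sigma> (j x) sequentially"
      using \<tau> unfolding MX.limit_metric_sequentially MY.limit_metric_sequentially
      by (auto simp: vdist_transfer_space[OF j] transfer_space_simps[OF j])
    then show "\<exists>y. limitin MY.mtopology \<sigma> y sequentially"
      by blast
  qed
  then show ?thesis
    by (intro complex_banach_space.intro complex_banach_space_axioms.intro Y.complex_normed_space_axioms)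
qed

lemma factorization_transfer:
  fixes f :: "'e::complex_normed_vector \<Rightarrow> 'f::complex_normed_vector" and j :: "'g \<Rightarrow> 'k"
  assumes F: "factorization p U f G g T" and j: "inj j"
  obtains g' T' where "factorization p U f (transfer_space j G) g' T'"
    "k_p p (transfer_space j G) T' = k_p p G T" "sup_norm U (transfer_space j G) g' = sup_norm U G g"
proof -
  have G: "complex_banach_space G" and g: "g \<in> Hinf U G" and T: "T \<in> p_compact_ops p G"
    and f: "\<And>x. x \<in> U \<Longrightarrow> f x = T (g x)"
    using F by (auto simp: factorization_def)
  interpret complex_banach_space G by fact
  note simps = transfer_space_simps[OF j]
  define T' where "T' b = (if b \<in> j ` carrier G then T (the_inv j b) else 0)" for b
  have T': "T' (j x) = T x" if "x \<in> carrier G" for x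
    using that by (simp add: T'_def the_inv_f_f[OF j])
  have img: "T' ` unit_ball (transfer_space j G) = T ` unit_ball G"
    unfolding unit_ball_transfer_space[OF j] image_image
    by (rule image_cong) (auto simp: T' unit_ball_def)
  have "clinear_on (transfer_space j G) type_space T'"
    using T by (auto simp: p_compact_ops_def clinear_on_def simps T' smult_carrier)
  then have "T' \<in> p_compact_ops p (transfer_space j G)"
    using T by (simp add: p_compact_ops_def img) (simp add: simps T'_def)
  moreover have "f x = T' (j (g x))" if "x \<in> U" for x
  proof -
    have "g x \<in> carrier G"
      using g that by (auto simp: Hinf_def holo_on_def)
    then show ?thesis
      using f[OF that] by (simp add: T')
  qed
  ultimately have "factorization p U f (transfer_space j G) (\<lambda>x. j (g x)) T'"
    using complex_banach_space_transfer_space[OF G j] Hinf_transfer_space(1)[OF j g]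
    by (simp add: factorization_def)
  then show thesis
    by (rule that) (simp_all add: k_p_def img Hinf_transfer_space(2)[OF j g])
qed

section \<open>The factorization norm and the isometry\<close>

lemma factorization_exists:
  fixes f :: "'e::complex_normed_vector \<Rightarrow> 'f::complex_banach"
    and j :: "(('e \<Rightarrow> complex) \<Rightarrow> complex) \<Rightarrow> 'g"
  assumes p: "1 \<le> p" and U: "open U" and j: "inj j"
    and f: "f \<in> Hinf U type_space" and K: "rel_p_compact p (f ` U)"
  obtains G :: "'g cspace" and g T where "factorization p U f G g T"
    "k_p p G T * sup_norm U G g = m_p p (f ` U)"
proof -
  obtain g T where "factorization p U f (transfer_space j (Ginf U)) g T"
    "k_p p (transfer_space j (Ginf U)) T = k_p p (Ginf U) (linearization U f)"
    "sup_norm U (transfer_space j (Ginf U)) g = sup_norm U (Ginf U) (delta U)"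
    by (rule factorization_transfer[OF factorization_linearization(1)[OF p U f K] j])
  then show thesis
    using that factorization_linearization(2)[OF p U f K] by simp
qed

lemma rel_p_compact_iff_factorization:
  fixes f :: "'e::complex_normed_vector \<Rightarrow> 'f::complex_banach"
    and j :: "(('e \<Rightarrow> complex) \<Rightarrow> complex) \<Rightarrow> 'g"
  assumes p: "1 \<le> p" and U: "open U" and j: "inj j" and f: "f \<in> Hinf U type_space"
  shows "rel_p_compact p (f ` U) \<longleftrightarrow> (\<exists>(G :: 'g cspace) g T. factorization p U f G g T)"
proof
  assume K: "rel_p_compact p (f ` U)"
  obtain G :: "'g cspace" and g T where "factorization p U f G g T"
    by (rule factorization_exists[OF p U j f K])
  then show "\<exists>(G :: 'g cspace) g T. factorization p U f G g T"
    by blast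
next
  assume "\<exists>(G :: 'g cspace) g T. factorization p U f G g T"
  then obtain G :: "'g cspace" and g T where "factorization p U f G g T"
    by blast
  then show "rel_p_compact p (f ` U)"
    by (rule factorization_m_p_le(1)[OF p])
qed

lemma Kp_Hinf_eq:
  fixes j :: "(('e::complex_normed_vector \<Rightarrow> complex) \<Rightarrow> complex) \<Rightarrow> 'g"
  assumes p: "1 \<le> p" and U: "open U" and j: "inj j"
  shows "Kp_Hinf TYPE('g) p U = {f :: 'e \<Rightarrow> 'f::complex_banach. f \<in> Hinf U type_space \<and> rel_p_compact p (f ` U)}"
  unfolding Kp_Hinf_def
  by (rule Collect_cong) (simp add: rel_p_compact_iff_factorization[OF p U j] cong: conj_cong)

lemma Kp_Hinf_norm_eq:
  fixes f :: "'e::complex_normed_vector \<Rightarrow> 'f::complex_banach"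
    and j :: "(('e \<Rightarrow> complex) \<Rightarrow> complex) \<Rightarrow> 'g"
  assumes p: "1 \<le> p" and U: "open U" and j: "inj j"
    and f: "f \<in> Hinf U type_space" and K: "rel_p_compact p (f ` U)"
  shows "Kp_Hinf_norm TYPE('g) p U f = m_p p (f ` U)"
proof -
  obtain G :: "'g cspace" and g T where F: "factorization p U f G g T"
    "k_p p G T * sup_norm U G g = m_p p (f ` U)"
    by (rule factorization_exists[OF p U j f K])
  show ?thesis
    unfolding Kp_Hinf_norm_def
  proof (rule cInf_eq_minimum)
    show "m_p p (f ` U) \<in>
        {k_p p G T * sup_norm U G g | (G :: 'g cspace) g T. factorization p U f G g T}"
      using F by force
  qed (use factorization_m_p_le(2)[OF p] in blast)
qed

text \<open>
  The inverse of the linearization map is composition with \<open>\<delta>\<close>.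
\<close>

lemma isometric_isomorphism_linearization:
  fixes j :: "(('e::complex_normed_vector \<Rightarrow> complex) \<Rightarrow> complex) \<Rightarrow> 'g"
  assumes p: "1 \<le> p" and U: "open U" and j: "inj j"
  shows "isometric_isomorphism (Kp_Hinf_space TYPE('g) p U :: ('e \<Rightarrow> 'f::complex_banach) cspace)
    (p_compact_space p (Ginf U)) (linearization U)"
proof -
  define S where "S = {f :: 'e \<Rightarrow> 'f. f \<in> Hinf U type_space \<and> rel_p_compact p (f ` U)}"
  interpret G: complex_normed_space "Ginf U"
    by (rule complex_normed_space_Ginf)
  note ops = G.p_compact_ops_eq[OF p, where 'f = 'f]
  have space: "Kp_Hinf_space TYPE('g) p U = fun_space S (Kp_Hinf_norm TYPE('g) p U)"
    by (simp add: Kp_Hinf_space_def Kp_Hinf_eq[OF p U j] S_def)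
  have sep: "f = (\<lambda>x. 0)" if "f \<in> Hinf U type_space" "\<And>x. x \<in> U \<Longrightarrow> f x = 0" for f :: "'e \<Rightarrow> 'f"
    using that Hinf_outside[OF that(1)] by fastforce
  have S: "fun_subspace S" "complex_normed_space (fun_space S (\<lambda>f. m_p p (f ` U)))"
    unfolding S_def by (rule complex_normed_space_m_p[OF p fun_subspace_Hinf]; rule sep; assumption)+
  have norm: "Kp_Hinf_norm TYPE('g) p U f = m_p p (f ` U)" if "f \<in> S" for f
    using that by (intro Kp_Hinf_norm_eq[OF p U j]) (simp_all add: S_def)
  have "complex_normed_space (fun_space S (Kp_Hinf_norm TYPE('g) p U))"
    by (rule complex_normed_space_fun_space_cong[OF S(2,1)]) (rule norm)
  moreover have lin_in: "linearization U f \<in> p_compact_ops p (Ginf U)" if "f \<in> S" for f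
    using that linearization_props(1)[of f U] linearization_p_compact(1)[OF p, of f U] by (simp add: S_def ops)
  moreover have lin_add: "linearization U (\<lambda>x. f x + g x) = (\<lambda>\<phi>. linearization U f \<phi> + linearization U g \<phi>)"
    if "f \<in> S" "g \<in> S" for f g
    using that
    by (intro linearization_eqI fun_subspaceD(2)[OF G.fun_subspace_bounded_ops])
      (auto simp: S_def linearization_props)
  moreover have lin_scale: "linearization U (\<lambda>x. c *\<^sub>C f x) = (\<lambda>\<phi>. c *\<^sub>C linearization U f \<phi>)"
    if "f \<in> S" for c f
    using that
    by (intro linearization_eqI fun_subspaceD(3)[OF G.fun_subspace_bounded_ops])
      (auto simp: S_def linearization_props)
  moreover have "bij_betw (linearization U) S (p_compact_ops p (Ginf U))"
  proof (rule bij_betw_byWitness[where f' = "\<lambda>T x. T (delta U x)"])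
    have out: "delta U x = \<zero>\<^bsub>Ginf U\<^esub>" if "x \<notin> U" for x
      by (rule Hinf_outside[OF delta_in_Hinf[OF U] that])
    show "\<forall>f\<in>S. (\<lambda>x. linearization U f (delta U x)) = f"
    proof (intro ballI ext)
      fix f x
      assume f: "f \<in> S"
      then have fH: "f \<in> Hinf U type_space"
        by (simp add: S_def)
      have comp: "(\<lambda>x. linearization U f (delta U x)) \<in> Hinf U type_space"
        by (rule G.Hinf_comp_bounded_op[OF delta_in_Hinf[OF U] linearization_props(1)[OF fH]])
      then show "linearization U f (delta U x) = f x"
        using linearization_props(2)[OF fH] Hinf_outside[OF fH] Hinf_outside[OF comp] by (cases "x \<in> U") auto
    qed
    show "\<forall>T\<in>p_compact_ops p (Ginf U). linearization U (\<lambda>x. T (delta U x) :: 'f) = T"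
      by (auto simp: ops intro!: linearization_eqI)
    show "linearization U ` S \<subseteq> p_compact_ops p (Ginf U)"
      using lin_in by blast
    show "(\<lambda>T x. T (delta U x)) ` p_compact_ops p (Ginf U) \<subseteq> S"
    proof safe
      fix T :: "(('e \<Rightarrow> complex) \<Rightarrow> complex) \<Rightarrow> 'f"
      assume T: "T \<in> p_compact_ops p (Ginf U)"
      then have "(\<lambda>x. T (delta U x)) \<in> Hinf U type_space"
        by (intro G.Hinf_comp_bounded_op[OF delta_in_Hinf[OF U]]) (simp add: ops)
      moreover have "rel_p_compact p ((\<lambda>x. T (delta U x)) ` U)"
      proof (rule rel_p_compact_subset)
        show "rel_p_compact p (T ` unit_ball (Ginf U))"
          using T by (simp add: ops)
        show "(\<lambda>x. T (delta U x)) ` U \<subseteq> T ` unit_ball (Ginf U)"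
          using delta_in_unit_ball by blast
      qed
      ultimately show "(\<lambda>x. T (delta U x)) \<in> S"
        by (simp add: S_def)
    qed
  qed
  moreover have "k_p p (Ginf U) (linearization U f) = Kp_Hinf_norm TYPE('g) p U f" if "f \<in> S" for f
    using that linearization_p_compact(2)[OF p, of f U] norm[OF that] by (simp add: S_def)
  ultimately show ?thesis
    using G.complex_normed_space_p_compact_space[OF p, where 'f = 'f]
    by (auto simp: isometric_isomorphism_def space clinear_on_def p_compact_space_def)
qed

theorem corollary1p4:
  fixes U :: "'e::complex_banach set" and f :: "'e \<Rightarrow> 'f::complex_banach" and p :: real
  assumes "open U" and "1 \<le> p" and "f \<in> Hinf U type_space"
  shows
    "(rel_p_compact p (f ` U) \<longleftrightarrow>
       (\<exists>(G :: ('e, 'h) universe cspace) g T. factorization p U f G g T)) \<and>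
     (rel_p_compact p (f ` U) \<longrightarrow>
       k_p_Hinf p U f = Kp_Hinf_norm TYPE(('e, 'h) universe) p U f \<and>
       factorization p U f (Ginf U) (delta U) (linearization U f) \<and>
       Kp_Hinf_norm TYPE(('e, 'h) universe) p U f =
         k_p p (Ginf U) (linearization U f) * sup_norm U (Ginf U) (delta U)) \<and>
     isometric_isomorphism
       (Kp_Hinf_space TYPE(('e, 'h) universe) p U :: ('e \<Rightarrow> 'f) cspace)
       (p_compact_space p (Ginf U))
       (linearization U)"
proof -
  have j: "inj (Inr :: _ \<Rightarrow> ('e, 'h) universe)"
    by simp
  note U = assms(1) and p = assms(2) and f = assms(3)
  have "rel_p_compact p (f ` U) \<longleftrightarrow> (\<exists>(G :: ('e, 'h) universe cspace) g T. factorization p U f G g T)"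
    by (rule rel_p_compact_iff_factorization[OF p U j f])
  moreover have "k_p_Hinf p U f = Kp_Hinf_norm TYPE(('e, 'h) universe) p U f \<and>
       factorization p U f (Ginf U) (delta U) (linearization U f) \<and>
       Kp_Hinf_norm TYPE(('e, 'h) universe) p U f =
         k_p p (Ginf U) (linearization U f) * sup_norm U (Ginf U) (delta U)" if "rel_p_compact p (f ` U)"
    using factorization_linearization[OF p U f that] Kp_Hinf_norm_eq[OF p U j f that]
    by (simp add: k_p_Hinf_def)
  ultimately show ?thesis
    using isometric_isomorphism_linearization[OF p U j] by blast
qed

end
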